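(* Let $u=(u_{ij})_{1\le i,j\le 4}$ be the matrix of generators of $C(S_4^+)$, let $M\in M_4(A\otimes A\otimes A)$ be the concrete magic unitary defined in the context, and let $P\in\mathbb{C}\langle X_4\rangle$ be a polynomial with $\deg P\le 50$. Then $P(M)=0$ if and only if $P(u)=0$.
   Context: A matrix $N\in M_n(D)$ over a unital $C^*$-algebra $D$ is a magic unitary if $N_{ij}^2=N_{ij}^*=N_{ij}$ and $\sum_{k}N_{ik}=1=\sum_k N_{kj}$ for all $1\le i,j\le n$. $C(S_4^+)$ is the universal unital $C^*$-algebra generated by elements $u_{ij}$, $1\le i,j\le 4$, subject to the relations that $u=(u_{ij})$ is a magic unitary. Let $A=C^*(p,q\mid p^2=p^*=p,\ q^2=q^*=q)$ be the universal unital $C^*$-algebra generated by two projections. Put $$R=\begin{pmatrix} p&0&1-p&0\\ 1-p&0&p&0\\ 0&q&0&1-q\\ 0&1-q&0&q\end{pmatrix}\in M_4(A),$$ and let $M\in M_4(A\otimes A\otimes A)$ be the magic unitary given by $M_{ij}=\sum_{k,l=1}^4 R_{ik}\otimes R_{kl}\otimes R_{lj}$. $\mathbb{C}\langle X_4\rangle$ is the free unital associative algebra on the 16 variables $X_4=\{x_{ij}:1\le i,j\le 4\}$; $\deg P$ is the maximal word length of a monomial occurring in $P$; $P(M)$ and $P(u)$ are obtained by substituting $M_{ij}$, respectively $u_{ij}$, for $x_{ij}$. *)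

theory Defs
  imports "HOL-Analysis.Analysis" "HOL-Library.Poly_Mapping"
begin

section \<open>Unital C*-algebras\<close>

text \<open>
  The zero algebra is admitted (there is no axiom \<open>0 \<noteq> 1\<close>), which is why the class is built on
  \<^class>\<open>monoid_mult\<close> and not on \<^class>\<open>real_normed_algebra_1\<close>.
\<close>

class cstar_algebra = real_normed_algebra + banach + monoid_mult +
  fixes scaleC :: "complex \<Rightarrow> 'a \<Rightarrow> 'a" (infixr "*\<^sub>C" 75)
    and star :: "'a \<Rightarrow> 'a"
  assumes scaleC_add_right: "c *\<^sub>C (x + y) = c *\<^sub>C x + c *\<^sub>C y"
    and scaleC_add_left: "(c + d) *\<^sub>C x = c *\<^sub>C x + d *\<^sub>C x"
    and scaleC_scaleC: "c *\<^sub>C (d *\<^sub>C x) = (c * d) *\<^sub>C x"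
    and scaleR_scaleC: "r *\<^sub>R x = complex_of_real r *\<^sub>C x"
    and mult_scaleC_left: "(c *\<^sub>C x) * y = c *\<^sub>C (x * y)"
    and mult_scaleC_right: "x * (c *\<^sub>C y) = c *\<^sub>C (x * y)"
    and norm_scaleC: "norm (c *\<^sub>C x) = cmod c * norm x"
    and star_add: "star (x + y) = star x + star y"
    and star_scaleC: "star (c *\<^sub>C x) = cnj c *\<^sub>C star x"
    and star_mult: "star (x * y) = star y * star x"
    and star_star: "star (star x) = x"
    and cstar_identity: "norm (star x * x) = (norm x)\<^sup>2"


section \<open>Free algebras\<close>

text \<open>
  The free unital associative algebra on \<open>'x\<close> is the monoid algebra of the free monoid on \<open>'x\<close>.
  \<^typ>\<open>'a \<Rightarrow>\<^sub>0 'b\<close> carries the convolution product when the keys form a monoid in additive notation;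
  hence the concatenation of words is written \<open>+\<close>.
\<close>

datatype 'x word = Word (letters: "'x list")

instantiation word :: (type) monoid_add
begin
definition zero_word :: "'a word" where "zero_word = Word []"
definition plus_word :: "'a word \<Rightarrow> 'a word \<Rightarrow> 'a word"
  where "plus_word v w = Word (letters v @ letters w)"
instance by standard (simp_all add: zero_word_def plus_word_def)
end

type_synonym 'x free_alg = "'x word \<Rightarrow>\<^sub>0 complex"

definition free_deg :: "'x free_alg \<Rightarrow> nat"
  where "free_deg P = Max (insert 0 ((\<lambda>w. length (letters w)) ` Poly_Mapping.keys P))"

definition free_eval :: "('x \<Rightarrow> 'a::cstar_algebra) \<Rightarrow> 'x free_alg \<Rightarrow> 'a"
  where "free_eval v P =
    (\<Sum>w\<in>Poly_Mapping.keys P. Poly_Mapping.lookup P w *\<^sub>C prod_list (map v (letters w)))"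

definition free_scale :: "complex \<Rightarrow> 'x free_alg \<Rightarrow> 'x free_alg"
  where "free_scale c P = Poly_Mapping.single 0 c * P"

text \<open>The free *-algebra on \<open>'x\<close> is the free algebra on the symbols \<open>x\<close> and \<open>x\<^sup>*\<close>.\<close>

datatype 'x letter = Gen 'x | GenStar 'x

type_synonym 'x free_star_alg = "'x letter free_alg"

fun letter_star :: "'x letter \<Rightarrow> 'x letter" where
  "letter_star (Gen x) = GenStar x"
| "letter_star (GenStar x) = Gen x"

definition word_star :: "'x letter word \<Rightarrow> 'x letter word"
  where "word_star w = Word (rev (map letter_star (letters w)))"

text \<open>As \<^const>\<open>word_star\<close> is an involution, the coefficient of \<open>w\<close> in \<open>P\<^sup>*\<close> is the conjugate
  of the coefficient of \<open>w\<^sup>*\<close> in \<open>P\<close>.\<close>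

definition free_star :: "'x free_star_alg \<Rightarrow> 'x free_star_alg"
  where "free_star P = Poly_Mapping.map_key word_star (Poly_Mapping.map cnj P)"

definition free_gen :: "'x \<Rightarrow> 'x free_star_alg"
  where "free_gen x = Poly_Mapping.single (Word [Gen x]) 1"


section \<open>Universal C*-algebras\<close>

definition cstar_seminorm :: "('x free_star_alg \<Rightarrow> real) \<Rightarrow> bool"
  where "cstar_seminorm p \<longleftrightarrow>
    (\<forall>x y. p (x + y) \<le> p x + p y) \<and>
    (\<forall>c x. p (free_scale c x) = cmod c * p x) \<and>
    (\<forall>x y. p (x * y) \<le> p x * p y) \<and>
    (\<forall>x. p (free_star x * x) = (p x)\<^sup>2)"

text \<open>
  A presentation consists of a type of generators and a set of *-polynomials, the relations
  \<open>r = 0\<close>.  The axiom is the usual existence condition for the universal C*-algebra.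
\<close>

class cstar_presentation =
  fixes relations :: "'a free_star_alg set"
  assumes relations_bounded:
    "\<exists>C. \<forall>p. cstar_seminorm p \<longrightarrow> (\<forall>r\<in>relations. p r = 0) \<longrightarrow> p (free_gen x) \<le> C"

text \<open>
  The universal C*-algebra is the Hausdorff completion of the free *-algebra in the largest
  C*-seminorm that vanishes on the relations: Cauchy sequences modulo null sequences.
\<close>

definition admissible :: "('x::cstar_presentation free_star_alg \<Rightarrow> real) \<Rightarrow> bool"
  where "admissible p \<longleftrightarrow> cstar_seminorm p \<and> (\<forall>r\<in>relations. p r = 0)"

definition univ_norm :: "'x::cstar_presentation free_star_alg \<Rightarrow> real"
  where "univ_norm f = (SUP p\<in>Collect admissible. p f)"

definition univ_cauchy :: "(nat \<Rightarrow> 'x::cstar_presentation free_star_alg) \<Rightarrow> bool"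
  where "univ_cauchy X \<longleftrightarrow> (\<forall>e>0. \<exists>N. \<forall>m\<ge>N. \<forall>n\<ge>N. univ_norm (X m - X n) < e)"

definition univ_rel :: "(nat \<Rightarrow> 'x::cstar_presentation free_star_alg) \<Rightarrow>
    (nat \<Rightarrow> 'x free_star_alg) \<Rightarrow> bool"
  where "univ_rel X Y \<longleftrightarrow>
    univ_cauchy X \<and> univ_cauchy Y \<and> (\<lambda>n. univ_norm (X n - Y n)) \<longlonglongrightarrow> 0"


subsection \<open>The universal seminorm\<close>

lemma letter_star_invol [simp]: "letter_star (letter_star x) = x"
  by (cases x) auto

lemma word_star_invol [simp]: "word_star (word_star w) = w"
  by (simp add: word_star_def rev_map comp_def)

lemma inj_word_star: "inj word_star"
  by (metis injI word_star_invol)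

lemma word_star_plus: "word_star (v + w) = word_star w + word_star v"
  by (simp add: word_star_def plus_word_def)

lemma word_star_0 [simp]: "word_star 0 = 0"
  by (simp add: word_star_def zero_word_def)

lemma lookup_free_star: "Poly_Mapping.lookup (free_star P) w = cnj (Poly_Mapping.lookup P (word_star w))"
  by (simp add: free_star_def map_key.rep_eq inj_word_star map.rep_eq when_def)

lemma free_star_single: "free_star (Poly_Mapping.single w c) = Poly_Mapping.single (word_star w) (cnj c)"
  by (rule poly_mapping_eqI) (auto simp: lookup_free_star lookup_single when_def)

lemma free_star_add: "free_star (P + Q) = free_star P + free_star Q"
  by (rule poly_mapping_eqI) (simp add: lookup_free_star lookup_add)

lemma free_star_0 [simp]: "free_star 0 = 0"
  by (rule poly_mapping_eqI) (simp add: lookup_free_star)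

lemma free_star_star [simp]: "free_star (free_star P) = P"
  by (rule poly_mapping_eqI) (simp add: lookup_free_star)

lemma free_star_minus: "free_star (- P) = - free_star P"
  by (rule poly_mapping_eqI) (simp add: lookup_free_star)

lemma free_star_diff: "free_star (P - Q) = free_star P - free_star Q"
  by (rule poly_mapping_eqI) (simp add: lookup_free_star lookup_minus)

lemma free_star_sum: "free_star (sum g I) = (\<Sum>i\<in>I. free_star (g i))"
  by (induction I rule: infinite_finite_induct) (simp_all add: free_star_add)

lemma free_induct [case_names single add]:
  fixes P :: "'x free_alg"
  assumes "\<And>w c. Q (Poly_Mapping.single w c)" and "\<And>f g. Q f \<Longrightarrow> Q g \<Longrightarrow> Q (f + g)"
  shows "Q P"
proof (induction P rule: update_induct)
  case const
  show ?case using assms(1) [of _ 0] by simp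
next
  case (update f a b)
  have "Poly_Mapping.update a b f = f + Poly_Mapping.single a b"
    using update(1) by (intro poly_mapping_eqI) (auto simp: lookup_update lookup_add lookup_single when_def in_keys_iff)
  then show ?case using assms update by simp
qed

lemma free_star_mult: "free_star (P * Q) = free_star Q * free_star P"
proof (induction P rule: free_induct)
  case (single w c)
  show ?case
  proof (induction Q rule: free_induct)
    case (single v d)
    show ?case by (simp add: free_star_single mult_single word_star_plus mult.commute)
  qed (simp add: distrib_left distrib_right free_star_add)
qed (simp add: distrib_left distrib_right free_star_add)

lemma free_scale_single: "free_scale c (Poly_Mapping.single w d) = Poly_Mapping.single w (c * d)"
  by (simp add: free_scale_def mult_single)

lemma free_scale_add_right: "free_scale c (P + Q) = free_scale c P + free_scale c Q"
  by (simp add: free_scale_def distrib_left)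

lemma free_scale_add_left: "free_scale (c + d) P = free_scale c P + free_scale d P"
  by (simp add: free_scale_def distrib_right single_add)

lemma free_scale_scale: "free_scale c (free_scale d P) = free_scale (c * d) P"
  by (simp add: free_scale_def mult.assoc [symmetric] mult_single)

lemma free_scale_1 [simp]: "free_scale 1 P = P"
  by (simp add: free_scale_def)

lemma free_scale_0 [simp]: "free_scale 0 P = 0"
  by (simp add: free_scale_def)

lemma free_scale_minus1: "free_scale (-1) P = - P"
  by (metis add.right_inverse eq_neg_iff_add_eq_0 free_scale_0 free_scale_1 free_scale_add_left add.commute)

lemma free_scale_minus_right: "free_scale c (P - Q) = free_scale c P - free_scale c Q"
  by (simp add: free_scale_def right_diff_distrib)

lemma mult_free_scale_left: "free_scale c P * Q = free_scale c (P * Q)"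
  by (simp add: free_scale_def mult.assoc)

lemma mult_free_scale_right: "P * free_scale c Q = free_scale c (P * Q)"
proof -
  have "P * Poly_Mapping.single 0 c = Poly_Mapping.single 0 c * P"
    by (induction P rule: free_induct)
      (simp_all add: mult_single mult.commute distrib_left distrib_right)
  then show ?thesis by (simp add: free_scale_def mult.assoc [symmetric])
qed

lemma free_star_scale: "free_star (free_scale c P) = free_scale (cnj c) (free_star P)"
  by (induction P rule: free_induct)
    (simp_all add: free_scale_single free_star_single free_scale_add_right free_star_add)

lemma free_star_1 [simp]: "free_star 1 = 1"
  by (metis free_star_single single_one word_star_0 complex_cnj_one)

context
  fixes p :: "'x free_star_alg \<Rightarrow> real"
  assumes p: "cstar_seminorm p"
begin

lemma csn_add: "p (x + y) \<le> p x + p y"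
  and csn_scale: "p (free_scale c x) = cmod c * p x"
  and csn_mult: "p (x * y) \<le> p x * p y"
  and csn_star: "p (free_star x * x) = (p x)\<^sup>2"
  using p unfolding cstar_seminorm_def by auto

lemma csn_0: "p 0 = 0"
  using csn_scale [of 0 0] by simp

lemma csn_minus: "p (- x) = p x"
  using csn_scale [of "-1" x] by (simp add: free_scale_minus1)

lemma csn_nonneg: "0 \<le> p x"
  using csn_add [of x "- x"] by (simp add: csn_0 csn_minus)

lemma csn_diff: "p (x - y) \<le> p x + p y"
  using csn_add [of x "- y"] by (simp add: csn_minus)

lemma csn_diff_commute: "p (x - y) = p (y - x)"
  using csn_minus [of "x - y"] by simp

lemma csn_abs_diff: "\<bar>p x - p y\<bar> \<le> p (x - y)"
  using csn_add [of "x - y" y] csn_add [of "y - x" x] csn_diff_commute [of x y] by simp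

lemma csn_cong: "p (x - y) = 0 \<Longrightarrow> p x = p y"
  using csn_abs_diff [of x y] by simp

lemma csn_star_le: "p x \<le> p (free_star x)"
proof (cases "p x = 0")
  case False
  then have "p x > 0" using csn_nonneg [of x] by simp
  moreover have "p x * p x \<le> p (free_star x) * p x"
    using csn_mult [of "free_star x" x] csn_star [of x] by (simp add: power2_eq_square)
  ultimately show ?thesis by simp
qed (simp add: csn_nonneg)

lemma csn_star_eq: "p (free_star x) = p x"
  using csn_star_le [of x] csn_star_le [of "free_star x"] by simp

lemma csn_idem: 
  assumes "p (x * x - x) = 0" "p (free_star x - x) = 0"
  shows "p x \<le> 1"
proof -
  have "p (free_star x * x - x * x) \<le> p (free_star x - x) * p x"
    using csn_mult [of "free_star x - x" x] by (simp add: left_diff_distrib)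
  then have "p (free_star x * x - x * x) = 0"
    using assms csn_nonneg [of "free_star x * x - x * x"] by simp
  then have "(p x)\<^sup>2 = p x"
    using csn_cong csn_star [of x] assms by metis
  then show ?thesis by (simp add: power2_eq_square) (metis mult_cancel_left1 order.refl zero_le_one)
qed

lemma csn_1: "p 1 \<le> 1"
  by (rule csn_idem) (simp_all add: csn_0)

end

lemma admissible_zero: "admissible (\<lambda>_. 0)"
  by (simp add: admissible_def cstar_seminorm_def)

lemma admissible_csn: "admissible p \<Longrightarrow> cstar_seminorm p"
  by (simp add: admissible_def)

lemma admissible_bounded:
  fixes f :: "'x::cstar_presentation free_star_alg"
  shows "\<exists>C. \<forall>p. admissible p \<longrightarrow> p f \<le> C"
proof (induction f rule: free_induct)
  case (single w c)
  show ?case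
  proof (cases w)
    case (Word l)
    have "\<exists>C. \<forall>p. admissible p \<longrightarrow> p (Poly_Mapping.single (Word l) 1) \<le> C"
    proof (induction l)
      case Nil
      have "Poly_Mapping.single (Word []) 1 = (1 :: 'x free_star_alg)"
        by (metis single_one zero_word_def)
      then show ?case using csn_1 admissible_csn by metis
    next
      case (Cons a l)
      then obtain C where C: "\<And>p. admissible p \<Longrightarrow> p (Poly_Mapping.single (Word l) 1) \<le> C" by blast
      obtain x where x: "a = Gen x \<or> a = GenStar x" by (cases a) auto
      obtain D where D: "\<And>p. admissible p \<Longrightarrow> p (free_gen x) \<le> D"
        using relations_bounded [of x] unfolding admissible_def by blast
      have eq: "Poly_Mapping.single (Word (a # l)) 1 =
          Poly_Mapping.single (Word [a]) 1 * Poly_Mapping.single (Word l) (1::complex)"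
        by (simp add: mult_single plus_word_def)
      have "p (Poly_Mapping.single (Word (a # l)) 1) \<le> D * C" if p: "admissible p" for p
      proof -
        note s = admissible_csn [OF p]
        have "free_star (free_gen x) = Poly_Mapping.single (Word [GenStar x]) 1"
          by (simp add: free_gen_def free_star_single word_star_def)
        then have "p (Poly_Mapping.single (Word [a]) 1) = p (free_gen x)"
          using x csn_star_eq [OF s, of "free_gen x"] by (auto simp: free_gen_def)
        then have "p (Poly_Mapping.single (Word [a]) 1) \<le> D" using D p by simp
        then show ?thesis
          unfolding eq using csn_mult [OF s] csn_nonneg [OF s] C [OF p]
          by (meson mult_mono order_trans)
      qed
      then show ?case by blast
    qed
    then obtain C where C: "\<And>p. admissible p \<Longrightarrow> p (Poly_Mapping.single (Word l) 1) \<le> C" by blast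
    have "p (Poly_Mapping.single w c) \<le> cmod c * C" if p: "admissible p" for p
      using csn_scale [OF admissible_csn [OF p], of c "Poly_Mapping.single w 1"] C [OF p]
      by (simp add: free_scale_single Word mult_left_mono)
    then show ?thesis by blast
  qed
next
  case (add f g)
  then obtain C D where "\<And>p. admissible p \<Longrightarrow> p f \<le> C" "\<And>p. admissible p \<Longrightarrow> p g \<le> D" by blast
  then have "p (f + g) \<le> C + D" if "admissible p" for p
    using csn_add [OF admissible_csn [OF that], of f g] that by (meson add_mono order_trans)
  then show ?case by blast
qed

lemma univ_norm_upper: "admissible p \<Longrightarrow> p f \<le> univ_norm f"
  unfolding univ_norm_def
  by (rule cSUP_upper) (use admissible_bounded [of f] in \<open>auto simp: bdd_above_def\<close>)

lemma univ_norm_least: "(\<And>p. admissible p \<Longrightarrow> p f \<le> C) \<Longrightarrow> univ_norm f \<le> C"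
  unfolding univ_norm_def by (rule cSUP_least) (use admissible_zero in auto)

lemma univ_norm_csn: "cstar_seminorm (univ_norm :: 'x::cstar_presentation free_star_alg \<Rightarrow> real)"
proof -
  have nn: "0 \<le> univ_norm f" for f :: "'x free_star_alg"
    using univ_norm_upper [OF admissible_zero, of f] by simp
  have 1: "univ_norm (x + y) \<le> univ_norm x + univ_norm y" for x y :: "'x free_star_alg"
    by (rule univ_norm_least) (meson add_mono admissible_csn csn_add order_trans univ_norm_upper)
  have 2: "univ_norm (free_scale c x) \<le> cmod c * univ_norm x" for c and x :: "'x free_star_alg"
    by (rule univ_norm_least)
      (metis admissible_csn csn_scale mult_left_mono norm_ge_zero univ_norm_upper)
  have 2: "univ_norm (free_scale c x) = cmod c * univ_norm x" for c and x :: "'x free_star_alg"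
  proof (cases "c = 0")
    case True
    then show ?thesis using nn [of 0] 2 [of 0 x] by simp
  next
    case False
    have "univ_norm x \<le> cmod (inverse c) * univ_norm (free_scale c x)"
      using 2 [of "inverse c" "free_scale c x"] False by (simp add: free_scale_scale)
    then have "cmod c * univ_norm x \<le> univ_norm (free_scale c x)"
      using False by (simp add: norm_inverse norm_divide field_simps)
    with 2 [of c x] show ?thesis by simp
  qed
  have 3: "univ_norm (x * y) \<le> univ_norm x * univ_norm y" for x y :: "'x free_star_alg"
    by (rule univ_norm_least)
      (meson admissible_csn csn_mult csn_nonneg mult_mono nn order_trans univ_norm_upper)
  have 4: "univ_norm (free_star x * x) \<le> (univ_norm x)\<^sup>2" for x :: "'x free_star_alg"
    by (rule univ_norm_least)
      (metis admissible_csn csn_star csn_nonneg power_mono univ_norm_upper)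
  have "univ_norm x \<le> sqrt (univ_norm (free_star x * x))" for x :: "'x free_star_alg"
    by (rule univ_norm_least) (metis admissible_csn csn_star real_le_rsqrt univ_norm_upper)
  then have "(univ_norm x)\<^sup>2 \<le> univ_norm (free_star x * x)" for x :: "'x free_star_alg"
    using nn by (metis power_mono real_sqrt_pow2)
  with 1 2 3 4 show ?thesis unfolding cstar_seminorm_def by (auto intro: antisym)
qed

lemma univ_norm_relation:
  fixes r :: "'x::cstar_presentation free_star_alg"
  assumes "r \<in> relations" shows "univ_norm r = 0"
proof (rule antisym)
  show "univ_norm r \<le> 0" by (rule univ_norm_least) (use assms in \<open>auto simp: admissible_def\<close>)
  show "0 \<le> univ_norm r" by (rule csn_nonneg [OF univ_norm_csn])
qed

lemmas un_add = csn_add [OF univ_norm_csn]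
  and un_scale = csn_scale [OF univ_norm_csn]
  and un_mult = csn_mult [OF univ_norm_csn]
  and un_star = csn_star [OF univ_norm_csn]
  and un_0 [simp] = csn_0 [OF univ_norm_csn]
  and un_minus = csn_minus [OF univ_norm_csn]
  and un_nonneg [simp] = csn_nonneg [OF univ_norm_csn]
  and un_diff_commute = csn_diff_commute [OF univ_norm_csn]
  and un_abs_diff = csn_abs_diff [OF univ_norm_csn]
  and un_star_eq = csn_star_eq [OF univ_norm_csn]


subsection \<open>Completion\<close>

lemma univ_cauchyD:
  assumes "univ_cauchy X" "e > 0"
  obtains N where "\<And>m n. m \<ge> N \<Longrightarrow> n \<ge> N \<Longrightarrow> univ_norm (X m - X n) < e"
  using assms unfolding univ_cauchy_def by blast

lemma univ_cauchy_const [simp]: "univ_cauchy (\<lambda>_. f)"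
  by (simp add: univ_cauchy_def)

lemma univ_cauchy_add:
  assumes "univ_cauchy X" "univ_cauchy Y" shows "univ_cauchy (\<lambda>n. X n + Y n)"
  unfolding univ_cauchy_def
proof (intro allI impI)
  fix e :: real assume "e > 0"
  then obtain M N where M: "\<And>m n. m \<ge> M \<Longrightarrow> n \<ge> M \<Longrightarrow> univ_norm (X m - X n) < e / 2"
    and N: "\<And>m n. m \<ge> N \<Longrightarrow> n \<ge> N \<Longrightarrow> univ_norm (Y m - Y n) < e / 2"
    using assms univ_cauchyD half_gt_zero by metis
  have "univ_norm (X m + Y m - (X n + Y n)) < e" if "m \<ge> max M N" "n \<ge> max M N" for m n
    using M [of m n] N [of m n] that un_add [of "X m - X n" "Y m - Y n"]
    by (simp add: add_diff_add)
  then show "\<exists>N. \<forall>m\<ge>N. \<forall>n\<ge>N. univ_norm (X m + Y m - (X n + Y n)) < e" by blast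
qed

lemma univ_cauchy_scale:
  assumes "univ_cauchy X" shows "univ_cauchy (\<lambda>n. free_scale c (X n))"
  unfolding univ_cauchy_def
proof (intro allI impI)
  fix e :: real assume "e > 0"
  then have "e / (cmod c + 1) > 0" by (simp add: add_nonneg_pos)
  then obtain N where N: "\<And>m n. m \<ge> N \<Longrightarrow> n \<ge> N \<Longrightarrow> univ_norm (X m - X n) < e / (cmod c + 1)"
    using assms univ_cauchyD by metis
  have "univ_norm (free_scale c (X m) - free_scale c (X n)) < e" if "m \<ge> N" "n \<ge> N" for m n
  proof -
    have "univ_norm (free_scale c (X m) - free_scale c (X n)) = cmod c * univ_norm (X m - X n)"
      by (metis free_scale_minus_right un_scale)
    also have "\<dots> \<le> (cmod c + 1) * univ_norm (X m - X n)"
      by (simp add: mult_right_mono)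
    also have "\<dots> < e"
      using N [OF that] by (simp add: pos_less_divide_eq add_nonneg_pos mult.commute)
    finally show ?thesis .
  qed
  then show "\<exists>N. \<forall>m\<ge>N. \<forall>n\<ge>N. univ_norm (free_scale c (X m) - free_scale c (X n)) < e" by blast
qed

lemma univ_cauchy_star:
  assumes "univ_cauchy X" shows "univ_cauchy (\<lambda>n. free_star (X n))"
  using assms unfolding univ_cauchy_def by (simp flip: free_star_diff add: un_star_eq)

lemma univ_cauchy_Cauchy:
  assumes "univ_cauchy X" shows "Cauchy (\<lambda>n. univ_norm (X n))"
  unfolding Cauchy_def dist_real_def
  by (meson assms un_abs_diff univ_cauchyD le_less_trans)

lemma univ_cauchy_convergent: "univ_cauchy X \<Longrightarrow> convergent (\<lambda>n. univ_norm (X n))"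
  by (simp add: Cauchy_convergent univ_cauchy_Cauchy)

lemma univ_cauchy_bounded:
  assumes "univ_cauchy X" obtains B where "B > 0" "\<And>n. univ_norm (X n) \<le> B"
proof -
  have "Bseq (\<lambda>n. univ_norm (X n))"
    using univ_cauchy_convergent [OF assms] convergent_imp_Bseq by blast
  then show ?thesis using that unfolding Bseq_def by auto
qed

lemma mult_diff_mult': "x * y - a * b = x * (y - b) + (x - a) * b" for x :: "'a::ring"
  by (simp add: algebra_simps)

lemma univ_cauchy_mult:
  assumes "univ_cauchy X" "univ_cauchy Y" shows "univ_cauchy (\<lambda>n. X n * Y n)"
  unfolding univ_cauchy_def
proof (intro allI impI)
  fix e :: real assume e: "e > 0"
  obtain B where B: "B > 0" "\<And>n. univ_norm (X n) \<le> B" using univ_cauchy_bounded assms by blast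
  obtain C where C: "C > 0" "\<And>n. univ_norm (Y n) \<le> C" using univ_cauchy_bounded assms by blast
  have "e / (2 * B) > 0" "e / (2 * C) > 0" using e B C by simp_all
  then obtain M N where M: "\<And>m n. m \<ge> M \<Longrightarrow> n \<ge> M \<Longrightarrow> univ_norm (X m - X n) < e / (2 * C)"
    and N: "\<And>m n. m \<ge> N \<Longrightarrow> n \<ge> N \<Longrightarrow> univ_norm (Y m - Y n) < e / (2 * B)"
    using assms univ_cauchyD by metis
  have "univ_norm (X m * Y m - X n * Y n) < e" if "m \<ge> max M N" "n \<ge> max M N" for m n
  proof -
    have "univ_norm (X m * Y m - X n * Y n)
        \<le> univ_norm (X m) * univ_norm (Y m - Y n) + univ_norm (X m - X n) * univ_norm (Y n)"
      unfolding mult_diff_mult' by (meson add_mono order_trans un_add un_mult)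
    also have "\<dots> \<le> B * univ_norm (Y m - Y n) + univ_norm (X m - X n) * C"
      using B C by (intro add_mono mult_mono) (auto intro: less_imp_le)
    also have "\<dots> < B * (e / (2 * B)) + e / (2 * C) * C"
      using M [of m n] N [of m n] that B C
      by (intro add_strict_mono mult_strict_left_mono mult_strict_right_mono) auto
    also have "\<dots> = e" using B C by simp
    finally show ?thesis .
  qed
  then show "\<exists>N. \<forall>m\<ge>N. \<forall>n\<ge>N. univ_norm (X m * Y m - X n * Y n) < e" by blast
qed

lemma un_tendsto_le:
  assumes "\<And>n. univ_norm (X n) \<le> g n" "g \<longlonglongrightarrow> 0"
  shows "(\<lambda>n. univ_norm (X n)) \<longlonglongrightarrow> 0"
  by (rule tendsto_sandwich [OF _ _ tendsto_const assms(2)]) (use assms in auto)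

lemma part_equivp_univ_rel: "part_equivp (univ_rel :: (nat \<Rightarrow> 'x::cstar_presentation free_star_alg) \<Rightarrow> _)"
proof (rule part_equivpI)
  show "\<exists>X. univ_rel X (X :: nat \<Rightarrow> 'x free_star_alg)"
    by (rule exI [of _ "\<lambda>_. 0"]) (simp add: univ_rel_def)
  show "symp (univ_rel :: (nat \<Rightarrow> 'x free_star_alg) \<Rightarrow> _)"
    by (auto simp: symp_def univ_rel_def un_diff_commute)
  show "transp (univ_rel :: (nat \<Rightarrow> 'x free_star_alg) \<Rightarrow> _)"
  proof (rule transpI)
    fix X Y Z :: "nat \<Rightarrow> 'x free_star_alg"
    assume a: "univ_rel X Y" "univ_rel Y Z"
    have "(\<lambda>n. univ_norm (X n - Z n)) \<longlonglongrightarrow> 0"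
    proof (rule un_tendsto_le)
      show "univ_norm (X n - Z n) \<le> univ_norm (X n - Y n) + univ_norm (Y n - Z n)" for n
        using un_add [of "X n - Y n" "Y n - Z n"] by simp
      show "(\<lambda>n. univ_norm (X n - Y n) + univ_norm (Y n - Z n)) \<longlonglongrightarrow> 0"
        using a tendsto_add [of _ 0 _ _ 0] by (fastforce simp: univ_rel_def)
    qed
    with a show "univ_rel X Z" by (simp add: univ_rel_def)
  qed
qed

quotient_type (overloaded) 'x univ_cstar =
    "nat \<Rightarrow> 'x::cstar_presentation free_star_alg" / partial: univ_rel
  by (rule part_equivp_univ_rel)

lemma univ_relI:
  assumes "univ_cauchy X" "univ_cauchy Y" "\<And>n. univ_norm (X n - Y n) \<le> g n" "g \<longlonglongrightarrow> 0"
  shows "univ_rel X Y"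
  using assms un_tendsto_le [of "\<lambda>n. X n - Y n" g] by (simp add: univ_rel_def)

lemma univ_rel_refl: "univ_cauchy X \<Longrightarrow> univ_rel X X"
  by (simp add: univ_rel_def)

lemma univ_rel_lim:
  assumes "univ_rel X Y" shows "lim (\<lambda>n. univ_norm (X n)) = lim (\<lambda>n. univ_norm (Y n))"
proof -
  have "(\<lambda>n. univ_norm (X n) - univ_norm (Y n)) \<longlonglongrightarrow> 0"
  proof (rule tendsto_rabs_zero_cancel, rule tendsto_sandwich [OF _ _ tendsto_const])
    show "(\<lambda>n. univ_norm (X n - Y n)) \<longlonglongrightarrow> 0" using assms by (simp add: univ_rel_def)
  qed (auto simp: un_abs_diff)
  moreover have "(\<lambda>n. univ_norm (X n) - univ_norm (Y n)) \<longlonglongrightarrow>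
      lim (\<lambda>n. univ_norm (X n)) - lim (\<lambda>n. univ_norm (Y n))"
    using assms unfolding univ_rel_def
    by (intro tendsto_diff) (auto simp: univ_cauchy_convergent convergent_LIMSEQ_iff [symmetric])
  ultimately show ?thesis using LIMSEQ_unique by fastforce
qed

instantiation univ_cstar :: (cstar_presentation) "{zero, one, plus, times}"
begin

lift_definition zero_univ_cstar :: "'a univ_cstar" is "\<lambda>_. 0"
  by (rule univ_rel_refl) simp

lift_definition one_univ_cstar :: "'a univ_cstar" is "\<lambda>_. 1"
  by (rule univ_rel_refl) simp

lift_definition plus_univ_cstar :: "'a univ_cstar \<Rightarrow> 'a univ_cstar \<Rightarrow> 'a univ_cstar"
  is "\<lambda>X Y n. X n + Y n"
proof -
  fix X X' Y Y' :: "nat \<Rightarrow> 'a free_star_alg"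
  assume a: "univ_rel X X'" "univ_rel Y Y'"
  show "univ_rel (\<lambda>n. X n + Y n) (\<lambda>n. X' n + Y' n)"
  proof (rule univ_relI)
    show "univ_norm (X n + Y n - (X' n + Y' n)) \<le> univ_norm (X n - X' n) + univ_norm (Y n - Y' n)" for n
      using un_add [of "X n - X' n" "Y n - Y' n"] by (simp add: add_diff_add)
    show "(\<lambda>n. univ_norm (X n - X' n) + univ_norm (Y n - Y' n)) \<longlonglongrightarrow> 0"
      using a tendsto_add [of _ 0 _ _ 0] by (fastforce simp: univ_rel_def)
  qed (use a in \<open>auto simp: univ_rel_def intro: univ_cauchy_add\<close>)
qed

lift_definition times_univ_cstar :: "'a univ_cstar \<Rightarrow> 'a univ_cstar \<Rightarrow> 'a univ_cstar"
  is "\<lambda>X Y n. X n * Y n"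
proof -
  fix X X' Y Y' :: "nat \<Rightarrow> 'a free_star_alg"
  assume a: "univ_rel X X'" "univ_rel Y Y'"
  obtain B where B: "B > 0" "\<And>n. univ_norm (X n) \<le> B"
    using univ_cauchy_bounded a unfolding univ_rel_def by blast
  obtain C where C: "C > 0" "\<And>n. univ_norm (Y' n) \<le> C"
    using univ_cauchy_bounded a unfolding univ_rel_def by blast
  show "univ_rel (\<lambda>n. X n * Y n) (\<lambda>n. X' n * Y' n)"
  proof (rule univ_relI)
    show "univ_norm (X n * Y n - X' n * Y' n) \<le>
        B * univ_norm (Y n - Y' n) + univ_norm (X n - X' n) * C" for n
    proof -
      have "univ_norm (X n * Y n - X' n * Y' n) \<le>
          univ_norm (X n) * univ_norm (Y n - Y' n) + univ_norm (X n - X' n) * univ_norm (Y' n)"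
        unfolding mult_diff_mult' by (meson add_mono order_trans un_add un_mult)
      also have "\<dots> \<le> B * univ_norm (Y n - Y' n) + univ_norm (X n - X' n) * C"
        using B C by (intro add_mono mult_mono) (auto intro: less_imp_le)
      finally show ?thesis .
    qed
    show "(\<lambda>n. B * univ_norm (Y n - Y' n) + univ_norm (X n - X' n) * C) \<longlonglongrightarrow> 0"
      using a unfolding univ_rel_def
      by (auto intro!: tendsto_add_zero tendsto_mult_left_zero tendsto_mult_right_zero)
  qed (use a in \<open>auto simp: univ_rel_def intro: univ_cauchy_mult\<close>)
qed

instance ..

end

lift_definition scaleC_univ :: "complex \<Rightarrow> 'x::cstar_presentation univ_cstar \<Rightarrow> 'x univ_cstar"
  is "\<lambda>c X n. free_scale c (X n)"
proof -
  fix c and X Y :: "nat \<Rightarrow> 'x free_star_alg"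
  assume a: "univ_rel X Y"
  show "univ_rel (\<lambda>n. free_scale c (X n)) (\<lambda>n. free_scale c (Y n))"
  proof (rule univ_relI)
    show "univ_norm (free_scale c (X n) - free_scale c (Y n)) \<le> cmod c * univ_norm (X n - Y n)" for n
      by (simp flip: free_scale_minus_right add: un_scale)
    show "(\<lambda>n. cmod c * univ_norm (X n - Y n)) \<longlonglongrightarrow> 0"
      using a by (auto simp: univ_rel_def intro: tendsto_mult_right_zero)
  qed (use a in \<open>auto simp: univ_rel_def intro: univ_cauchy_scale\<close>)
qed

lift_definition star_univ :: "'x::cstar_presentation univ_cstar \<Rightarrow> 'x univ_cstar"
  is "\<lambda>X n. free_star (X n)"
  by (auto simp: univ_rel_def univ_cauchy_star un_star_eq simp flip: free_star_diff)

definition univ_of :: "'x::cstar_presentation free_star_alg \<Rightarrow> 'x univ_cstar"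
  where "univ_of f = abs_univ_cstar (\<lambda>_. f)"

lemma univ_cstar_cases [case_names abs, cases type: univ_cstar]:
  obtains X where "univ_cauchy X" "z = abs_univ_cstar X"
  by (metis Quotient_univ_cstar Quotient_rel_rep Quotient_abs_rep univ_rel_def)

lemma abs_univ_eqI: "univ_rel X Y \<Longrightarrow> abs_univ_cstar X = abs_univ_cstar Y"
  using Quotient_rel_abs [OF Quotient_univ_cstar] .

lemma univ_cauchy_minus: "univ_cauchy X \<Longrightarrow> univ_cauchy (\<lambda>n. - X n)"
  using univ_cauchy_scale [of X "-1"] by (simp add: free_scale_minus1)

lemma univ_cauchy_diff: "univ_cauchy X \<Longrightarrow> univ_cauchy Y \<Longrightarrow> univ_cauchy (\<lambda>n. X n - Y n)"
  using univ_cauchy_add [of X "\<lambda>n. - Y n"] by (simp add: univ_cauchy_minus)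

instantiation univ_cstar :: (cstar_presentation) real_normed_vector
begin

lift_definition norm_univ_cstar :: "'a univ_cstar \<Rightarrow> real"
  is "\<lambda>X. lim (\<lambda>n. univ_norm (X n))"
  by (rule univ_rel_lim)

lemma tendsto_norm_univ:
  fixes X :: "nat \<Rightarrow> 'a free_star_alg"
  assumes "univ_cauchy X"
  shows "(\<lambda>n. univ_norm (X n)) \<longlonglongrightarrow> norm (abs_univ_cstar X)"
  using assms
  by (simp add: norm_univ_cstar.abs_eq univ_rel_refl convergent_LIMSEQ_iff [symmetric] univ_cauchy_convergent)

definition uminus_univ_cstar :: "'a univ_cstar \<Rightarrow> 'a univ_cstar"
  where "- z = scaleC_univ (-1) z"
definition minus_univ_cstar :: "'a univ_cstar \<Rightarrow> 'a univ_cstar \<Rightarrow> 'a univ_cstar"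
  where "y - z = y + - (z :: 'a univ_cstar)"
definition scaleR_univ_cstar :: "real \<Rightarrow> 'a univ_cstar \<Rightarrow> 'a univ_cstar"
  where "r *\<^sub>R z = scaleC_univ (complex_of_real r) z"
definition dist_univ_cstar :: "'a univ_cstar \<Rightarrow> 'a univ_cstar \<Rightarrow> real"
  where "dist y z = norm (y - (z :: 'a univ_cstar))"
definition sgn_univ_cstar :: "'a univ_cstar \<Rightarrow> 'a univ_cstar"
  where "sgn z = inverse (norm z) *\<^sub>R (z :: 'a univ_cstar)"
definition uniformity_univ_cstar :: "('a univ_cstar \<times> 'a univ_cstar) filter"
  where "uniformity_univ_cstar = (INF e\<in>{0 <..}. principal {(x, y). dist x y < e})"
definition open_univ_cstar :: "'a univ_cstar set \<Rightarrow> bool"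
  where "open_univ_cstar U \<longleftrightarrow> (\<forall>x\<in>U. eventually (\<lambda>(x', y). x' = x \<longrightarrow> y \<in> U) uniformity)"

lemmas univ_abs_simps = univ_rel_refl plus_univ_cstar.abs_eq times_univ_cstar.abs_eq
  zero_univ_cstar.abs_eq one_univ_cstar.abs_eq scaleC_univ.abs_eq star_univ.abs_eq
  univ_cauchy_add univ_cauchy_mult univ_cauchy_scale univ_cauchy_star univ_cauchy_minus

lemma abs_univ_minus:
  "univ_cauchy X \<Longrightarrow> - abs_univ_cstar X = abs_univ_cstar (\<lambda>n. - X n :: 'a free_star_alg)"
  by (simp add: uminus_univ_cstar_def univ_abs_simps free_scale_minus1)

lemma abs_univ_diff:
  "univ_cauchy X \<Longrightarrow> univ_cauchy Y \<Longrightarrow>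
    abs_univ_cstar X - abs_univ_cstar Y = abs_univ_cstar (\<lambda>n. X n - Y n :: 'a free_star_alg)"
  by (simp add: minus_univ_cstar_def univ_abs_simps abs_univ_minus)

lemma norm_scaleC_univ: "norm (scaleC_univ c z) = cmod c * norm (z :: 'a univ_cstar)"
proof (cases z)
  case (abs X)
  have "(\<lambda>n. univ_norm (free_scale c (X n))) \<longlonglongrightarrow> cmod c * norm z"
    unfolding un_scale using abs tendsto_norm_univ by (auto intro: tendsto_mult_left)
  moreover have "(\<lambda>n. univ_norm (free_scale c (X n))) \<longlonglongrightarrow> norm (scaleC_univ c z)"
    using abs tendsto_norm_univ univ_cauchy_scale by (auto simp: univ_abs_simps)
  ultimately show ?thesis using LIMSEQ_unique by blast
qed

instance
proof
  fix x y z :: "'a univ_cstar" and a b :: real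
  show "x + y + z = x + (y + z)"
    by (cases x, cases y, cases z) (simp add: univ_abs_simps add.assoc)
  show "x + y = y + x"
    by (cases x, cases y) (simp add: univ_abs_simps add.commute)
  show "0 + x = x"
    by (cases x) (simp add: univ_abs_simps)
  show "- x + x = 0"
    by (cases x) (simp add: univ_abs_simps abs_univ_minus)
  show "x - y = x + - y" by (rule minus_univ_cstar_def)
  show "a *\<^sub>R (x + y) = a *\<^sub>R x + a *\<^sub>R y"
    by (cases x, cases y) (simp add: scaleR_univ_cstar_def univ_abs_simps free_scale_add_right)
  show "(a + b) *\<^sub>R x = a *\<^sub>R x + b *\<^sub>R x"
    by (cases x) (simp add: scaleR_univ_cstar_def univ_abs_simps free_scale_add_left)
  show "a *\<^sub>R b *\<^sub>R x = (a * b) *\<^sub>R x"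
    by (cases x) (simp add: scaleR_univ_cstar_def univ_abs_simps free_scale_scale)
  show "1 *\<^sub>R x = x"
    by (cases x) (simp add: scaleR_univ_cstar_def univ_abs_simps)
  show "dist x y = norm (x - y)" by (rule dist_univ_cstar_def)
  show "sgn x = inverse (norm x) *\<^sub>R x" by (rule sgn_univ_cstar_def)
  show "uniformity = (INF e\<in>{0 <..}. principal {(x, y). dist x (y :: 'a univ_cstar) < e})"
    by (rule uniformity_univ_cstar_def)
  show "open U \<longleftrightarrow> (\<forall>x\<in>U. eventually (\<lambda>(x', y). x' = x \<longrightarrow> y \<in> U) uniformity)"
    for U :: "'a univ_cstar set" by (rule open_univ_cstar_def)
  show "norm x = 0 \<longleftrightarrow> x = 0"
  proof
    assume "norm x = 0"
    then show "x = 0"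
    proof (cases x)
      case (abs X)
      with \<open>norm x = 0\<close> tendsto_norm_univ [of X] have "univ_rel X (\<lambda>_. 0)"
        by (simp add: univ_rel_def)
      with abs show ?thesis by (simp add: zero_univ_cstar.abs_eq abs_univ_eqI)
    qed
  next
    assume "x = 0"
    then show "norm x = 0"
      using tendsto_norm_univ [of "\<lambda>_. 0 :: 'a free_star_alg"]
      by (simp add: zero_univ_cstar.abs_eq LIMSEQ_const_iff)
  qed
  show "norm (x + y) \<le> norm x + norm y"
  proof (cases x, cases y)
    fix X Y assume *: "univ_cauchy X" "x = abs_univ_cstar X" "univ_cauchy Y" "y = abs_univ_cstar Y"
    show ?thesis
    proof (rule LIMSEQ_le)
      show "(\<lambda>n. univ_norm (X n + Y n)) \<longlonglongrightarrow> norm (x + y)"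
        using * tendsto_norm_univ [OF univ_cauchy_add, of X Y] by (simp add: univ_abs_simps)
      show "(\<lambda>n. univ_norm (X n) + univ_norm (Y n)) \<longlonglongrightarrow> norm x + norm y"
        using * by (auto intro!: tendsto_add tendsto_norm_univ)
    qed (use un_add in blast)
  qed
  show "norm (a *\<^sub>R x) = \<bar>a\<bar> * norm x"
    by (simp add: scaleR_univ_cstar_def norm_scaleC_univ)
qed

end

lemma norm_univ_of: "norm (univ_of f) = univ_norm f"
  using tendsto_norm_univ [of "\<lambda>_. f"] by (simp add: univ_of_def LIMSEQ_const_iff)

lemma univ_of_add: "univ_of (f + g) = univ_of f + univ_of g"
  and univ_of_minus: "univ_of (- f) = - univ_of f"
  and univ_of_diff: "univ_of (f - g) = univ_of f - univ_of g"
  and univ_of_mult: "univ_of (f * g) = univ_of f * univ_of g"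
  and univ_of_0: "univ_of 0 = 0"
  and univ_of_1: "univ_of 1 = 1"
  and univ_of_scale: "univ_of (free_scale c f) = scaleC_univ c (univ_of f)"
  and univ_of_star: "univ_of (free_star f) = star_univ (univ_of f)"
  by (simp_all add: univ_of_def univ_abs_simps abs_univ_minus abs_univ_diff)

lemma univ_of_approx:
  assumes X: "univ_cauchy X" and "e > 0"
  obtains N where "\<And>n. n \<ge> N \<Longrightarrow> norm (abs_univ_cstar X - univ_of (X n)) < e"
proof -
  obtain N where N: "\<And>m n. m \<ge> N \<Longrightarrow> n \<ge> N \<Longrightarrow> univ_norm (X m - X n) < e / 2"
    using univ_cauchyD [OF X] \<open>e > 0\<close> half_gt_zero by metis
  have "norm (abs_univ_cstar X - univ_of (X n)) \<le> e / 2" if "n \<ge> N" for n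
  proof (rule LIMSEQ_le_const2)
    have "univ_cauchy (\<lambda>m. X m - X n)" using X by (intro univ_cauchy_diff) auto
    then show "(\<lambda>m. univ_norm (X m - X n)) \<longlonglongrightarrow> norm (abs_univ_cstar X - univ_of (X n))"
      using X by (simp add: univ_of_def abs_univ_diff tendsto_norm_univ)
    show "\<exists>N. \<forall>m\<ge>N. univ_norm (X m - X n) \<le> e / 2"
      using N that less_imp_le by blast
  qed
  then have "norm (abs_univ_cstar X - univ_of (X n)) < e" if "n \<ge> N" for n
    using that \<open>e > 0\<close> by (smt (verit) field_sum_of_halves)
  then show ?thesis using that by blast
qed

lemma univ_of_dense:
  assumes "e > 0" obtains f where "norm (z - univ_of f) < e"
  by (cases z) (metis assms order_refl univ_of_approx)

instance univ_cstar :: (cstar_presentation) banach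
proof
  fix Z :: "nat \<Rightarrow> 'a univ_cstar"
  assume Z: "Cauchy Z"
  have "\<exists>f. norm (Z k - univ_of f) < 1 / Suc k" for k
    by (rule univ_of_dense [of "1 / Suc k" "Z k"]) auto
  then obtain F where F: "\<And>k. norm (Z k - univ_of (F k)) < 1 / Suc k" by meson
  have F0: "(\<lambda>k. Z k - univ_of (F k)) \<longlonglongrightarrow> 0"
    by (rule LIMSEQ_norm_0) (use F in auto)
  have "Cauchy (\<lambda>k. univ_of (F k))"
  proof (rule metric_CauchyI)
    fix e :: real assume "e > 0"
    then have e: "e / 3 > 0" by simp
    obtain M where M: "\<And>m n. m \<ge> M \<Longrightarrow> n \<ge> M \<Longrightarrow> norm (Z m - Z n) < e / 3"
      using CauchyD [OF Z e] by blast
    obtain N where N: "\<And>n. n \<ge> N \<Longrightarrow> norm (Z n - univ_of (F n)) < e / 3"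
      using LIMSEQ_D [OF F0 e] unfolding diff_zero by blast
    have "dist (univ_of (F m)) (univ_of (F n)) < e" if "m \<ge> max M N" "n \<ge> max M N" for m n
    proof -
      have eq: "univ_of (F m) - univ_of (F n)
          = (Z m - Z n) - (Z m - univ_of (F m)) + (Z n - univ_of (F n))" by simp
      have "norm (univ_of (F m) - univ_of (F n))
          \<le> norm (Z m - Z n) + norm (Z m - univ_of (F m)) + norm (Z n - univ_of (F n))"
        unfolding eq using norm_triangle_ineq [of "(Z m - Z n) - (Z m - univ_of (F m))" "Z n - univ_of (F n)"]
          norm_triangle_ineq4 [of "Z m - Z n" "Z m - univ_of (F m)"] by linarith
      with M [of m n] N [of m] N [of n] that show ?thesis by (simp add: dist_norm)
    qed
    then show "\<exists>K. \<forall>m\<ge>K. \<forall>n\<ge>K. dist (univ_of (F m)) (univ_of (F n)) < e" by blast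
  qed
  then have cF: "univ_cauchy F"
    unfolding Cauchy_def univ_cauchy_def dist_norm by (simp flip: univ_of_diff add: norm_univ_of)
  have "(\<lambda>k. univ_of (F k)) \<longlonglongrightarrow> abs_univ_cstar F"
  proof (rule LIMSEQ_I)
    fix e :: real assume "e > 0"
    from univ_of_approx [OF cF this]
    obtain N where "\<And>n. n \<ge> N \<Longrightarrow> norm (abs_univ_cstar F - univ_of (F n)) < e" by blast
    then show "\<exists>N. \<forall>n\<ge>N. norm (univ_of (F n) - abs_univ_cstar F) < e"
      by (metis norm_minus_commute)
  qed
  from tendsto_add [OF F0 this] have "Z \<longlonglongrightarrow> abs_univ_cstar F" by simp
  then show "convergent Z" by (rule convergentI)
qed

instantiation univ_cstar :: (cstar_presentation) cstar_algebra
begin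

definition scaleC_univ_cstar :: "complex \<Rightarrow> 'a univ_cstar \<Rightarrow> 'a univ_cstar"
  where "scaleC_univ_cstar = scaleC_univ"
definition star_univ_cstar :: "'a univ_cstar \<Rightarrow> 'a univ_cstar"
  where "star_univ_cstar = star_univ"

instance
proof
  fix x y z :: "'a univ_cstar" and a b :: real and c d :: complex
  show "x * y * z = x * (y * z)"
    by (cases x, cases y, cases z) (simp add: univ_abs_simps mult.assoc)
  show "(x + y) * z = x * z + y * z"
    by (cases x, cases y, cases z) (simp add: univ_abs_simps distrib_right)
  show "x * (y + z) = x * y + x * z"
    by (cases x, cases y, cases z) (simp add: univ_abs_simps distrib_left)
  show "a *\<^sub>R x * y = a *\<^sub>R (x * y)"
    by (cases x, cases y) (simp add: scaleR_univ_cstar_def univ_abs_simps mult_free_scale_left)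
  show "x * a *\<^sub>R y = a *\<^sub>R (x * y)"
    by (cases x, cases y) (simp add: scaleR_univ_cstar_def univ_abs_simps mult_free_scale_right)
  show "1 * x = x" "x * 1 = x"
    by (cases x, simp add: univ_abs_simps)+
  show "norm (x * y) \<le> norm x * norm y"
  proof (cases x, cases y)
    fix X Y assume *: "univ_cauchy X" "x = abs_univ_cstar X" "univ_cauchy Y" "y = abs_univ_cstar Y"
    show ?thesis
    proof (rule LIMSEQ_le)
      show "(\<lambda>n. univ_norm (X n * Y n)) \<longlonglongrightarrow> norm (x * y)"
        using * tendsto_norm_univ [OF univ_cauchy_mult, of X Y] by (simp add: univ_abs_simps)
      show "(\<lambda>n. univ_norm (X n) * univ_norm (Y n)) \<longlonglongrightarrow> norm x * norm y"
        using * by (auto intro!: tendsto_mult tendsto_norm_univ)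
    qed (use un_mult in blast)
  qed
  show "c *\<^sub>C (x + y) = c *\<^sub>C x + c *\<^sub>C y"
    by (cases x, cases y) (simp add: scaleC_univ_cstar_def univ_abs_simps free_scale_add_right)
  show "(c + d) *\<^sub>C x = c *\<^sub>C x + d *\<^sub>C x"
    by (cases x) (simp add: scaleC_univ_cstar_def univ_abs_simps free_scale_add_left)
  show "c *\<^sub>C d *\<^sub>C x = (c * d) *\<^sub>C x"
    by (cases x) (simp add: scaleC_univ_cstar_def univ_abs_simps free_scale_scale)
  show "a *\<^sub>R x = complex_of_real a *\<^sub>C x"
    by (simp add: scaleC_univ_cstar_def scaleR_univ_cstar_def)
  show "c *\<^sub>C x * y = c *\<^sub>C (x * y)"
    by (cases x, cases y) (simp add: scaleC_univ_cstar_def univ_abs_simps mult_free_scale_left)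
  show "x * c *\<^sub>C y = c *\<^sub>C (x * y)"
    by (cases x, cases y) (simp add: scaleC_univ_cstar_def univ_abs_simps mult_free_scale_right)
  show "norm (c *\<^sub>C x) = cmod c * norm x"
    by (simp add: scaleC_univ_cstar_def norm_scaleC_univ)
  show "star (x + y) = star x + star y"
    by (cases x, cases y) (simp add: star_univ_cstar_def univ_abs_simps free_star_add)
  show "star (c *\<^sub>C x) = cnj c *\<^sub>C star x"
    by (cases x) (simp add: star_univ_cstar_def scaleC_univ_cstar_def univ_abs_simps free_star_scale)
  show "star (x * y) = star y * star x"
    by (cases x, cases y) (simp add: star_univ_cstar_def univ_abs_simps free_star_mult)
  show "star (star x) = x"
    by (cases x) (simp add: star_univ_cstar_def univ_abs_simps)
  show "norm (star x * x) = (norm x)\<^sup>2"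
  proof (cases x)
    case (abs X)
    have "(\<lambda>n. univ_norm (free_star (X n) * X n)) \<longlonglongrightarrow> norm (star x * x)"
      using abs tendsto_norm_univ [OF univ_cauchy_mult [OF univ_cauchy_star], of X X]
      by (simp add: star_univ_cstar_def univ_abs_simps)
    moreover have "(\<lambda>n. univ_norm (free_star (X n) * X n)) \<longlonglongrightarrow> (norm x)\<^sup>2"
      unfolding un_star abs(2) by (rule tendsto_power [OF tendsto_norm_univ [OF abs(1)]])
    ultimately show ?thesis using LIMSEQ_unique by blast
  qed
qed

end

definition univ_gen :: "'x::cstar_presentation \<Rightarrow> 'x univ_cstar"
  where "univ_gen x = univ_of (free_gen x)"

lemma univ_of_relation: "r \<in> relations \<Longrightarrow> univ_of r = 0"
  using norm_univ_of [of r] univ_norm_relation [of r] by simp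

lemma univ_of_scaleC: "univ_of (free_scale c f) = c *\<^sub>C univ_of f"
  by (simp add: univ_of_scale scaleC_univ_cstar_def)

lemma univ_of_free_star: "univ_of (free_star f) = star (univ_of f)"
  by (simp add: univ_of_star star_univ_cstar_def)

lemma univ_of_sum: "univ_of (sum g I) = (\<Sum>i\<in>I. univ_of (g i))"
  by (induction I rule: infinite_finite_induct) (simp_all add: univ_of_add univ_of_0)

lemmas univ_of_simps = univ_of_add univ_of_diff univ_of_mult univ_of_1 univ_of_0
  univ_of_scaleC univ_of_free_star univ_of_sum


section \<open>Magic unitaries and \<open>C(S\<^sub>n\<^sup>+)\<close>\<close>

definition magic_unitary :: "'a::cstar_algebra ^ 'n ^ 'n \<Rightarrow> bool"
  where "magic_unitary N \<longleftrightarrow>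
    (\<forall>i j. N $ i $ j * N $ i $ j = N $ i $ j \<and> star (N $ i $ j) = N $ i $ j) \<and>
    (\<forall>i. (\<Sum>k\<in>UNIV. N $ i $ k) = 1) \<and> (\<forall>j. (\<Sum>k\<in>UNIV. N $ k $ j) = 1)"

datatype 'n magic_gen = MagicGen 'n 'n

instantiation magic_gen :: (finite) cstar_presentation
begin

definition relations_magic_gen :: "'a magic_gen free_star_alg set"
  where "relations_magic_gen =
    (let x = (\<lambda>i j. free_gen (MagicGen i j)) in
      {x i j * x i j - x i j | i j. True} \<union>
      {free_star (x i j) - x i j | i j. True} \<union>
      {(\<Sum>k\<in>UNIV. x i k) - 1 | i. True} \<union>
      {(\<Sum>k\<in>UNIV. x k j) - 1 | j. True})"

instance
proof
  fix x :: "'a magic_gen"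
  obtain i j where x: "x = MagicGen i j" by (cases x)
  have "p (free_gen x) \<le> 1" if "cstar_seminorm p" "\<forall>r\<in>relations. p r = 0"
    for p :: "'a magic_gen free_star_alg \<Rightarrow> real"
    unfolding x by (rule csn_idem [OF that(1)]; rule that(2) [rule_format],
      unfold relations_magic_gen_def Let_def, blast)
  then show "\<exists>C. \<forall>p. cstar_seminorm p \<longrightarrow> (\<forall>r\<in>relations. p r = 0) \<longrightarrow> p (free_gen x) \<le> C"
    by blast
qed

end

type_synonym 'n quantum_perm = "'n magic_gen univ_cstar"

definition quantum_perm_u :: "'n::finite quantum_perm ^ 'n ^ 'n"
  where "quantum_perm_u = (\<chi> i j. univ_gen (MagicGen i j))"

lemma magic_unitary_quantum_perm_u: "magic_unitary (quantum_perm_u :: 'n::finite quantum_perm ^ 'n ^ 'n)"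
proof -
  let ?x = "\<lambda>i j :: 'n. free_gen (MagicGen i j)"
  have "univ_of (?x i j * ?x i j - ?x i j) = 0" "univ_of (free_star (?x i j) - ?x i j) = 0"
    "univ_of ((\<Sum>k\<in>UNIV. ?x i k) - 1) = 0" "univ_of ((\<Sum>k\<in>UNIV. ?x k j) - 1) = 0" for i j
    by (rule univ_of_relation, unfold relations_magic_gen_def Let_def, blast)+
  then show ?thesis
    by (simp add: magic_unitary_def quantum_perm_u_def univ_gen_def univ_of_simps)
qed


section \<open>The C*-algebra generated by two projections\<close>

datatype proj_gen = GenP | GenQ

instantiation proj_gen :: cstar_presentation
begin

definition relations_proj_gen :: "proj_gen free_star_alg set"
  where "relations_proj_gen =
    {free_gen x * free_gen x - free_gen x | x. True} \<union>
    {free_star (free_gen x) - free_gen x | x. True}"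

instance
proof
  fix x :: proj_gen
  have "p (free_gen x) \<le> 1" if "cstar_seminorm p" "\<forall>r\<in>relations. p r = 0"
    for p :: "proj_gen free_star_alg \<Rightarrow> real"
    by (rule csn_idem [OF that(1)]; rule that(2) [rule_format],
      unfold relations_proj_gen_def, blast)
  then show "\<exists>C. \<forall>p. cstar_seminorm p \<longrightarrow> (\<forall>r\<in>relations. p r = 0) \<longrightarrow> p (free_gen x) \<le> C"
    by blast
qed

end

type_synonym two_proj = "proj_gen univ_cstar"

definition proj_p :: two_proj where "proj_p = univ_gen GenP"
definition proj_q :: two_proj where "proj_q = univ_gen GenQ"

lemma univ_gen_proj:
  "univ_gen (x::proj_gen) * univ_gen x = univ_gen x" "star (univ_gen (x::proj_gen)) = univ_gen x"
proof -
  have "univ_of (free_gen x * free_gen x - free_gen x) = 0"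
    "univ_of (free_star (free_gen x) - free_gen x) = 0"
    by (rule univ_of_relation, unfold relations_proj_gen_def, blast)+
  then show "univ_gen x * univ_gen x = univ_gen x" "star (univ_gen x) = univ_gen x"
    by (simp_all add: univ_gen_def univ_of_simps)
qed


section \<open>C*-seminorms on a C*-algebra are dominated by its norm\<close>

lemma scaleC_one [simp]: "1 *\<^sub>C (x::'a::cstar_algebra) = x"
  using scaleR_scaleC [of 1 x] by simp

lemma scaleC_zero_left [simp]: "0 *\<^sub>C (x::'a::cstar_algebra) = 0"
  using scaleR_scaleC [of 0 x] by simp

lemma star_one [simp]: "star (1::'a::cstar_algebra) = 1"
  by (metis mult.right_neutral star_mult star_star)

lemma star_zero [simp]: "star (0::'a::cstar_algebra) = 0"
  by (metis add_cancel_right_left star_add)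

lemma star_minus: "star (- x) = - star (x::'a::cstar_algebra)"
  by (metis add.right_inverse minus_unique star_add star_zero)

lemma star_diff: "star (x - y) = star x - star (y::'a::cstar_algebra)"
  using star_add [of x "- y"] by (simp add: star_minus)

lemma star_sum: "star (sum g I) = (\<Sum>i\<in>I. star (g i :: 'a::cstar_algebra))"
  by (induction I rule: infinite_finite_induct) (simp_all add: star_add)

lemma star_scaleR: "star (r *\<^sub>R x) = r *\<^sub>R star (x::'a::cstar_algebra)"
  by (simp add: scaleR_scaleC star_scaleC)

lemma norm_star_le: "norm x \<le> norm (star (x::'a::cstar_algebra))"
proof (cases "x = 0")
  case False
  have "norm x * norm x \<le> norm (star x) * norm x"
    using norm_mult_ineq [of "star x" x] by (simp add: cstar_identity power2_eq_square)
  with False show ?thesis by simp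
qed simp

lemma bounded_linear_star: "bounded_linear (star :: 'a::cstar_algebra \<Rightarrow> 'a)"
proof (rule bounded_linear_intro)
  show "norm (star x) \<le> norm x * 1" for x :: 'a
    using norm_star_le [of "star x"] by (simp add: star_star)
qed (simp_all add: star_add star_scaleR)

lemma norm_one_le: "norm (1::'a::cstar_algebra) \<le> 1"
proof -
  have "(norm (1::'a))\<^sup>2 = norm (1::'a)" using cstar_identity [of "1::'a"] by simp
  then show ?thesis by (auto simp: power2_eq_square)
qed

lemma norm_power_le: "norm ((x::'a::cstar_algebra) ^ n) \<le> norm x ^ n"
proof (induction n)
  case (Suc n)
  have "norm (x * x ^ n) \<le> norm x * norm (x ^ n)" by (rule norm_mult_ineq)
  also have "\<dots> \<le> norm x * norm x ^ n" by (rule mult_left_mono [OF Suc]) simp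
  finally show ?case by simp
qed (simp add: norm_one_le)

lemma abs_gbinomial_half_le: "\<bar>(1/2::real) gchoose n\<bar> \<le> 1"
proof (induction n)
  case (Suc n)
  have "(1/2::real) gchoose Suc n = ((1/2 - real n) / (real n + 1)) * (1/2 gchoose n)"
    using gbinomial_mult_1 [of "1/2::real" n] by (simp add: field_simps)
  moreover have "\<bar>1/2 - real n\<bar> \<le> real n + 1" by arith
  then have "\<bar>(1/2 - real n) / (real n + 1)\<bar> \<le> 1" by (simp add: abs_divide)
  ultimately show ?case using Suc by (simp only: abs_mult mult_le_one abs_ge_zero)
qed simp

lemma selfadjoint_complement:
  fixes h :: "'a::cstar_algebra"
  assumes h: "star h = h" and h1: "norm h < 1"
  obtains k where "star k = k" "h * k = k * h" "h * h + k * k = 1"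
proof -
  define x where "x = h * h"
  define c where "c n = ((1/2::real) gchoose n) * (-1) ^ n" for n
  define a where "a n = c n *\<^sub>R x ^ n" for n
  have "norm x \<le> norm h * norm h" unfolding x_def by (rule norm_mult_ineq)
  also have "\<dots> < 1" using h1 mult_strict_mono [of "norm h" 1 "norm h" 1] by simp
  finally have x1: "norm x < 1" .
  have "norm (a n) \<le> norm x ^ n" for n
  proof -
    have "norm (a n) = \<bar>(1/2::real) gchoose n\<bar> * norm (x ^ n)" by (simp add: a_def c_def abs_mult power_abs)
    also have "\<dots> \<le> 1 * norm x ^ n"
      by (intro mult_mono abs_gbinomial_half_le norm_power_le) auto
    finally show ?thesis by simp
  qed
  then have sum: "summable (\<lambda>n. norm (a n))"
    by (intro summable_comparison_test [OF _ summable_geometric [of "norm x"]]) (use x1 in auto)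
  then have sa: "summable a" by (rule summable_norm_cancel)
  define k where "k = suminf a"
  have sx: "star x = x" by (simp add: x_def star_mult h)
  have star_pow: "star (x ^ n) = x ^ n" for n
    by (induction n) (simp_all add: star_mult sx power_commutes)
  have comm: "h * x ^ n = x ^ n * h" for n
    by (rule power_commuting_commutes [symmetric]) (simp add: x_def mult.assoc)
  have "star k = k"
    unfolding k_def bounded_linear.suminf [OF bounded_linear_star sa]
    by (simp add: a_def [abs_def] star_scaleR star_pow)
  moreover have "h * k = k * h"
    unfolding k_def suminf_mult [OF sa, symmetric] suminf_mult2 [OF sa]
    by (simp add: a_def [abs_def] comm)
  moreover have "k * k = 1 - h * h"
  proof -
    have conv: "(\<Sum>i\<le>n. a i * a (n - i)) = ((1 gchoose n) * (-1) ^ n) *\<^sub>R x ^ n" for n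
    proof -
      have "(\<Sum>i\<le>n. a i * a (n - i)) = (\<Sum>i\<le>n. (c i * c (n - i)) *\<^sub>R x ^ n)"
        by (rule sum.cong) (simp_all add: a_def mult.commute flip: power_add)
      also have "\<dots> = (\<Sum>i\<le>n. ((1/2 gchoose i) * (1/2 gchoose (n - i))) * (-1) ^ n) *\<^sub>R x ^ n"
        unfolding scaleR_sum_left [symmetric]
        by (rule arg_cong [where f = "\<lambda>r. r *\<^sub>R x ^ n"], rule sum.cong)
          (simp_all add: c_def flip: power_add)
      also have "(\<Sum>i\<le>n. ((1/2 gchoose i) * (1/2 gchoose (n - i))) * (-1) ^ n)
          = ((1::real) gchoose n) * (-1) ^ n"
        using gbinomial_Vandermonde [of "1/2::real" "1/2" n]
        by (simp add: atLeast0AtMost flip: sum_distrib_right)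
      finally show ?thesis .
    qed
    have "(\<lambda>n. ((1 gchoose n) * (-1) ^ n) *\<^sub>R x ^ n) sums (k * k)"
      using Cauchy_product_sums [OF sum sum] by (simp add: conv k_def)
    moreover have "(\<lambda>n. (((1::real) gchoose n) * (-1) ^ n) *\<^sub>R x ^ n) sums
        (\<Sum>n\<in>{0, 1}. (((1::real) gchoose n) * (-1) ^ n) *\<^sub>R x ^ n)"
    proof (rule sums_finite)
      fix n :: nat assume "n \<notin> {0, 1}"
      then have "((1::real) gchoose n) = 0"
        using binomial_gbinomial [of 1 n, where ?'a = real] by (simp add: binomial_eq_0)
      then show "(((1::real) gchoose n) * (-1) ^ n) *\<^sub>R x ^ n = 0" by simp
    qed simp
    ultimately have "k * k = (\<Sum>n\<in>{0, 1}. (((1::real) gchoose n) * (-1) ^ n) *\<^sub>R x ^ n)"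
      by (rule sums_unique2)
    then show ?thesis by (simp add: x_def)
  qed
  ultimately show ?thesis using that by simp
qed

lemma cstar_seminorm_le_norm:
  fixes q :: "'a::cstar_algebra \<Rightarrow> real"
  assumes add: "\<And>x y. q (x + y) \<le> q x + q y"
    and scale: "\<And>c x. q (c *\<^sub>C x) = cmod c * q x"
    and mult: "\<And>x y. q (x * y) \<le> q x * q y"
    and star: "\<And>x. q (star x * x) = (q x)\<^sup>2"
  shows "q a \<le> norm a"
proof -
  have one: "q 1 \<le> 1"
    using star [of 1] by (auto simp: power2_eq_square)
  have sa: "q h \<le> 1" if h: "star h = h" "norm h < 1" for h
  proof -
    obtain k where k: "star k = k" "h * k = k * h" "h * h + k * k = 1"
      using selfadjoint_complement [OF h] by blast
    have minus: "(- c) *\<^sub>C y = - (c *\<^sub>C y)" for c and y :: 'a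
      by (metis add.right_inverse minus_unique scaleC_add_left scaleC_zero_left)
    define u where "u = h + \<i> *\<^sub>C k"
    have su: "star u = h - \<i> *\<^sub>C k"
      by (simp add: u_def star_add star_scaleC h k minus)
    have ii: "\<i> *\<^sub>C k * \<i> *\<^sub>C k = - (k * k)"
      by (simp add: mult_scaleC_left mult_scaleC_right scaleC_scaleC minus)
    have ik: "h * \<i> *\<^sub>C k = \<i> *\<^sub>C k * h"
      by (simp add: mult_scaleC_left mult_scaleC_right k)
    have "star u * u = 1" "u * star u = 1"
      unfolding su unfolding u_def by (simp_all add: distrib_left distrib_right
        left_diff_distrib right_diff_distrib ii ik k)
    then have "(q u)\<^sup>2 \<le> 1" "(q (star u))\<^sup>2 \<le> 1"
      using star [of u] star [of "star u"] one by (simp_all add: star_star)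
    then have "q u \<le> 1" "q (star u) \<le> 1" by (simp_all add: abs_square_le_1)
    moreover have "u + star u = h + h"
      unfolding su by (simp add: u_def)
    then have "h = (1/2) *\<^sub>C (u + star u)"
      using scaleR_scaleC [of "1/2" "u + star u"] by (simp add: scaleR_half_double)
    ultimately show ?thesis
      using scale [of "1/2" "u + star u"] add [of u "star u"] by simp
  qed
  have le1: "q b \<le> 1" if b: "norm b < 1" for b
  proof -
    have "norm (star b * b) < 1"
      using b by (simp add: cstar_identity power_less_one_iff abs_square_less_1)
    then have "(q b)\<^sup>2 \<le> 1"
      using sa [of "star b * b"] star [of b] by (simp add: star_mult star_star)
    then show ?thesis by (simp add: abs_square_le_1)
  qed
  show ?thesis
  proof (rule dense_ge)
    fix t assume t: "norm a < t"
    then have t0: "t > 0" by (meson norm_ge_zero le_less_trans)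
    have "norm (complex_of_real (1 / t) *\<^sub>C a) < 1"
      using t t0 by (simp add: norm_scaleC norm_divide)
    from le1 [OF this] show "q a \<le> t"
      using t0 by (simp add: scale norm_divide)
  qed
qed


section \<open>Tensor products\<close>

text \<open>
  The *-algebra presented by symbols \<open>a \<otimes> b\<close> subject to bilinearity and the componentwise product,
  involution and unit is the algebraic tensor product.  Hence the universal C*-algebra of this
  presentation is the completion of the algebraic tensor product in its largest C*-seminorm,
  i.e. the maximal C*-tensor product.  The C*-algebra generated by two projections is nuclear
  (all its irreducible representations have dimension at most \<open>2\<close>), so its tensor powers carry only
  one C*-norm and the maximal tensor product is also the minimal one.
\<close>

datatype ('a, 'b) tensor_gen = TensorGen 'a 'b

instantiation tensor_gen :: (cstar_algebra, cstar_algebra) cstar_presentation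
begin

definition relations_tensor_gen :: "('a, 'b) tensor_gen free_star_alg set"
  where "relations_tensor_gen =
    (let t = (\<lambda>a b. free_gen (TensorGen a b)) in
      {t (a + a') b - (t a b + t a' b) | a a' b. True} \<union>
      {t a (b + b') - (t a b + t a b') | a b b'. True} \<union>
      {t (c *\<^sub>C a) b - free_scale c (t a b) | c a b. True} \<union>
      {t a (c *\<^sub>C b) - free_scale c (t a b) | c a b. True} \<union>
      {t (a * a') (b * b') - t a b * t a' b' | a a' b b'. True} \<union>
      {t (star a) (star b) - free_star (t a b) | a b. True} \<union>
      {t 1 1 - 1})"

instance
proof
  fix x :: "('a, 'b) tensor_gen"
  obtain a b where x: "x = TensorGen a b" by (cases x)
  let ?t = "\<lambda>a b. free_gen (TensorGen a b) :: ('a, 'b) tensor_gen free_star_alg"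
  have "p (free_gen x) \<le> norm a * norm b" if p: "cstar_seminorm p" and rel: "\<forall>r\<in>relations. p r = 0"
    for p :: "('a, 'b) tensor_gen free_star_alg \<Rightarrow> real"
  proof -
    have 1: "p (?t (a + a') b) = p (?t a b + ?t a' b)" for a a' b
      by (rule csn_cong [OF p], rule rel [rule_format], unfold relations_tensor_gen_def Let_def, blast)
    have 2: "p (?t a (b + b')) = p (?t a b + ?t a b')" for a b b'
      by (rule csn_cong [OF p], rule rel [rule_format], unfold relations_tensor_gen_def Let_def, blast)
    have 3: "p (?t (c *\<^sub>C a) b) = p (free_scale c (?t a b))" for c a b
      by (rule csn_cong [OF p], rule rel [rule_format], unfold relations_tensor_gen_def Let_def, blast)
    have 4: "p (?t a (c *\<^sub>C b)) = p (free_scale c (?t a b))" for c a b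
      by (rule csn_cong [OF p], rule rel [rule_format], unfold relations_tensor_gen_def Let_def, blast)
    have 5: "p (?t (a * a') (b * b')) = p (?t a b * ?t a' b')" for a a' b b'
      by (rule csn_cong [OF p], rule rel [rule_format], unfold relations_tensor_gen_def Let_def, blast)
    have 6: "p (?t (star a) (star b) - free_star (?t a b)) = 0" for a b
      by (rule rel [rule_format], unfold relations_tensor_gen_def Let_def, blast)
    have 7: "p (?t (star a * a) (star b * b)) = (p (?t a b))\<^sup>2" for a b
    proof -
      have "p (?t (star a) (star b) * ?t a b - free_star (?t a b) * ?t a b) \<le> 0"
        using csn_mult [OF p, of "?t (star a) (star b) - free_star (?t a b)" "?t a b"] 6 [of a b]
        by (simp add: left_diff_distrib)
      then have "p (?t (star a) (star b) * ?t a b) = p (free_star (?t a b) * ?t a b)"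
        using csn_nonneg [OF p] by (intro csn_cong [OF p] antisym)
      then show ?thesis by (simp add: 5 csn_star [OF p])
    qed
    have "p (?t a 1) \<le> norm a"
    proof (rule cstar_seminorm_le_norm [where q = "\<lambda>a. p (?t a 1)"])
      show "p (?t (x + y) 1) \<le> p (?t x 1) + p (?t y 1)" for x y
        by (simp add: 1 csn_add [OF p])
      show "p (?t (c *\<^sub>C x) 1) = cmod c * p (?t x 1)" for c x
        by (simp add: 3 csn_scale [OF p])
      show "p (?t (x * y) 1) \<le> p (?t x 1) * p (?t y 1)" for x y
        using 5 [of x y 1 1] csn_mult [OF p, of "?t x 1" "?t y 1"] by simp
      show "p (?t (star x * x) 1) = (p (?t x 1))\<^sup>2" for x
        using 7 [of x 1] by simp
    qed
    moreover have "p (?t 1 b) \<le> norm b"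
    proof (rule cstar_seminorm_le_norm [where q = "\<lambda>b. p (?t 1 b)"])
      show "p (?t 1 (x + y)) \<le> p (?t 1 x) + p (?t 1 y)" for x y
        by (simp add: 2 csn_add [OF p])
      show "p (?t 1 (c *\<^sub>C x)) = cmod c * p (?t 1 x)" for c x
        by (simp add: 4 csn_scale [OF p])
      show "p (?t 1 (x * y)) \<le> p (?t 1 x) * p (?t 1 y)" for x y
        using 5 [of 1 1 x y] csn_mult [OF p, of "?t 1 x" "?t 1 y"] by simp
      show "p (?t 1 (star x * x)) = (p (?t 1 x))\<^sup>2" for x
        using 7 [of 1 x] by simp
    qed
    ultimately have "p (?t a 1) * p (?t 1 b) \<le> norm a * norm b"
      using csn_nonneg [OF p] by (intro mult_mono) auto
    then show ?thesis
      using 5 [of a 1 1 b] csn_mult [OF p, of "?t a 1" "?t 1 b"] by (simp add: x)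
  qed
  then show "\<exists>C. \<forall>p. cstar_seminorm p \<longrightarrow> (\<forall>r\<in>relations. p r = 0) \<longrightarrow> p (free_gen x) \<le> C"
    by blast
qed

end

type_synonym ('a, 'b) cstar_tensor = "('a, 'b) tensor_gen univ_cstar"

definition tensor :: "'a::cstar_algebra \<Rightarrow> 'b::cstar_algebra \<Rightarrow> ('a, 'b) cstar_tensor"
    (infixr "\<otimes>" 72)
  where "a \<otimes> b = univ_gen (TensorGen a b)"

lemma tensor_add_left: "(a + a') \<otimes> b = a \<otimes> b + a' \<otimes> b"
  and tensor_add_right: "a \<otimes> (b + b') = a \<otimes> b + a \<otimes> b'"
  and tensor_scaleC_left: "(c *\<^sub>C a) \<otimes> b = c *\<^sub>C (a \<otimes> b)"
  and tensor_scaleC_right: "a \<otimes> (c *\<^sub>C b) = c *\<^sub>C (a \<otimes> b)"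
  and tensor_mult: "(a \<otimes> b) * (a' \<otimes> b') = (a * a') \<otimes> (b * b')"
  and star_tensor: "star (a \<otimes> b) = star a \<otimes> star b"
  and tensor_one: "1 \<otimes> 1 = (1 :: ('a, 'b) cstar_tensor)"
  for a a' :: "'a::cstar_algebra" and b b' :: "'b::cstar_algebra"
proof -
  let ?t = "\<lambda>a b. free_gen (TensorGen a b) :: ('a, 'b) tensor_gen free_star_alg"
  have "univ_of (?t (a + a') b - (?t a b + ?t a' b)) = 0"
    "univ_of (?t a (b + b') - (?t a b + ?t a b')) = 0"
    "univ_of (?t (c *\<^sub>C a) b - free_scale c (?t a b)) = 0"
    "univ_of (?t a (c *\<^sub>C b) - free_scale c (?t a b)) = 0"
    "univ_of (?t (a * a') (b * b') - ?t a b * ?t a' b') = 0"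
    "univ_of (?t (star a) (star b) - free_star (?t a b)) = 0"
    "univ_of (?t 1 1 - 1) = 0"
    by (rule univ_of_relation, unfold relations_tensor_gen_def Let_def, blast)+
  then show "(a + a') \<otimes> b = a \<otimes> b + a' \<otimes> b"
    "a \<otimes> (b + b') = a \<otimes> b + a \<otimes> b'"
    "(c *\<^sub>C a) \<otimes> b = c *\<^sub>C (a \<otimes> b)"
    "a \<otimes> (c *\<^sub>C b) = c *\<^sub>C (a \<otimes> b)"
    "(a \<otimes> b) * (a' \<otimes> b') = (a * a') \<otimes> (b * b')"
    "star (a \<otimes> b) = star a \<otimes> star b"
    "1 \<otimes> 1 = (1 :: ('a, 'b) cstar_tensor)"
    by (simp_all add: tensor_def univ_gen_def univ_of_simps)
qed


section \<open>The model\<close>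

definition model_R :: "two_proj ^ 4 ^ 4"
  where "model_R = vector
    [vector [proj_p, 0, 1 - proj_p, 0],
     vector [1 - proj_p, 0, proj_p, 0],
     vector [0, proj_q, 0, 1 - proj_q],
     vector [0, 1 - proj_q, 0, proj_q]]"

definition model_M :: "(two_proj, (two_proj, two_proj) cstar_tensor) cstar_tensor ^ 4 ^ 4"
  where "model_M = (\<chi> i j. \<Sum>k\<in>UNIV. \<Sum>l\<in>UNIV. model_R $ i $ k \<otimes> model_R $ k $ l \<otimes> model_R $ l $ j)"

lemma vector_4_nth:
  "(vector [a, b, c, d] :: 'a::zero ^ 4) $ 1 = a" "(vector [a, b, c, d] :: 'a::zero ^ 4) $ 2 = b"
  "(vector [a, b, c, d] :: 'a::zero ^ 4) $ 3 = c" "(vector [a, b, c, d] :: 'a::zero ^ 4) $ 4 = d"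
  by (simp_all add: vector_def)

lemma model_R_nth:
  "model_R $ 1 $ 1 = proj_p" "model_R $ 1 $ 2 = 0" "model_R $ 1 $ 3 = 1 - proj_p" "model_R $ 1 $ 4 = 0"
  "model_R $ 2 $ 1 = 1 - proj_p" "model_R $ 2 $ 2 = 0" "model_R $ 2 $ 3 = proj_p" "model_R $ 2 $ 4 = 0"
  "model_R $ 3 $ 1 = 0" "model_R $ 3 $ 2 = proj_q" "model_R $ 3 $ 3 = 0" "model_R $ 3 $ 4 = 1 - proj_q"
  "model_R $ 4 $ 1 = 0" "model_R $ 4 $ 2 = 1 - proj_q" "model_R $ 4 $ 3 = 0" "model_R $ 4 $ 4 = proj_q"
  by (simp_all only: model_R_def vector_4_nth)

lemma proj_pq:
  "proj_p * proj_p = proj_p" "star proj_p = proj_p" "proj_q * proj_q = proj_q" "star proj_q = proj_q"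
  by (simp_all only: proj_p_def proj_q_def univ_gen_proj)

lemma magic_unitary_model_R: "magic_unitary model_R"
  unfolding magic_unitary_def forall_4 sum_4 model_R_nth
  by (simp add: proj_pq star_diff right_diff_distrib left_diff_distrib)

lemma model_R_row_orthogonal: "k \<noteq> l \<Longrightarrow> model_R $ i $ k * model_R $ i $ l = 0"
proof -
  have "\<forall>i k l. k \<noteq> l \<longrightarrow> model_R $ i $ k * model_R $ i $ l = 0"
    unfolding forall_4 model_R_nth by (simp add: proj_pq right_diff_distrib left_diff_distrib)
  then show "k \<noteq> l \<Longrightarrow> model_R $ i $ k * model_R $ i $ l = 0" by blast
qed

lemma tensor_zero_left [simp]: "0 \<otimes> b = 0" and tensor_zero_right [simp]: "a \<otimes> 0 = 0"
  using tensor_scaleC_left [of 0 0 b] tensor_scaleC_right [of a 0 0] by simp_all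

lemma tensor_sum_left: "(\<Sum>i\<in>I. f i) \<otimes> b = (\<Sum>i\<in>I. f i \<otimes> b)"
  by (induction I rule: infinite_finite_induct) (simp_all add: tensor_add_left)

lemma tensor_sum_right: "a \<otimes> (\<Sum>i\<in>I. f i) = (\<Sum>i\<in>I. a \<otimes> f i)"
  by (induction I rule: infinite_finite_induct) (simp_all add: tensor_add_right)

lemma magic_unitary_convolution:
  assumes N: "magic_unitary N" and N': "magic_unitary N'"
    and orth: "\<And>i k l. k \<noteq> l \<Longrightarrow> N $ i $ k * N $ i $ l = 0"
  shows "magic_unitary (\<chi> i j. \<Sum>k\<in>UNIV. N $ i $ k \<otimes> N' $ k $ j)"
proof -
  have sq: "(\<Sum>k\<in>UNIV. N $ i $ k \<otimes> N' $ k $ j) * (\<Sum>l\<in>UNIV. N $ i $ l \<otimes> N' $ l $ j)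
      = (\<Sum>k\<in>UNIV. N $ i $ k \<otimes> N' $ k $ j)" for i j
  proof -
    have "(\<Sum>l\<in>UNIV. (N $ i $ k \<otimes> N' $ k $ j) * (N $ i $ l \<otimes> N' $ l $ j)) = N $ i $ k \<otimes> N' $ k $ j" for k
    proof -
      have "(N $ i $ k \<otimes> N' $ k $ j) * (N $ i $ l \<otimes> N' $ l $ j)
          = (if l = k then N $ i $ k \<otimes> N' $ k $ j else 0)" for l
        using N N' orth [of k l i] by (simp add: tensor_mult magic_unitary_def)
      then show ?thesis by simp
    qed
    then show ?thesis by (simp only: sum_product)
  qed
  moreover have "(\<Sum>j\<in>UNIV. \<Sum>k\<in>UNIV. N $ i $ k \<otimes> N' $ k $ j) = 1" for i
  proof -
    have "(\<Sum>j\<in>UNIV. \<Sum>k\<in>UNIV. N $ i $ k \<otimes> N' $ k $ j)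
        = (\<Sum>k\<in>UNIV. N $ i $ k \<otimes> (\<Sum>j\<in>UNIV. N' $ k $ j))"
      unfolding tensor_sum_right by (rule sum.swap)
    also have "\<dots> = (\<Sum>k\<in>UNIV. N $ i $ k) \<otimes> 1"
      using N' by (simp add: magic_unitary_def tensor_sum_left)
    finally show ?thesis using N by (simp add: magic_unitary_def tensor_one)
  qed
  moreover have "(\<Sum>i\<in>UNIV. \<Sum>k\<in>UNIV. N $ i $ k \<otimes> N' $ k $ j) = 1" for j
  proof -
    have "(\<Sum>i\<in>UNIV. \<Sum>k\<in>UNIV. N $ i $ k \<otimes> N' $ k $ j)
        = (\<Sum>k\<in>UNIV. (\<Sum>i\<in>UNIV. N $ i $ k) \<otimes> N' $ k $ j)"
      unfolding tensor_sum_left by (rule sum.swap)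
    also have "\<dots> = 1 \<otimes> (\<Sum>k\<in>UNIV. N' $ k $ j)"
      using N by (simp add: magic_unitary_def tensor_sum_right)
    finally show ?thesis using N' by (simp add: magic_unitary_def tensor_one)
  qed
  moreover have "star (\<Sum>k\<in>UNIV. N $ i $ k \<otimes> N' $ k $ j) = (\<Sum>k\<in>UNIV. N $ i $ k \<otimes> N' $ k $ j)" for i j
    using N N' by (simp add: star_sum star_tensor magic_unitary_def)
  ultimately show ?thesis by (simp add: magic_unitary_def)
qed

lemma magic_unitary_model_M: "magic_unitary model_M"
proof -
  define N where "N = (\<chi> i j. \<Sum>k\<in>UNIV. model_R $ i $ k \<otimes> model_R $ k $ j)"
  have "magic_unitary N"
    unfolding N_def by (intro magic_unitary_convolution magic_unitary_model_R model_R_row_orthogonal)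
  then have "magic_unitary (\<chi> i j. \<Sum>k\<in>UNIV. model_R $ i $ k \<otimes> N $ k $ j)"
    by (intro magic_unitary_convolution magic_unitary_model_R model_R_row_orthogonal)
  then show ?thesis by (simp add: N_def model_M_def tensor_sum_right)
qed

end

theory Submission
  imports Defs
begin

text \<open>
  The Fourier transform over the Klein four-group turns the fundamental matrix \<open>u\<close> into a \<open>3 \<times> 3\<close> matrix
  \<open>a\<close> that satisfies the relations of \<open>SO\<^sub>-\<^sub>1(3)\<close> (Banica and Bichon).  With the quaternion units \<open>e\<^sub>i\<close>, the
  entries of \<open>a\<^sub>i\<^sub>j \<otimes> e\<^sub>i \<otimes> e\<^sub>j\<close> commute and form a rotation matrix.  In terms of a unit quaternion \<open>q\<close> the
  entries of a rotation matrix are quadratic forms in \<open>q\<close>, and conversely the products \<open>q\<^sub>a q\<^sub>b\<close> are affine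
  in the entries; the resulting symmetric \<open>4 \<times> 4\<close> matrix has vanishing \<open>2 \<times> 2\<close> minors as a consequence of
  the relations.  Hence a product of \<open>n\<close> of its entries only depends on the multiset of the \<open>2n\<close> indices, so
  every polynomial in \<open>u\<close> is a linear image of homogeneous polynomials in \<open>q\<close>, one for each degree in
  the grading group \<open>(\<int>/2)\<^sup>4\<close>, and it vanishes as soon as these vanish on the unit sphere.

  On the model side, a pair of projections at a fixed angle is a rotation about a coordinate axis, up to
  an exchange of coordinates.  The three tensor factors of \<open>M\<close> thus give a product of three rotations,
  which by Euler's theorem is an arbitrary rotation.  So \<open>P(M) = 0\<close> makes all these polynomials vanish on the
  sphere.
\<close>

section \<open>Projections with sum one\<close>

lemma scaleR_3: "3 *\<^sub>R x = x + x + (x :: 'a::real_vector)"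
  and scaleR_4: "4 *\<^sub>R x = x + x + x + (x :: 'a::real_vector)"
  using scaleR_left_distrib [of 2 1 x] scaleR_left_distrib [of 2 2 x] by (simp_all add: scaleR_2)

text \<open>The set of these \<open>h\<close> is stable under \<open>h \<mapsto> (3h - h\<^sup>3)/2\<close>, because with \<open>c = e + h\<close> and \<open>d = e - h\<close> the
  element \<open>e + (3h - h\<^sup>3)/2\<close> is the convex combination \<open>(c\<^sup>3 + 3c\<^sup>2d)/4\<close>.  As \<open>\<parallel>h\<parallel> \<le> 1/2\<close>, this map stretches
  the norm by at least \<open>11/8\<close>, which is only possible for \<open>h = 0\<close>.\<close>

lemma extreme_point_aux:
  fixes e h :: "'a::cstar_algebra"
  assumes e: "e * e = e" "e * h = h" "h * e = h"
    and le: "norm (e + h) \<le> 1" "norm (e - h) \<le> 1"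
  shows "norm h \<le> 1/2"
    and "norm (e + (1/2) *\<^sub>R (3 *\<^sub>R h - h * h * h)) \<le> 1"
    and "norm (e - (1/2) *\<^sub>R (3 *\<^sub>R h - h * h * h)) \<le> 1"
proof -
  have mult: "norm (a * b) \<le> 1" if "norm a \<le> 1" "norm b \<le> 1" for a b :: 'a
    using norm_mult_ineq [of a b] mult_mono [OF that] by simp
  have mult3: "norm (a * b * c) \<le> 1" if "norm a \<le> 1" "norm b \<le> 1" "norm c \<le> 1" for a b c :: 'a
    using that by (intro mult)
  have eh: "e * (h * x) = h * x" "h * (e * x) = h * x" "e * (e * x) = e * x" for x
    by (simp_all add: e flip: mult.assoc)
  \<comment> \<open>Both squares stay in the unit ball, so \<open>4 h\<close> has norm at most
    \<open>2\<close>.\<close>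
  have "(e + h) * (e + h) - (e - h) * (e - h) = 4 *\<^sub>R h"
    by (simp add: algebra_simps e scaleR_4)
  then have "norm (4 *\<^sub>R h) \<le> 1 + 1"
    by (metis norm_triangle_ineq4 mult [OF le(1) le(1)] mult [OF le(2) le(2)] add_mono order_trans)
  then show "norm h \<le> 1/2" by simp
  have 3: "e + (1/2) *\<^sub>R (3 *\<^sub>R k - k * k * k) =
      (1/4) *\<^sub>R ((e + k) * (e + k) * (e + k) + 3 *\<^sub>R ((e + k) * (e + k) * (e - k)))"
    if k: "e * k = k" "k * e = k" for k
  proof -
    have "e * (k * x) = k * x" "k * (e * x) = k * x" for x by (simp_all add: k flip: mult.assoc)
    then have "(e + k) * (e + k) * (e + k) = e + 3 *\<^sub>R k + 3 *\<^sub>R (k * k) + k * k * k"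
      "(e + k) * (e + k) * (e - k) = e + k - k * k - k * k * k"
      by (simp_all add: algebra_simps e k eh scaleR_3)
    then have "(e + k) * (e + k) * (e + k) + 3 *\<^sub>R ((e + k) * (e + k) * (e - k))
        = 4 *\<^sub>R e + (6 *\<^sub>R k - 2 *\<^sub>R (k * k * k))"
      using scaleR_left_distrib [of 3 3 k]
      by (simp only:) (simp add: algebra_simps scaleR_3 scaleR_4 scaleR_2)
    then show ?thesis by (simp add: scaleR_add_right scaleR_diff_right)
  qed
  have bound: "norm ((1/4) *\<^sub>R (a + 3 *\<^sub>R b)) \<le> 1" if "norm a \<le> 1" "norm b \<le> 1" for a b :: 'a
    using norm_triangle_ineq [of a "3 *\<^sub>R b"] that by simp
  show "norm (e + (1/2) *\<^sub>R (3 *\<^sub>R h - h * h * h)) \<le> 1"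
    unfolding 3 [OF e(2,3)] by (intro bound mult3 le)
  have "e - (1/2) *\<^sub>R (3 *\<^sub>R h - h * h * h) = e + (1/2) *\<^sub>R (3 *\<^sub>R (- h) - (- h) * (- h) * (- h))"
    by (simp add: scaleR_diff_right)
  also have "norm \<dots> \<le> 1"
    by (subst 3) (use e le in \<open>auto intro!: bound mult3 simp del: norm_scaleR\<close>)
  finally show "norm (e - (1/2) *\<^sub>R (3 *\<^sub>R h - h * h * h)) \<le> 1" .
qed

text \<open>The unit of a C*-algebra is an extreme point of its unit ball; here the algebra is the
  corner cut out by \<open>e\<close>.\<close>

lemma extreme_point:
  fixes e h :: "'a::cstar_algebra"
  assumes e: "e * e = e" and h: "e * h = h" "h * e = h" "norm (e + h) \<le> 1" "norm (e - h) \<le> 1"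
  shows "h = 0"
proof -
  define K where "K = {h. e * h = h \<and> h * e = h \<and> norm (e + h) \<le> 1 \<and> norm (e - h) \<le> 1}"
  define s where "s = Sup (norm ` K)"
  have hK: "h \<in> K" using h by (simp add: K_def)
  have half: "norm k \<le> 1/2" if "k \<in> K" for k
    using extreme_point_aux(1) [of e k] that e by (simp add: K_def)
  then have bdd: "bdd_above (norm ` K)" by (intro bdd_aboveI2)
  have le: "norm k \<le> s" if "k \<in> K" for k
    unfolding s_def using that bdd by (intro cSup_upper) auto
  \<comment> \<open>Comparing with the supremum \<open>s\<close> replaces an iteration of the map:
    \<open>2 * norm ?k\<close> is at least \<open>(3 - 1/4) * norm k\<close>.\<close>
  have "norm k \<le> 8/11 * s" if k: "k \<in> K" for k
  proof -
    let ?k = "(1/2) *\<^sub>R (3 *\<^sub>R k - k * k * k)"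
    have "?k \<in> K"
      using extreme_point_aux [of e k] k e
      by (simp add: K_def right_diff_distrib left_diff_distrib mult.assoc) (simp flip: mult.assoc)
    then have "norm ?k \<le> s" by (rule le)
    moreover have "3 * norm k \<le> 2 * norm ?k + norm (k * k * k)"
      using norm_triangle_ineq [of "2 *\<^sub>R ?k" "k * k * k"] by simp
    moreover have "norm (k * k * k) \<le> (norm k * norm k) * norm k"
      by (meson mult_right_mono norm_ge_zero norm_mult_ineq order_trans)
    moreover have "(norm k * norm k) * norm k \<le> (1/2 * (1/2)) * norm k"
      using half [OF k] by (intro mult_right_mono mult_mono) auto
    ultimately show ?thesis by linarith
  qed
  then have "s \<le> 8/11 * s" unfolding s_def using hK by (intro cSup_least) (auto simp: s_def)
  then have "norm h \<le> 0" using le [OF hK] by linarith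
  then show ?thesis by simp
qed

text \<open>Every \<open>e - 2 e p\<^sub>k e\<close> with \<open>e = p\<^sub>j\<close> lies in the unit ball, and the elements \<open>e p\<^sub>k e\<close> for \<open>k \<noteq> j\<close> add up
  to \<open>0\<close>; averaging gives \<open>\<parallel>e \<plusminus> e p\<^sub>i e\<parallel> \<le> 1\<close>.\<close>

lemma sum_projections_orthogonal:
  fixes p :: "4 \<Rightarrow> 'a::cstar_algebra"
  assumes p: "\<And>i. p i * p i = p i" "\<And>i. star (p i) = p i" and sum: "(\<Sum>i\<in>UNIV. p i) = 1"
    and ne: "i \<noteq> j"
  shows "p i * p j = 0"
proof -
  let ?e = "p j"
  have pp: "p i * (p i * x) = p i * x" for i x by (simp add: p flip: mult.assoc)
  have n1: "norm x \<le> 1" if "star x * x = x \<or> star x * x = 1" for x :: 'a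
  proof -
    have "(norm x)\<^sup>2 = norm x \<or> (norm x)\<^sup>2 \<le> 1"
      using cstar_identity [of x] that norm_one_le by metis
    then show ?thesis by (auto simp: power2_eq_square abs_square_le_1 [unfolded power2_eq_square])
  qed
  have e1: "norm ?e \<le> 1" by (rule n1) (simp add: p)
  have sym: "norm (?e - 2 *\<^sub>R (?e * p k * ?e)) \<le> 1" for k
  proof -
    \<comment> \<open>The reflection in a projection is a self-adjoint unitary.\<close>
    have "norm (1 - 2 *\<^sub>R p k) \<le> 1"
      by (rule n1) (simp add: star_diff star_scaleR p algebra_simps, simp flip: scaleR_left_distrib)
    moreover note e1
    moreover have "?e - 2 *\<^sub>R (?e * p k * ?e) = ?e * (1 - 2 *\<^sub>R p k) * ?e"
      by (simp add: algebra_simps p)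
    ultimately show ?thesis
      using norm_mult_ineq [of "?e * (1 - 2 *\<^sub>R p k)" ?e] norm_mult_ineq [of ?e "1 - 2 *\<^sub>R p k"]
      by (smt (verit, best) mult_le_one norm_ge_zero)
  qed
  \<comment> \<open>Exactly two further indices remain among four, so \<open>?e + b i\<close> is the
    mean of the two elements \<open>?e - 2 b k\<close> and \<open>?e - 2 b l\<close>; likewise
    \<open>?e - b i\<close> is the mean of \<open>?e\<close> and \<open>?e - 2 b i\<close>.\<close>
  have "card (UNIV - {i, j}) = 2" using ne by (subst card_Diff_subset) auto
  then obtain k l where kl: "UNIV - {i, j} = {k, l}" "k \<noteq> l" by (metis card_2_iff)
  define b where "b k = ?e * p k * ?e" for k
  have U: "UNIV = insert i (insert j {k, l})" and "i \<notin> {k, l}" "j \<notin> {k, l}" using kl by auto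
  then have "p i + (p j + (p k + p l)) = 1" using ne kl(2) unfolding sum [symmetric] U by simp
  then have "b i + (b j + (b k + b l)) = ?e * ?e" unfolding b_def
    by (metis distrib_left distrib_right mult.right_neutral)
  then have bi: "b i = - (b k + b l)"
    by (simp add: b_def p pp eq_neg_iff_add_eq_0 algebra_simps)
  have half: "norm (x + y) \<le> 1" if "norm (2 *\<^sub>R x) \<le> 1" "norm (2 *\<^sub>R y) \<le> 1" for x y :: 'a
    using that norm_triangle_ineq [of x y] by simp
  have "b i = 0"
  proof (rule extreme_point)
    show "?e * ?e = ?e" "?e * b i = b i" "b i * ?e = b i" by (simp_all add: b_def p pp mult.assoc)
    have "?e + b i = ((1/2) *\<^sub>R ?e - b k) + ((1/2) *\<^sub>R ?e - b l)"
      unfolding bi by (simp add: algebra_simps flip: scaleR_left_distrib)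
    also have "norm \<dots> \<le> 1"
      by (rule half) (use sym in \<open>simp_all add: b_def scaleR_diff_right\<close>)
    finally show "norm (?e + b i) \<le> 1" .
    have "?e - b i = (1/2) *\<^sub>R ?e + ((1/2) *\<^sub>R ?e - b i)"
      by (simp flip: scaleR_left_distrib)
    also have "norm \<dots> \<le> 1"
      by (rule half) (use sym e1 in \<open>simp_all add: b_def scaleR_diff_right\<close>)
    finally show "norm (?e - b i) \<le> 1" .
  qed
  \<comment> \<open>The compression \<open>b i\<close> is \<open>star x * x\<close> for
    \<open>x = p i * p j\<close>.\<close>
  then have "(norm (p i * p j))\<^sup>2 = 0"
    by (simp add: b_def star_mult p mult.assoc pp flip: cstar_identity)
  then show ?thesis by simp
qed


section \<open>Universal property\<close>

lemma free_eval_superset: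
  assumes "finite S" "Poly_Mapping.keys P \<subseteq> S"
  shows "free_eval v P = (\<Sum>w\<in>S. Poly_Mapping.lookup P w *\<^sub>C prod_list (map v (letters w)))"
  unfolding free_eval_def
  by (rule sum.mono_neutral_left) (use assms in \<open>auto simp: in_keys_iff\<close>)

lemma free_eval_single: "free_eval v (Poly_Mapping.single w c) = c *\<^sub>C prod_list (map v (letters w))"
  by (subst free_eval_superset [where S = "{w}"]) auto

lemma free_eval_add: "free_eval v (P + Q) = free_eval v P + free_eval v Q"
proof -
  let ?S = "Poly_Mapping.keys P \<union> Poly_Mapping.keys Q"
  have "free_eval v R = (\<Sum>w\<in>?S. Poly_Mapping.lookup R w *\<^sub>C prod_list (map v (letters w)))"
    if "R \<in> {P, Q, P + Q}" for R
    by (rule free_eval_superset) (use that Poly_Mapping.keys_add [of P Q] in auto)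
  then show ?thesis by (simp add: lookup_add scaleC_add_left sum.distrib)
qed

lemma scaleC_zero_right [simp]: "c *\<^sub>C (0::'a::cstar_algebra) = 0"
  using scaleC_add_right [of c 0 "0::'a"] by simp

lemma scaleC_sum_right: "c *\<^sub>C (\<Sum>i\<in>I. f i) = (\<Sum>i\<in>I. c *\<^sub>C (f i :: 'a::cstar_algebra))"
  by (induction I rule: infinite_finite_induct) (simp_all add: scaleC_add_right)

lemma free_eval_mult: "free_eval v (P * Q) = free_eval v P * free_eval v Q"
proof (induction P rule: free_induct)
  case (single w c)
  show ?case
  proof (induction Q rule: free_induct)
    case (single u d)
    show ?case
      by (simp add: mult_single free_eval_single plus_word_def mult_scaleC_left mult_scaleC_right
          scaleC_scaleC mult.commute)
  qed (simp add: distrib_left free_eval_add)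
qed (simp add: distrib_right free_eval_add)

lemma free_eval_scale: "free_eval v (free_scale c P) = c *\<^sub>C free_eval v P"
  by (induction P rule: free_induct)
    (simp_all add: free_scale_single free_eval_single scaleC_scaleC free_scale_add_right free_eval_add scaleC_add_right)

lemma free_eval_1: "free_eval v 1 = 1"
  using free_eval_single [of v 0 1] unfolding single_one by (simp add: zero_word_def)

lemma free_eval_0: "free_eval v 0 = 0"
  by (simp add: free_eval_def)

lemma free_eval_diff: "free_eval v (P - Q) = free_eval v P - free_eval v Q"
  using free_eval_add [of v "P - Q" Q] by simp

lemma free_eval_sum: "free_eval v (sum g I) = (\<Sum>i\<in>I. free_eval v (g i))"
  by (induction I rule: infinite_finite_induct) (simp_all add: free_eval_add free_eval_0)

definition letter_eval :: "('x \<Rightarrow> 'a::cstar_algebra) \<Rightarrow> 'x letter \<Rightarrow> 'a"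
  where "letter_eval v l = (case l of Gen x \<Rightarrow> v x | GenStar x \<Rightarrow> star (v x))"

lemma letter_eval_star: "letter_eval v (letter_star l) = star (letter_eval v l)"
  by (cases l) (simp_all add: letter_eval_def star_star)

definition star_eval :: "('x \<Rightarrow> 'a::cstar_algebra) \<Rightarrow> 'x free_star_alg \<Rightarrow> 'a"
  where "star_eval v = free_eval (letter_eval v)"

lemma star_eval_gen: "star_eval v (free_gen x) = v x"
  by (simp add: star_eval_def free_gen_def free_eval_single letter_eval_def)

lemma star_prod_list: "star (prod_list xs) = prod_list (map star (rev xs :: 'a::cstar_algebra list))"
  by (induction xs) (simp_all add: star_mult)

lemma star_eval_star: "star_eval v (free_star P) = star (star_eval v P)"
proof (induction P rule: free_induct)
  case (single w c)
  have "prod_list (map (letter_eval v) (letters (word_star w))) = star (prod_list (map (letter_eval v) (letters w)))"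
    by (simp add: word_star_def star_prod_list rev_map comp_def letter_eval_star)
  then show ?case by (simp add: free_star_single star_eval_def free_eval_single star_scaleC)
qed (simp add: free_star_add star_eval_def free_eval_add star_add)

lemmas star_eval_simps = star_eval_gen star_eval_star
  free_eval_add [of "letter_eval v" for v, folded star_eval_def]
  free_eval_diff [of "letter_eval v" for v, folded star_eval_def]
  free_eval_mult [of "letter_eval v" for v, folded star_eval_def]
  free_eval_scale [of "letter_eval v" for v, folded star_eval_def]
  free_eval_1 [of "letter_eval v" for v, folded star_eval_def]
  free_eval_sum [of "letter_eval v" for v, folded star_eval_def]

definition star_hom :: "('a::cstar_algebra \<Rightarrow> 'b::cstar_algebra) \<Rightarrow> bool"
  where "star_hom h \<longleftrightarrow> (\<forall>x y. h (x + y) = h x + h y) \<and> (\<forall>c x. h (c *\<^sub>C x) = c *\<^sub>C h x) \<and>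
    (\<forall>x y. h (x * y) = h x * h y) \<and> h 1 = 1 \<and> (\<forall>x. h (star x) = star (h x))"

lemma star_homD:
  assumes "star_hom h"
  shows "h (x + y) = h x + h y" "h (c *\<^sub>C x) = c *\<^sub>C h x" "h (x * y) = h x * h y" "h 1 = 1"
    "h (star x) = star (h x)" "h 0 = 0" "h (x - y) = h x - h y"
proof -
  show *: "h (x + y) = h x + h y" "h (c *\<^sub>C x) = c *\<^sub>C h x" "h (x * y) = h x * h y" "h 1 = 1"
    "h (star x) = star (h x)" for x y c
    using assms by (simp_all add: star_hom_def)
  show "h 0 = 0" using *(2) [of 0 0] by simp
  show "h (x - y) = h x - h y" using *(1) [of "x - y" y] by (simp add: algebra_simps)
qed

lemma star_hom_sum: "star_hom h \<Longrightarrow> h (\<Sum>i\<in>I. f i) = (\<Sum>i\<in>I. h (f i))"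
  by (induction I rule: infinite_finite_induct) (simp_all add: star_homD)

lemma star_hom_free_eval: "star_hom h \<Longrightarrow> h (free_eval v P) = free_eval (h \<circ> v) P"
proof -
  assume h: "star_hom h"
  have "h (prod_list xs) = prod_list (map h xs)" for xs
    by (induction xs) (simp_all add: star_homD [OF h])
  then show ?thesis
    by (simp add: free_eval_def star_hom_sum [OF h] star_homD [OF h])
qed

text \<open>The seminorm \<open>norm (star_eval v f)\<close> is admissible, hence dominated by
  \<open>univ_norm\<close>, so \<open>star_eval v\<close> extends to the completion. The clause on
  commuting elements \<open>d\<close> passes to limits from words; it later shows that
  representations of different tensor factors commute.\<close>

theorem univ_cstar_extension:
  fixes v :: "'x::cstar_presentation \<Rightarrow> 'a::cstar_algebra"
  assumes rel: "\<And>r. r \<in> relations \<Longrightarrow> star_eval v r = 0"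
  shows "\<exists>h. star_hom h \<and> (\<forall>x. h (univ_gen x) = v x) \<and>
    (\<forall>z d. (\<forall>x. d * v x = v x * d \<and> d * star (v x) = star (v x) * d) \<longrightarrow> d * h z = h z * d)"
proof -
  have "admissible (\<lambda>f. norm (star_eval v f))"
    unfolding admissible_def cstar_seminorm_def
    by (simp add: star_eval_simps rel norm_triangle_ineq norm_scaleC norm_mult_ineq cstar_identity)
  then have le: "norm (star_eval v f) \<le> univ_norm f" for f by (rule univ_norm_upper)
  have "convergent (\<lambda>n. star_eval v (X n))" if X: "univ_cauchy X" for X
    unfolding Cauchy_convergent_iff [symmetric] Cauchy_def dist_norm star_eval_simps(4) [symmetric]
  proof (intro allI impI)
    fix e :: real assume "e > 0"
    then have "\<exists>N. \<forall>m\<ge>N. \<forall>n\<ge>N. univ_norm (X m - X n) < e"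
      using X unfolding univ_cauchy_def by simp
    then obtain N where N: "univ_norm (X m - X n) < e" if "m \<ge> N" "n \<ge> N" for m n by auto
    show "\<exists>M. \<forall>m\<ge>M. \<forall>n\<ge>M. norm (star_eval v (X m - X n)) < e"
      by (intro exI [of _ N] allI impI) (rule le_less_trans [OF le N])
  qed
  then have conv: "(\<lambda>n. star_eval v (X n)) \<longlonglongrightarrow> lim (\<lambda>n. star_eval v (X n))" if "univ_cauchy X" for X
    using that by (simp flip: convergent_LIMSEQ_iff)
  \<comment> \<open>The limit is taken along a chosen representative; the next fact shows that the
    choice does not matter.\<close>
  define h where "h z = lim (\<lambda>n. star_eval v (rep_univ_cstar z n))" for z
  have h: "(\<lambda>n. star_eval v (X n)) \<longlonglongrightarrow> h (abs_univ_cstar X)" if X: "univ_cauchy X" for X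
  proof -
    define Y where "Y = rep_univ_cstar (abs_univ_cstar X)"
    have r: "univ_rel X Y"
      unfolding Y_def
      by (rule part_equivp_symp [OF part_equivp_univ_rel], rule Quotient_rep_abs [OF Quotient_univ_cstar])
        (rule univ_rel_refl [OF X])
    then have lim: "(\<lambda>n. univ_norm (X n - Y n)) \<longlonglongrightarrow> 0" and "univ_cauchy Y"
      by (simp_all add: univ_rel_def)
    have "(\<lambda>n. star_eval v (X n - Y n)) \<longlonglongrightarrow> 0"
      by (rule Lim_null_comparison [OF _ lim]) (simp add: le)
    moreover have "(\<lambda>n. star_eval v (Y n)) \<longlonglongrightarrow> h (abs_univ_cstar X)"
      using conv [OF \<open>univ_cauchy Y\<close>] by (simp add: h_def Y_def)
    ultimately have "(\<lambda>n. star_eval v (X n - Y n) + star_eval v (Y n)) \<longlonglongrightarrow> 0 + h (abs_univ_cstar X)"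
      by (rule tendsto_add)
    then show ?thesis by (simp add: star_eval_simps)
  qed
  have of: "h (univ_of f) = star_eval v f" for f
    using h [of "\<lambda>_. f"] by (simp add: univ_of_def LIMSEQ_const_iff)
  have eq: "h z = y" if "univ_cauchy X" "z = abs_univ_cstar X" "(\<lambda>n. star_eval v (X n)) \<longlonglongrightarrow> y" for X z y
    using LIMSEQ_unique [OF h [OF that(1)] that(3)] that(2) by simp
  have bl: "bounded_linear (\<lambda>x::'a. c *\<^sub>C x)" for c
    by (rule bounded_linear_intro [where K = "cmod c"])
      (simp_all add: scaleC_add_right scaleR_scaleC scaleC_scaleC mult.commute norm_scaleC)
  have "star_hom h"
    unfolding star_hom_def
  proof (intro conjI allI)
    show "h (x + y) = h x + h y" for x y
    proof (cases x, cases y)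
      fix X Y assume *: "univ_cauchy X" "x = abs_univ_cstar X" "univ_cauchy Y" "y = abs_univ_cstar Y"
      show ?thesis
        by (rule eq [of "\<lambda>n. X n + Y n"])
          (use * in \<open>auto simp: univ_abs_simps star_eval_simps intro!: tendsto_add h\<close>)
    qed
    show "h (x * y) = h x * h y" for x y
    proof (cases x, cases y)
      fix X Y assume *: "univ_cauchy X" "x = abs_univ_cstar X" "univ_cauchy Y" "y = abs_univ_cstar Y"
      show ?thesis
        by (rule eq [of "\<lambda>n. X n * Y n"])
          (use * in \<open>auto simp: univ_abs_simps star_eval_simps intro!: tendsto_mult h\<close>)
    qed
    show "h (c *\<^sub>C x) = c *\<^sub>C h x" for c x
    proof (cases x)
      case (abs X)
      then show ?thesis
        by (intro eq [of "\<lambda>n. free_scale c (X n)"])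
          (auto simp: scaleC_univ_cstar_def univ_abs_simps star_eval_simps intro!: bounded_linear.tendsto [OF bl] h)
    qed
    show "h (star x) = star (h x)" for x
    proof (cases x)
      case (abs X)
      then show ?thesis
        by (intro eq [of "\<lambda>n. free_star (X n)"])
          (auto simp: star_univ_cstar_def univ_abs_simps star_eval_simps
            intro!: bounded_linear.tendsto [OF bounded_linear_star] h)
    qed
    show "h 1 = 1" using of [of 1] by (simp add: univ_of_1 star_eval_simps)
  qed
  moreover have "h (univ_gen x) = v x" for x by (simp add: univ_gen_def of star_eval_gen)
  moreover have "d * h z = h z * d"
    if d: "\<forall>x. d * v x = v x * d \<and> d * star (v x) = star (v x) * d" for z d
  proof (cases z)
    case (abs X)
    have l: "d * letter_eval v l = letter_eval v l * d" for l
      by (cases l) (simp_all add: letter_eval_def d)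
    have "d * prod_list (map (letter_eval v) w) = prod_list (map (letter_eval v) w) * d" for w
    proof (induction w)
      case (Cons a w)
      have "d * (letter_eval v a * prod_list (map (letter_eval v) w))
          = letter_eval v a * (d * prod_list (map (letter_eval v) w))"
        by (simp only: l mult.assoc [symmetric])
      then show ?case by (simp add: Cons mult.assoc)
    qed simp
    then have comm: "d * star_eval v f = star_eval v f * d" for f
      by (simp add: star_eval_def free_eval_def sum_distrib_left sum_distrib_right mult_scaleC_left mult_scaleC_right)
    have lim: "(\<lambda>n. star_eval v (X n)) \<longlonglongrightarrow> h z" using h [OF abs(1)] abs(2) by simp
    show ?thesis
      using LIMSEQ_unique [OF tendsto_mult [OF tendsto_const lim] tendsto_mult [OF lim tendsto_const, of d, folded comm]] .
  qed
  ultimately show ?thesis by blast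
qed

theorem magic_unitary_extension:
  fixes N :: "'a::cstar_algebra ^ 'n::finite ^ 'n"
  assumes "magic_unitary N"
  obtains h where "star_hom h" "\<And>i j. h (quantum_perm_u $ i $ j) = N $ i $ j"
proof -
  let ?v = "\<lambda>g. case g of MagicGen i j \<Rightarrow> N $ i $ j"
  have "star_eval ?v r = 0" if "r \<in> relations" for r
    using that assms unfolding relations_magic_gen_def Let_def magic_unitary_def
    by (auto simp: star_eval_simps)
  then obtain h where "star_hom h" "\<And>x. h (univ_gen x) = ?v x"
    using univ_cstar_extension [of ?v] by blast
  then show thesis using that by (simp add: quantum_perm_u_def)
qed

theorem two_proj_extension:
  fixes p q :: "'a::cstar_algebra"
  assumes "p * p = p" "star p = p" "q * q = q" "star q = q"
  shows "\<exists>h. star_hom h \<and> h proj_p = p \<and> h proj_q = q \<and>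
    (\<forall>z d. d * p = p * d \<longrightarrow> d * q = q * d \<longrightarrow> d * h z = h z * d)"
proof -
  let ?v = "\<lambda>g. case g of GenP \<Rightarrow> p | GenQ \<Rightarrow> q"
  have "star_eval ?v r = 0" if "r \<in> relations" for r
    using that assms unfolding relations_proj_gen_def
    by (auto simp: star_eval_simps split: proj_gen.splits)
  then obtain h where h: "star_hom h" "\<And>x. h (univ_gen x) = ?v x"
    "\<And>z d. (\<forall>x. d * ?v x = ?v x * d \<and> d * star (?v x) = star (?v x) * d) \<Longrightarrow> d * h z = h z * d"
    using univ_cstar_extension [of ?v] by blast
  have "d * h z = h z * d" if "d * p = p * d" "d * q = q * d" for z d
    by (rule h(3)) (use that assms in \<open>auto split: proj_gen.splits\<close>)
  with h show ?thesis by (intro exI [of _ h]) (simp add: proj_p_def proj_q_def)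
qed

text \<open>Commuting ranges suffice because the tensor product is the maximal one. The clause on
  \<open>d\<close> makes a second application to a nested tensor product possible.\<close>

theorem tensor_extension:
  fixes f :: "'a::cstar_algebra \<Rightarrow> 'c::cstar_algebra" and g :: "'b::cstar_algebra \<Rightarrow> 'c"
  assumes f: "star_hom f" and g: "star_hom g" and comm: "\<And>x y. f x * g y = g y * f x"
  obtains h where "star_hom h" "\<And>x y. h (x \<otimes> y) = f x * g y"
    "\<And>z d. (\<And>x. d * f x = f x * d) \<Longrightarrow> (\<And>y. d * g y = g y * d) \<Longrightarrow> d * h z = h z * d"
proof -
  let ?v = "\<lambda>t. case t of TensorGen x y \<Rightarrow> f x * g y"
  have c: "f x * g y * (f x' * g y') = f x * f x' * (g y * g y')" for x y x' y'
    by (metis comm mult.assoc)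
  have s: "star (g y) * star (f x) = star (f x) * star (g y)" for x y
    by (metis comm star_mult)
  have "star_eval ?v r = 0" if "r \<in> relations" for r
    using that unfolding relations_tensor_gen_def Let_def
    by (auto simp: star_eval_simps star_homD [OF f] star_homD [OF g] distrib_left distrib_right
        mult_scaleC_left mult_scaleC_right c star_mult s simp flip: comm)
  then obtain h where h: "star_hom h" "\<And>x. h (univ_gen x) = ?v x"
    "\<And>z d. (\<forall>x. d * ?v x = ?v x * d \<and> d * star (?v x) = star (?v x) * d) \<Longrightarrow> d * h z = h z * d"
    using univ_cstar_extension [of ?v] by blast
  have "d * h z = h z * d" if d: "\<And>x. d * f x = f x * d" "\<And>y. d * g y = g y * d" for z d
  proof (rule h(3))
    have *: "d * (f x * g y) = f x * g y * d" for x y by (metis d mult.assoc)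
    have "d * ?v t = ?v t * d" "d * star (?v t) = star (?v t) * d" for t
      by (cases t; simp add: star_mult * flip: comm star_homD(5) [OF f] star_homD(5) [OF g])+
    then show "\<forall>t. d * ?v t = ?v t * d \<and> d * star (?v t) = star (?v t) * d" by blast
  qed
  with h show thesis using that by (simp add: tensor_def)
qed


section \<open>Operators on a finite-dimensional Hilbert space\<close>

text \<open>The inner product of \<^typ>\<open>complex ^ 'n\<close> is the real part of the Hermitian one; the real
  adjoint of a complex-linear operator is its Hermitian adjoint.\<close>

typedef (overloaded) ('n::finite) op =
  "{f :: (complex ^ 'n) \<Rightarrow>\<^sub>L (complex ^ 'n). \<forall>c v. blinfun_apply f (c *s v) = c *s blinfun_apply f v}"
  by (rule exI [of _ 0]) simp

setup_lifting type_definition_op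

lift_definition apply_op :: "'n::finite op \<Rightarrow> complex ^ 'n \<Rightarrow> complex ^ 'n" is blinfun_apply .

lemma vec_norm_scale: "norm (c *s v) = cmod c * norm (v :: complex ^ 'n::finite)"
  by (simp add: norm_vec_def norm_mult L2_set_right_distrib)

lemma bounded_linear_scale: "bounded_linear ((*s) c :: complex ^ 'n \<Rightarrow> complex ^ 'n::finite)"
  by (rule bounded_linear_intro [where K = "cmod c"])
    (simp_all add: vec_norm_scale vec_eq_iff algebra_simps mult.commute scaleR_conv_of_real)

lemma inner_vec_scale: "(c *s v) \<bullet> w = v \<bullet> (cnj c *s (w :: complex ^ 'n::finite))"
  by (simp add: inner_vec_def inner_complex_def algebra_simps)

lemma adjoint_blinfun_works:
  fixes f :: "(complex ^ 'n) \<Rightarrow>\<^sub>L (complex ^ 'n::finite)"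
  shows "blinfun_apply f v \<bullet> w = v \<bullet> adjoint (blinfun_apply f) w"
  by (rule adjoint_works [symmetric]) (simp add: bounded_linear.linear blinfun.bounded_linear_right)

lemma bounded_linear_adjoint_blinfun:
  "bounded_linear (adjoint (blinfun_apply (f :: (complex ^ 'n) \<Rightarrow>\<^sub>L (complex ^ 'n::finite))))"
  unfolding linear_conv_bounded_linear [symmetric]
  by (rule adjoint_linear) (simp add: bounded_linear.linear blinfun.bounded_linear_right)

lemma adjoint_blinfun_scale:
  fixes f :: "(complex ^ 'n) \<Rightarrow>\<^sub>L (complex ^ 'n::finite)"
  assumes f: "\<forall>c v. blinfun_apply f (c *s v) = c *s blinfun_apply f v"
  shows "adjoint (blinfun_apply f) (c *s w) = c *s adjoint (blinfun_apply f) w"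
proof (rule vector_eq_ldot [THEN iffD1], intro allI)
  fix v
  have "v \<bullet> adjoint (blinfun_apply f) (c *s w) = (cnj c *s blinfun_apply f v) \<bullet> w"
    by (simp add: inner_vec_scale flip: adjoint_blinfun_works)
  also have "\<dots> = (cnj c *s v) \<bullet> adjoint (blinfun_apply f) w"
    using f by (metis adjoint_blinfun_works)
  finally show "v \<bullet> adjoint (blinfun_apply f) (c *s w) = v \<bullet> (c *s adjoint (blinfun_apply f) w)"
    by (simp add: inner_vec_scale)
qed

instantiation op :: (finite) real_normed_algebra
begin

lift_definition zero_op :: "'a op" is 0 by simp
lift_definition plus_op :: "'a op \<Rightarrow> 'a op \<Rightarrow> 'a op" is "(+)"
  by (simp add: blinfun.add_left vec_eq_iff algebra_simps)
lift_definition minus_op :: "'a op \<Rightarrow> 'a op \<Rightarrow> 'a op" is "(-)"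
  by (simp add: blinfun.diff_left vec_eq_iff algebra_simps)
lift_definition uminus_op :: "'a op \<Rightarrow> 'a op" is uminus
  by (simp add: blinfun.minus_left vec_eq_iff)
lift_definition scaleR_op :: "real \<Rightarrow> 'a op \<Rightarrow> 'a op" is scaleR
  by (simp add: blinfun.scaleR_left vec_eq_iff)
lift_definition times_op :: "'a op \<Rightarrow> 'a op \<Rightarrow> 'a op" is blinfun_compose
  by simp
lift_definition norm_op :: "'a op \<Rightarrow> real" is norm .
definition dist_op :: "'a op \<Rightarrow> 'a op \<Rightarrow> real"
  where "dist_op f g = norm (f - g)"
definition sgn_op :: "'a op \<Rightarrow> 'a op"
  where "sgn_op f = inverse (norm f) *\<^sub>R f"
definition uniformity_op :: "('a op \<times> 'a op) filter"
  where "uniformity_op = (INF e\<in>{0 <..}. principal {(x, y). dist x y < e})"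
definition open_op :: "'a op set \<Rightarrow> bool"
  where "open_op U \<longleftrightarrow> (\<forall>x\<in>U. eventually (\<lambda>(x', y). x' = x \<longrightarrow> y \<in> U) uniformity)"

instance
proof
  fix f g k :: "'a op" and a b :: real
  show "f + g + k = f + (g + k)" "f + g = g + f" "0 + f = f" "- f + f = 0" "f - g = f + - g"
    "a *\<^sub>R (f + g) = a *\<^sub>R f + a *\<^sub>R g" "(a + b) *\<^sub>R f = a *\<^sub>R f + b *\<^sub>R f"
    "a *\<^sub>R b *\<^sub>R f = (a * b) *\<^sub>R f" "1 *\<^sub>R f = f"
    by (transfer; simp add: algebra_simps)+
  show "f * g * k = f * (g * k)" by transfer (rule blinfun_eqI, simp)
  show "(f + g) * k = f * k + g * k" "f * (g + k) = f * g + f * k"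
    "a *\<^sub>R f * g = a *\<^sub>R (f * g)" "f * a *\<^sub>R g = a *\<^sub>R (f * g)"
    by (transfer, rule blinfun_eqI, simp add: blinfun.bilinear_simps)+
  show "dist f g = norm (f - g)" by (rule dist_op_def)
  show "sgn f = inverse (norm f) *\<^sub>R f" by (rule sgn_op_def)
  show "uniformity = (INF e\<in>{0 <..}. principal {(x, y). dist x (y :: 'a op) < e})"
    by (rule uniformity_op_def)
  show "open U \<longleftrightarrow> (\<forall>x\<in>U. eventually (\<lambda>(x', y). x' = x \<longrightarrow> y \<in> U) uniformity)"
    for U :: "'a op set" by (rule open_op_def)
  show "norm f = 0 \<longleftrightarrow> f = 0" by transfer simp
  show "norm (f + g) \<le> norm f + norm g" by transfer (rule norm_triangle_ineq)
  show "norm (a *\<^sub>R f) = \<bar>a\<bar> * norm f" by transfer simp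
  show "norm (f * g) \<le> norm f * norm g" by transfer (rule norm_blinfun_compose)
qed

end

instance op :: (finite) banach
proof
  fix F :: "nat \<Rightarrow> 'a op"
  assume F: "Cauchy F"
  define G where "G n = Rep_op (F n)" for n
  have d: "dist (F m) (F n) = dist (G m) (G n)" for m n
    by (simp add: G_def dist_norm norm_op.rep_eq minus_op.rep_eq)
  have "Cauchy G" using F unfolding Cauchy_def d .
  then have "\<exists>g. G \<longlonglongrightarrow> g" by (simp add: Cauchy_convergent flip: convergent_def)
  then obtain g where g: "G \<longlonglongrightarrow> g" ..
  have "blinfun_apply g (c *s v) = c *s blinfun_apply g v" for c v
  proof -
    have "(\<lambda>n. blinfun_apply (G n) (c *s v)) \<longlonglongrightarrow> blinfun_apply g (c *s v)"
      by (rule blinfun.tendsto [OF g tendsto_const])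
    moreover have "(\<lambda>n. c *s blinfun_apply (G n) v) \<longlonglongrightarrow> c *s blinfun_apply g v"
      by (rule bounded_linear.tendsto [OF bounded_linear_scale blinfun.tendsto [OF g tendsto_const]])
    moreover have "blinfun_apply (G n) (c *s v) = c *s blinfun_apply (G n) v" for n
      using Rep_op [of "F n"] by (simp add: G_def)
    ultimately show ?thesis using LIMSEQ_unique by simp
  qed
  then have "Rep_op (Abs_op g) = g" by (intro Abs_op_inverse) simp
  then have "dist (F n) (Abs_op g) = dist (G n) g" for n
    by (simp add: G_def dist_norm norm_op.rep_eq minus_op.rep_eq)
  then have "F \<longlonglongrightarrow> Abs_op g" using g by (simp add: tendsto_dist_iff [of F] tendsto_dist_iff [of G])
  then show "convergent F" by (rule convergentI)
qed

instantiation op :: (finite) cstar_algebra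
begin

lift_definition one_op :: "'a op" is id_blinfun by simp
lift_definition scaleC_op :: "complex \<Rightarrow> 'a op \<Rightarrow> 'a op" is "\<lambda>c f. Blinfun ((*s) c) o\<^sub>L f"
  by (simp add: bounded_linear_Blinfun_apply bounded_linear_scale vec_eq_iff)
lift_definition star_op :: "'a op \<Rightarrow> 'a op" is "\<lambda>f. Blinfun (adjoint (blinfun_apply f))"
  by (simp add: bounded_linear_Blinfun_apply bounded_linear_adjoint_blinfun adjoint_blinfun_scale)

lemma star_op_inner: "apply_op f v \<bullet> w = v \<bullet> apply_op (star f) w"
  by (transfer, subst adjoint_blinfun_works)
    (simp add: bounded_linear_Blinfun_apply bounded_linear_adjoint_blinfun)

lemma star_op_inner': "apply_op (star f) v \<bullet> w = v \<bullet> apply_op f w"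
  by (metis inner_commute star_op_inner)

lemma apply_op_simps: 
  "apply_op 0 v = 0" "apply_op 1 v = v" "apply_op (f + g) v = apply_op f v + apply_op g v"
  "apply_op (f - g) v = apply_op f v - apply_op g v" "apply_op (- f) v = - apply_op f v"
  "apply_op (r *\<^sub>R f) v = r *\<^sub>R apply_op f v" "apply_op (f * g) v = apply_op f (apply_op g v)"
  "apply_op (c *\<^sub>C f) v = c *s apply_op f v"
  "apply_op f (v + w) = apply_op f v + apply_op f w"
  "apply_op f (r *\<^sub>R v) = r *\<^sub>R apply_op f v"
  "apply_op f (c *s v) = c *s apply_op f v"
  by (transfer; simp add: blinfun.bilinear_simps bounded_linear_Blinfun_apply bounded_linear_scale)+

lemma op_eqI: "(\<And>v. apply_op f v = apply_op g v) \<Longrightarrow> f = g"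
  by transfer (rule blinfun_eqI)

lemma op_eqI_inner: "(\<And>v w. apply_op f v \<bullet> w = apply_op g v \<bullet> w) \<Longrightarrow> f = g"
  by (rule op_eqI) (metis vector_eq_rdot)

lemma norm_apply_op: "norm (apply_op f v) \<le> norm f * norm v"
  by transfer (rule norm_blinfun)

lemma norm_op_le: "0 \<le> b \<Longrightarrow> (\<And>v. norm (apply_op f v) \<le> b * norm v) \<Longrightarrow> norm f \<le> b"
  by transfer (rule norm_blinfun_bound)

lemma norm_scaleC_le: "norm (c *\<^sub>C f) \<le> cmod c * norm (f :: 'a op)"
proof (rule norm_op_le)
  show "norm (apply_op (c *\<^sub>C f) v) \<le> cmod c * norm f * norm v" for v
    using norm_apply_op [of f v] by (simp add: apply_op_simps vec_norm_scale mult_left_mono mult.assoc)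
qed simp

instance
proof
  fix f g :: "'a op" and a :: real and c d :: complex
  show "1 * f = f" "f * 1 = f"
    "c *\<^sub>C (f + g) = c *\<^sub>C f + c *\<^sub>C g" "(c + d) *\<^sub>C f = c *\<^sub>C f + d *\<^sub>C f"
    "c *\<^sub>C (d *\<^sub>C f) = (c * d) *\<^sub>C f" "a *\<^sub>R f = complex_of_real a *\<^sub>C f"
    "(c *\<^sub>C f) * g = c *\<^sub>C (f * g)" "f * (c *\<^sub>C g) = c *\<^sub>C (f * g)"
    by (rule op_eqI; simp add: apply_op_simps vec_eq_iff; simp add: algebra_simps scaleR_conv_of_real)+
  show "norm (c *\<^sub>C f) = cmod c * norm f"
  proof (rule antisym)
    show "cmod c * norm f \<le> norm (c *\<^sub>C f)"
    proof (cases "c = 0")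
      case False
      have "f = inverse c *\<^sub>C c *\<^sub>C f"
        using False by (intro op_eqI) (simp add: apply_op_simps vec_eq_iff)
      then have "norm f \<le> cmod (inverse c) * norm (c *\<^sub>C f)" by (metis norm_scaleC_le)
      then show ?thesis using False by (simp add: norm_inverse norm_divide field_simps)
    qed simp
  qed (rule norm_scaleC_le)
  show "star (f + g) = star f + star g" "star (c *\<^sub>C f) = cnj c *\<^sub>C star f"
    "star (f * g) = star g * star f"
    by (rule op_eqI_inner, simp add: apply_op_simps star_op_inner' inner_add_left inner_vec_scale inner_add_right)+
  show ss: "star (star f) = f"
    by (rule op_eqI_inner) (simp add: star_op_inner' flip: star_op_inner)
  \<comment> \<open>This is the Cauchy-Schwarz inequality for the inner product of \<open>v\<close>
    with \<open>star h * h\<close> applied to \<open>v\<close>.\<close>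
  have le: "(norm h)\<^sup>2 \<le> norm (star h * h)" for h :: "'a op"
  proof -
    have "norm h \<le> sqrt (norm (star h * h))"
    proof (rule norm_op_le)
      fix v
      have "(norm (apply_op h v))\<^sup>2 = v \<bullet> apply_op (star h * h) v"
        by (simp add: power2_norm_eq_inner star_op_inner apply_op_simps)
      also have "\<dots> \<le> norm v * norm (apply_op (star h * h) v)" by (rule norm_cauchy_schwarz)
      also have "\<dots> \<le> norm v * (norm (star h * h) * norm v)"
        by (intro mult_left_mono norm_apply_op) simp
      finally have "(norm (apply_op h v))\<^sup>2 \<le> (sqrt (norm (star h * h)) * norm v)\<^sup>2"
        by (simp add: power_mult_distrib power2_eq_square algebra_simps)
      then show "norm (apply_op h v) \<le> sqrt (norm (star h * h)) * norm v"
        by (rule power2_le_imp_le) simp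
    qed simp
    from power_mono [OF this norm_ge_zero, of 2] show ?thesis by simp
  qed
  have norm_star: "norm h \<le> norm (star h)" for h :: "'a op"
  proof (cases "norm h = 0")
    case False
    have "norm h * norm h \<le> norm (star h) * norm h"
      using le [of h] norm_mult_ineq [of "star h" h] by (simp add: power2_eq_square)
    then show ?thesis using False by simp
  qed simp
  have "norm (star f) = norm f"
    using ss norm_star [of f] norm_star [of "star f"] by simp
  then show "norm (star f * f) = (norm f)\<^sup>2"
    using le [of f] norm_mult_ineq [of "star f" f] by (simp add: power2_eq_square)
qed

end

text \<open>Weighted permutation matrices are closed under products, so identities between operators
  of this kind reduce to identities between signs and indices.\<close>

definition perm_op :: "('n \<Rightarrow> real) \<Rightarrow> ('n \<Rightarrow> 'n) \<Rightarrow> 'n::finite op"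
  where "perm_op s \<pi> = Abs_op (Blinfun (\<lambda>v. \<chi> i. s i *\<^sub>R (v $ \<pi> i)))"

lemma apply_perm_op: "apply_op (perm_op s \<pi>) v = (\<chi> i. s i *\<^sub>R (v $ \<pi> i))"
proof -
  have "linear (\<lambda>v :: complex ^ 'a. \<chi> i. s i *\<^sub>R (v $ \<pi> i))"
    by (intro linearI) (simp_all add: vec_eq_iff algebra_simps)
  then have "blinfun_apply (Blinfun (\<lambda>v. \<chi> i. s i *\<^sub>R (v $ \<pi> i))) v = (\<chi> i. s i *\<^sub>R (v $ \<pi> i))"
    for v :: "complex ^ 'a"
    by (simp add: bounded_linear_Blinfun_apply linear_conv_bounded_linear)
  then show ?thesis
    by (simp add: perm_op_def apply_op.rep_eq Abs_op_inverse vec_eq_iff algebra_simps)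
qed

lemma perm_op_mult: "perm_op s \<pi> * perm_op t \<rho> = perm_op (\<lambda>i. s i * t (\<pi> i)) (\<lambda>i. \<rho> (\<pi> i))"
  by (rule op_eqI) (simp add: apply_op_simps apply_perm_op vec_eq_iff)

lemma perm_op_one: "perm_op (\<lambda>_. 1) (\<lambda>i. i) = 1"
  by (rule op_eqI) (simp add: apply_op_simps apply_perm_op vec_eq_iff)

lemma star_perm_op:
  assumes "\<And>i. \<pi> (\<pi> i) = i" "\<And>i. s (\<pi> i) = s i"
  shows "star (perm_op s \<pi>) = perm_op s \<pi>"
proof (rule op_eqI_inner)
  fix v w :: "complex ^ 'a"
  have "bij_betw \<pi> UNIV UNIV" by (rule bij_betw_byWitness [where f' = \<pi>]) (auto simp: assms)
  then have "(\<Sum>i\<in>UNIV. (v $ \<pi> i) \<bullet> (s (\<pi> i) *\<^sub>R w $ \<pi> (\<pi> i))) = (\<Sum>i\<in>UNIV. (v $ i) \<bullet> (s i *\<^sub>R w $ \<pi> i))"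
    by (rule sum.reindex_bij_betw)
  then show "apply_op (star (perm_op s \<pi>)) v \<bullet> w = apply_op (perm_op s \<pi>) v \<bullet> w"
    unfolding star_op_inner' unfolding apply_perm_op inner_vec_def by (simp add: assms)
qed


section \<open>Quaternions over an algebra\<close>

text \<open>The Klein four-group with neutral element \<open>K0\<close>, written additively. It
  indexes the quaternion units and the characters, and two copies of it form the grading
  group.\<close>

datatype klein = K0 | K1 | K2 | K3

lemma UNIV_klein: "UNIV = {K0, K1, K2, K3}"
  using klein.exhaust by auto

instance klein :: finite
  by standard (simp add: UNIV_klein)

lemma sum_klein: "(\<Sum>k\<in>UNIV. f k) = f K0 + f K1 + f K2 + f K3"
  by (simp add: UNIV_klein add.assoc)

lemma all_klein: "(\<forall>k. P k) \<longleftrightarrow> P K0 \<and> P K1 \<and> P K2 \<and> P K3"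
  by (metis klein.exhaust)

instantiation klein :: plus
begin

definition plus_klein :: "klein \<Rightarrow> klein \<Rightarrow> klein" where
  "plus_klein a b = (case a of
     K0 \<Rightarrow> b
   | K1 \<Rightarrow> (case b of K0 \<Rightarrow> K1 | K1 \<Rightarrow> K0 | K2 \<Rightarrow> K3 | K3 \<Rightarrow> K2)
   | K2 \<Rightarrow> (case b of K0 \<Rightarrow> K2 | K1 \<Rightarrow> K3 | K2 \<Rightarrow> K0 | K3 \<Rightarrow> K1)
   | K3 \<Rightarrow> (case b of K0 \<Rightarrow> K3 | K1 \<Rightarrow> K2 | K2 \<Rightarrow> K1 | K3 \<Rightarrow> K0))"

instance ..

end

text \<open>The sign in \<open>e\<^sub>a e\<^sub>b = \<plusminus> e\<^sub>a\<^sub>+\<^sub>b\<close> for the quaternion units \<open>1, i, j, k\<close>.\<close>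

definition qsign :: "klein \<Rightarrow> klein \<Rightarrow> real" where
  "qsign a b = (case a of
     K0 \<Rightarrow> 1
   | K1 \<Rightarrow> (case b of K0 \<Rightarrow> 1 | K1 \<Rightarrow> - 1 | K2 \<Rightarrow> 1 | K3 \<Rightarrow> - 1)
   | K2 \<Rightarrow> (case b of K0 \<Rightarrow> 1 | K1 \<Rightarrow> - 1 | K2 \<Rightarrow> - 1 | K3 \<Rightarrow> 1)
   | K3 \<Rightarrow> (case b of K0 \<Rightarrow> 1 | K1 \<Rightarrow> 1 | K2 \<Rightarrow> - 1 | K3 \<Rightarrow> - 1))"

lemma klein_add_simps [simp]:
  "K0 + a = a" "a + K0 = a" "a + a = K0"
  "K1 + K2 = K3" "K1 + K3 = K2" "K2 + K1 = K3" "K2 + K3 = K1" "K3 + K1 = K2" "K3 + K2 = K1"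
  by (simp_all add: plus_klein_def split: klein.splits)

lemma qsign_simps [simp]:
  "qsign K0 a = 1" "qsign a K0 = 1" "qsign K1 K1 = - 1" "qsign K2 K2 = - 1" "qsign K3 K3 = - 1"
  "qsign K1 K2 = 1" "qsign K2 K3 = 1" "qsign K3 K1 = 1"
  "qsign K2 K1 = - 1" "qsign K3 K2 = - 1" "qsign K1 K3 = - 1"
  by (simp_all add: qsign_def split: klein.splits)

lemma klein_add_cancel [simp]: "a + (a + b) = (b :: klein)"
  by (cases a; cases b; simp)

lemma klein_add_eq_iff: "a + b = c \<longleftrightarrow> b = a + (c :: klein)"
  by (cases a; cases b; cases c; simp)

lemma qsign_sq: "qsign a b * qsign a b = 1"
  by (cases a; cases b; simp)

datatype 'a quat = Quat (qcoeff: "klein \<Rightarrow> 'a")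

lemma quat_eqI: "(\<And>k. qcoeff x k = qcoeff y k) \<Longrightarrow> x = y"
  by (cases x; cases y) auto

instantiation quat :: ("{real_algebra, monoid_mult}") "{real_algebra, monoid_mult}"
begin

definition zero_quat :: "'a quat" where "zero_quat = Quat (\<lambda>_. 0)"
definition one_quat :: "'a quat" where "one_quat = Quat (\<lambda>k. if k = K0 then 1 else 0)"
definition plus_quat :: "'a quat \<Rightarrow> 'a quat \<Rightarrow> 'a quat"
  where "plus_quat x y = Quat (\<lambda>k. qcoeff x k + qcoeff y k)"
definition minus_quat :: "'a quat \<Rightarrow> 'a quat \<Rightarrow> 'a quat"
  where "minus_quat x y = Quat (\<lambda>k. qcoeff x k - qcoeff y k)"
definition uminus_quat :: "'a quat \<Rightarrow> 'a quat"
  where "uminus_quat x = Quat (\<lambda>k. - qcoeff x k)"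
definition scaleR_quat :: "real \<Rightarrow> 'a quat \<Rightarrow> 'a quat"
  where "scaleR_quat r x = Quat (\<lambda>k. r *\<^sub>R qcoeff x k)"
text \<open>Every group element is its own inverse, so \<open>i + k\<close> is the only partner of
  \<open>i\<close> whose sum with \<open>i\<close> is \<open>k\<close>.\<close>

definition times_quat :: "'a quat \<Rightarrow> 'a quat \<Rightarrow> 'a quat"
  where "times_quat x y = Quat (\<lambda>k. \<Sum>i\<in>UNIV. qsign i (i + k) *\<^sub>R (qcoeff x i * qcoeff y (i + k)))"

lemma qcoeff_simps:
  "qcoeff (0 :: 'a quat) k = 0" "qcoeff (1 :: 'a quat) k = (if k = K0 then 1 else 0)"
  "qcoeff (x + y :: 'a quat) k = qcoeff x k + qcoeff y k"
  "qcoeff (x - y :: 'a quat) k = qcoeff x k - qcoeff y k"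
  "qcoeff (- x :: 'a quat) k = - qcoeff x k"
  "qcoeff (r *\<^sub>R x :: 'a quat) k = r *\<^sub>R qcoeff x k"
  "qcoeff (x * y :: 'a quat) k = (\<Sum>i\<in>UNIV. qsign i (i + k) *\<^sub>R (qcoeff x i * qcoeff y (i + k)))"
  by (simp_all add: zero_quat_def one_quat_def plus_quat_def minus_quat_def uminus_quat_def
      scaleR_quat_def times_quat_def)

instance
proof
  fix x y z :: "'a quat" and r s :: real
  show "x + y + z = x + (y + z)" "x + y = y + x" "0 + x = x" "- x + x = 0" "x - y = x + - y"
    "r *\<^sub>R (x + y) = r *\<^sub>R x + r *\<^sub>R y" "(r + s) *\<^sub>R x = r *\<^sub>R x + s *\<^sub>R x"
    "r *\<^sub>R s *\<^sub>R x = (r * s) *\<^sub>R x" "1 *\<^sub>R x = x"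
    by (rule quat_eqI; simp add: qcoeff_simps algebra_simps)+
  show "(x + y) * z = x * z + y * z" "x * (y + z) = x * y + x * z"
    by (rule quat_eqI; simp add: qcoeff_simps algebra_simps sum.distrib)+
  show "r *\<^sub>R x * y = r *\<^sub>R (x * y)" "x * r *\<^sub>R y = r *\<^sub>R (x * y)"
    by (rule quat_eqI; simp add: qcoeff_simps scaleR_sum_right mult.commute)+
  show "1 * x = x" "x * 1 = x"
    by (rule quat_eqI, rename_tac k, case_tac k; simp add: qcoeff_simps sum_klein)+
  show "x * y * z = x * (y * z)"
    by (rule quat_eqI, rename_tac k, case_tac k; simp add: qcoeff_simps sum_klein algebra_simps)
qed

end

text \<open>The element \<open>x\<close> times the unit of index \<open>a\<close>. Nesting it,
  \<open>qunit i (qunit j x)\<close> encodes \<open>x\<close> tensored with two quaternion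
  units.\<close>

definition qunit :: "klein \<Rightarrow> 'a::{real_algebra, monoid_mult} \<Rightarrow> 'a quat"
  where "qunit a x = Quat (\<lambda>k. if k = a then x else 0)"

lemma qcoeff_qunit: "qcoeff (qunit a x) k = (if k = a then x else 0)"
  by (simp add: qunit_def)

lemma qunit_mult: "qunit a x * qunit b y = qunit (a + b) (qsign a b *\<^sub>R (x * y))"
proof (rule quat_eqI)
  fix k
  have "qcoeff (qunit a x * qunit b y) k = (\<Sum>i\<in>UNIV. if i = a then
      (if k = a + b then qsign a b *\<^sub>R (x * y) else 0) else 0)"
    unfolding qcoeff_simps by (rule sum.cong) (auto simp: qcoeff_qunit klein_add_eq_iff)
  then show "qcoeff (qunit a x * qunit b y) k = qcoeff (qunit (a + b) (qsign a b *\<^sub>R (x * y))) k"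
    by (simp add: qcoeff_qunit)
qed

lemma qunit_linear:
  "qunit a 0 = 0" "qunit K0 1 = 1" "qunit a (x + y) = qunit a x + qunit a y"
  "qunit a (x - y) = qunit a x - qunit a y" "qunit a (- x) = - qunit a x"
  "qunit a (r *\<^sub>R x) = r *\<^sub>R qunit a x"
  by (rule quat_eqI; simp add: qcoeff_simps qcoeff_qunit)+


section \<open>Rotation matrices and rank-one matrices\<close>

text \<open>The equations of \<open>SO(3)\<close>; the index \<open>K0\<close> is not used, and \<open>kcyc\<close> permutes the other three
  cyclically.\<close>

fun kcyc :: "klein \<Rightarrow> klein" where
  "kcyc K0 = K0" | "kcyc K1 = K2" | "kcyc K2 = K3" | "kcyc K3 = K1"

definition rotation :: "(klein \<Rightarrow> klein \<Rightarrow> 'a::{ring, monoid_mult}) \<Rightarrow> bool" where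
  "rotation r \<longleftrightarrow>
    (\<forall>i j k l. r i j * r k l = r k l * r i j) \<and>
    (\<forall>i k. i \<noteq> K0 \<longrightarrow> k \<noteq> K0 \<longrightarrow>
      r i K1 * r k K1 + r i K2 * r k K2 + r i K3 * r k K3 = (if i = k then 1 else 0)) \<and>
    (\<forall>i k. i \<noteq> K0 \<longrightarrow> k \<noteq> K0 \<longrightarrow>
      r K1 i * r K1 k + r K2 i * r K2 k + r K3 i * r K3 k = (if i = k then 1 else 0)) \<and>
    (\<forall>i j. i \<noteq> K0 \<longrightarrow> j \<noteq> K0 \<longrightarrow>
      r i j * r (kcyc i) (kcyc j) - r (kcyc i) j * r i (kcyc j) = r (kcyc (kcyc i)) (kcyc (kcyc j)))"

text \<open>For the rotation matrix of a unit quaternion \<open>q\<close> this is \<open>4 q\<^sub>a q\<^sub>b\<close>.\<close>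

definition qsym :: "(klein \<Rightarrow> klein \<Rightarrow> 'a::{ring, monoid_mult}) \<Rightarrow> klein \<Rightarrow> klein \<Rightarrow> 'a" where
  "qsym r a b = (case a of
     K0 \<Rightarrow> (case b of
         K0 \<Rightarrow> 1 + r K1 K1 + r K2 K2 + r K3 K3
       | K1 \<Rightarrow> r K3 K2 - r K2 K3
       | K2 \<Rightarrow> r K1 K3 - r K3 K1
       | K3 \<Rightarrow> r K2 K1 - r K1 K2)
   | K1 \<Rightarrow> (case b of
         K0 \<Rightarrow> r K3 K2 - r K2 K3
       | K1 \<Rightarrow> 1 + r K1 K1 - r K2 K2 - r K3 K3
       | K2 \<Rightarrow> r K1 K2 + r K2 K1
       | K3 \<Rightarrow> r K1 K3 + r K3 K1)
   | K2 \<Rightarrow> (case b of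
         K0 \<Rightarrow> r K1 K3 - r K3 K1
       | K1 \<Rightarrow> r K1 K2 + r K2 K1
       | K2 \<Rightarrow> 1 - r K1 K1 + r K2 K2 - r K3 K3
       | K3 \<Rightarrow> r K2 K3 + r K3 K2)
   | K3 \<Rightarrow> (case b of
         K0 \<Rightarrow> r K2 K1 - r K1 K2
       | K1 \<Rightarrow> r K1 K3 + r K3 K1
       | K2 \<Rightarrow> r K2 K3 + r K3 K2
       | K3 \<Rightarrow> 1 - r K1 K1 - r K2 K2 + r K3 K3))"

lemma qsym_commute: "qsym r a b = qsym r b a"
  by (cases a; cases b; simp add: qsym_def)

text \<open>The quadratic relations of SO(3), oriented as rewrite rules. Products of distinct
  entries occur in both orders, since ordered rewriting with commutativity may leave either one. The
  rule for the square of \<open>r K3 K3\<close> is already reduced by those for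
  \<open>r K3 K1\<close> and \<open>r K3 K2\<close>.\<close>

lemma rotation_reduce:
  fixes r :: "klein \<Rightarrow> klein \<Rightarrow> 'a::{ring, monoid_mult}"
  assumes r: "rotation r"
  shows "r K1 K3 * r K1 K3 = 1 - r K1 K1 * r K1 K1 - r K1 K2 * r K1 K2"
    "r K2 K3 * r K2 K3 = 1 - r K2 K1 * r K2 K1 - r K2 K2 * r K2 K2"
    "r K3 K1 * r K3 K1 = 1 - r K1 K1 * r K1 K1 - r K2 K1 * r K2 K1"
    "r K3 K2 * r K3 K2 = 1 - r K1 K2 * r K1 K2 - r K2 K2 * r K2 K2"
    "r K3 K3 * r K3 K3 = r K1 K1 * r K1 K1 + r K2 K1 * r K2 K1 + r K1 K2 * r K1 K2 + r K2 K2 * r K2 K2 - 1"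
    "r K1 K1 * r K2 K1 = - (r K1 K2 * r K2 K2) - r K1 K3 * r K2 K3"
    "r K2 K1 * r K1 K1 = - (r K1 K2 * r K2 K2) - r K1 K3 * r K2 K3"
    "r K1 K1 * r K1 K2 = - (r K2 K1 * r K2 K2) - r K3 K1 * r K3 K2"
    "r K1 K2 * r K1 K1 = - (r K2 K1 * r K2 K2) - r K3 K1 * r K3 K2"
    "r K1 K1 * r K3 K1 = - (r K1 K2 * r K3 K2) - r K1 K3 * r K3 K3"
    "r K3 K1 * r K1 K1 = - (r K1 K2 * r K3 K2) - r K1 K3 * r K3 K3"
    "r K1 K1 * r K1 K3 = - (r K2 K1 * r K2 K3) - r K3 K1 * r K3 K3"
    "r K1 K3 * r K1 K1 = - (r K2 K1 * r K2 K3) - r K3 K1 * r K3 K3"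
    "r K2 K1 * r K3 K1 = - (r K2 K2 * r K3 K2) - r K2 K3 * r K3 K3"
    "r K3 K1 * r K2 K1 = - (r K2 K2 * r K3 K2) - r K2 K3 * r K3 K3"
    "r K1 K2 * r K1 K3 = - (r K2 K2 * r K2 K3) - r K3 K2 * r K3 K3"
    "r K1 K3 * r K1 K2 = - (r K2 K2 * r K2 K3) - r K3 K2 * r K3 K3"
    "r K1 K1 * r K2 K2 = r K2 K1 * r K1 K2 + r K3 K3"
    "r K2 K2 * r K1 K1 = r K2 K1 * r K1 K2 + r K3 K3"
    "r K1 K2 * r K2 K3 = r K2 K2 * r K1 K3 + r K3 K1"
    "r K2 K3 * r K1 K2 = r K2 K2 * r K1 K3 + r K3 K1"
    "r K1 K3 * r K2 K1 = r K2 K3 * r K1 K1 + r K3 K2"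
    "r K2 K1 * r K1 K3 = r K2 K3 * r K1 K1 + r K3 K2"
    "r K2 K1 * r K3 K2 = r K3 K1 * r K2 K2 + r K1 K3"
    "r K3 K2 * r K2 K1 = r K3 K1 * r K2 K2 + r K1 K3"
    "r K2 K2 * r K3 K3 = r K3 K2 * r K2 K3 + r K1 K1"
    "r K3 K3 * r K2 K2 = r K3 K2 * r K2 K3 + r K1 K1"
    "r K2 K3 * r K3 K1 = r K3 K3 * r K2 K1 + r K1 K2"
    "r K3 K1 * r K2 K3 = r K3 K3 * r K2 K1 + r K1 K2"
    "r K3 K1 * r K1 K2 = r K1 K1 * r K3 K2 + r K2 K3"
    "r K1 K2 * r K3 K1 = r K1 K1 * r K3 K2 + r K2 K3"
    "r K3 K2 * r K1 K3 = r K1 K2 * r K3 K3 + r K2 K1"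
    "r K1 K3 * r K3 K2 = r K1 K2 * r K3 K3 + r K2 K1"
    "r K3 K3 * r K1 K1 = r K1 K3 * r K3 K1 + r K2 K2"
    "r K1 K1 * r K3 K3 = r K1 K3 * r K3 K1 + r K2 K2"
proof -
  have comm: "r i j * r k l = r k l * r i j" for i j k l
    using r by (simp add: rotation_def)
  have row: "r i K1 * r k K1 + r i K2 * r k K2 + r i K3 * r k K3 = (if i = k then 1 else 0)"
    and col: "r K1 i * r K1 k + r K2 i * r K2 k + r K3 i * r K3 k = (if i = k then 1 else 0)"
    if "i \<noteq> K0" "k \<noteq> K0" for i k
    using r that by (simp_all add: rotation_def)
  have cof: "r i j * r (kcyc i) (kcyc j) = r (kcyc i) j * r i (kcyc j) + r (kcyc (kcyc i)) (kcyc (kcyc j))"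
    if "i \<noteq> K0" "j \<noteq> K0" for i j
    using r that by (simp add: rotation_def diff_eq_eq add.commute)
  show "r K1 K3 * r K1 K3 = 1 - r K1 K1 * r K1 K1 - r K1 K2 * r K1 K2"
    using row [of K1 K1] by (simp add: algebra_simps)
  show "r K2 K3 * r K2 K3 = 1 - r K2 K1 * r K2 K1 - r K2 K2 * r K2 K2"
    using row [of K2 K2] by (simp add: algebra_simps)
  show 31: "r K3 K1 * r K3 K1 = 1 - r K1 K1 * r K1 K1 - r K2 K1 * r K2 K1"
    using col [of K1 K1] by (simp add: algebra_simps)
  show 32: "r K3 K2 * r K3 K2 = 1 - r K1 K2 * r K1 K2 - r K2 K2 * r K2 K2"
    using col [of K2 K2] by (simp add: algebra_simps)
  have "r K3 K3 * r K3 K3 = 1 - r K3 K1 * r K3 K1 - r K3 K2 * r K3 K2"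
    using row [of K3 K3] by (simp add: algebra_simps)
  then show "r K3 K3 * r K3 K3 = r K1 K1 * r K1 K1 + r K2 K1 * r K2 K1 + r K1 K2 * r K1 K2 + r K2 K2 * r K2 K2 - 1"
    unfolding 31 32 by (simp add: algebra_simps)
  show *: "r K1 K1 * r K2 K1 = - (r K1 K2 * r K2 K2) - r K1 K3 * r K2 K3"
    using row [of K1 K2] by (simp add: eq_neg_iff_add_eq_0 algebra_simps)
  show "r K2 K1 * r K1 K1 = - (r K1 K2 * r K2 K2) - r K1 K3 * r K2 K3"
    unfolding comm [of K2 K1] by (rule *)
  show *: "r K1 K1 * r K1 K2 = - (r K2 K1 * r K2 K2) - r K3 K1 * r K3 K2"
    using col [of K1 K2] by (simp add: eq_neg_iff_add_eq_0 algebra_simps)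
  show "r K1 K2 * r K1 K1 = - (r K2 K1 * r K2 K2) - r K3 K1 * r K3 K2"
    unfolding comm [of K1 K2] by (rule *)
  show *: "r K1 K1 * r K3 K1 = - (r K1 K2 * r K3 K2) - r K1 K3 * r K3 K3"
    using row [of K1 K3] by (simp add: eq_neg_iff_add_eq_0 algebra_simps)
  show "r K3 K1 * r K1 K1 = - (r K1 K2 * r K3 K2) - r K1 K3 * r K3 K3"
    unfolding comm [of K3 K1] by (rule *)
  show *: "r K1 K1 * r K1 K3 = - (r K2 K1 * r K2 K3) - r K3 K1 * r K3 K3"
    using col [of K1 K3] by (simp add: eq_neg_iff_add_eq_0 algebra_simps)
  show "r K1 K3 * r K1 K1 = - (r K2 K1 * r K2 K3) - r K3 K1 * r K3 K3"
    unfolding comm [of K1 K3] by (rule *)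
  show *: "r K2 K1 * r K3 K1 = - (r K2 K2 * r K3 K2) - r K2 K3 * r K3 K3"
    using row [of K2 K3] by (simp add: eq_neg_iff_add_eq_0 algebra_simps)
  show "r K3 K1 * r K2 K1 = - (r K2 K2 * r K3 K2) - r K2 K3 * r K3 K3"
    unfolding comm [of K3 K1] by (rule *)
  show *: "r K1 K2 * r K1 K3 = - (r K2 K2 * r K2 K3) - r K3 K2 * r K3 K3"
    using col [of K2 K3] by (simp add: eq_neg_iff_add_eq_0 algebra_simps)
  show "r K1 K3 * r K1 K2 = - (r K2 K2 * r K2 K3) - r K3 K2 * r K3 K3"
    unfolding comm [of K1 K3] by (rule *)
  show *: "r K1 K1 * r K2 K2 = r K2 K1 * r K1 K2 + r K3 K3"
    using cof [of K1 K1] by simp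
  show "r K2 K2 * r K1 K1 = r K2 K1 * r K1 K2 + r K3 K3"
    unfolding comm [of K2 K2 K1] by (rule *)
  show *: "r K1 K2 * r K2 K3 = r K2 K2 * r K1 K3 + r K3 K1"
    using cof [of K1 K2] by simp
  show "r K2 K3 * r K1 K2 = r K2 K2 * r K1 K3 + r K3 K1"
    unfolding comm [of K2 K3 K1] by (rule *)
  show *: "r K1 K3 * r K2 K1 = r K2 K3 * r K1 K1 + r K3 K2"
    using cof [of K1 K3] by simp
  show "r K2 K1 * r K1 K3 = r K2 K3 * r K1 K1 + r K3 K2"
    unfolding comm [of K2 K1 K1] by (rule *)
  show *: "r K2 K1 * r K3 K2 = r K3 K1 * r K2 K2 + r K1 K3"
    using cof [of K2 K1] by simp
  show "r K3 K2 * r K2 K1 = r K3 K1 * r K2 K2 + r K1 K3"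
    unfolding comm [of K3 K2 K2] by (rule *)
  show *: "r K2 K2 * r K3 K3 = r K3 K2 * r K2 K3 + r K1 K1"
    using cof [of K2 K2] by simp
  show "r K3 K3 * r K2 K2 = r K3 K2 * r K2 K3 + r K1 K1"
    unfolding comm [of K3 K3 K2] by (rule *)
  show *: "r K2 K3 * r K3 K1 = r K3 K3 * r K2 K1 + r K1 K2"
    using cof [of K2 K3] by simp
  show "r K3 K1 * r K2 K3 = r K3 K3 * r K2 K1 + r K1 K2"
    unfolding comm [of K3 K1 K2] by (rule *)
  show *: "r K3 K1 * r K1 K2 = r K1 K1 * r K3 K2 + r K2 K3"
    using cof [of K3 K1] by simp
  show "r K1 K2 * r K3 K1 = r K1 K1 * r K3 K2 + r K2 K3"
    unfolding comm [of K1 K2 K3] by (rule *)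
  show *: "r K3 K2 * r K1 K3 = r K1 K2 * r K3 K3 + r K2 K1"
    using cof [of K3 K2] by simp
  show "r K1 K3 * r K3 K2 = r K1 K2 * r K3 K3 + r K2 K1"
    unfolding comm [of K1 K3 K3] by (rule *)
  show *: "r K3 K3 * r K1 K1 = r K1 K3 * r K3 K1 + r K2 K2"
    using cof [of K3 K3] by simp
  show "r K1 K1 * r K3 K3 = r K1 K3 * r K3 K1 + r K2 K2"
    unfolding comm [of K1 K1 K3] by (rule *)
qed

text \<open>On actual rotations both sides are \<open>16\<close> times the product of four
  coordinates of the quaternion. Over a general algebra each of the 256 instances follows from the
  quadratic relations.\<close>

lemma qsym_minor:
  assumes r: "rotation r"
  shows "qsym r a b * qsym r c d = qsym r a c * qsym r b d"
proof -
  have comm: "r i j * r k l = r k l * r i j" for i j k l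
    using r by (simp add: rotation_def)
  have "\<forall>a b c d. qsym r a b * qsym r c d = qsym r a c * qsym r b d"
    unfolding all_klein
    by (simp add: qsym_def algebra_simps rotation_reduce [OF r] comm)
  then show ?thesis by blast
qed


section \<open>Products of commuting rank-one entries\<close>

lemma finite_lists_length: "finite {v :: 'b::finite list. length v = n}"
  using finite_lists_length_eq [of "UNIV :: 'b set" n] by simp

lemma lists_length_Suc: "{v. length v = Suc n} = (\<lambda>(b, v). b # v) ` (UNIV \<times> {v. length v = n})"
  by (auto simp: length_Suc_conv image_iff)

lemma prod_list_sum_expand:
  fixes f :: "'l \<Rightarrow> 'b::finite \<Rightarrow> real" and g :: "'b \<Rightarrow> 'r::{real_algebra, monoid_mult}"
  shows "prod_list (map (\<lambda>l. \<Sum>b\<in>UNIV. f l b *\<^sub>R g b) w) =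
    (\<Sum>v | length v = length w. prod_list (map2 f w v) *\<^sub>R prod_list (map g v))"
proof (induction w)
  case (Cons l w)
  have "prod_list (map (\<lambda>l. \<Sum>b\<in>UNIV. f l b *\<^sub>R g b) (l # w)) =
      (\<Sum>b\<in>UNIV. \<Sum>v | length v = length w.
        prod_list (map2 f (l # w) (b # v)) *\<^sub>R prod_list (map g (b # v)))"
    by (simp add: Cons sum_product mult.commute)
  also have "\<dots> = (\<Sum>(b, v)\<in>UNIV \<times> {v. length v = length w}.
        prod_list (map2 f (l # w) (b # v)) *\<^sub>R prod_list (map g (b # v)))"
    by (rule sum.cartesian_product)
  also have "\<dots> = (\<Sum>v | length v = length (l # w). prod_list (map2 f (l # w) v) *\<^sub>R prod_list (map g v))"
    unfolding list.size add_Suc_right add_0_right lists_length_Suc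
    by (subst sum.reindex) (auto simp: inj_on_def intro!: sum.cong)
  finally show ?case .
qed simp

text \<open>For \<open>Z a b = q a * q b\<close> with commuting \<open>q\<close> this is the
  monomial of the list. An unpaired last index contributes the factor \<open>1\<close>.\<close>

fun pair_prod :: "('k \<Rightarrow> 'k \<Rightarrow> 'r::monoid_mult) \<Rightarrow> 'k list \<Rightarrow> 'r" where
  "pair_prod Z (a # b # s) = Z a b * pair_prod Z s"
| "pair_prod Z _ = 1"

text \<open>Behind a prefix of even length, \<open>a\<close> and \<open>b\<close> form one pair and
  symmetry exchanges them. Behind an odd prefix they belong to neighbouring pairs and the minor
  identity applies; the parity assumption provides the partner of \<open>b\<close>.\<close>

lemma pair_prod_swap:
  assumes sym: "\<And>a b. Z a b = Z b a" and minor: "\<And>a b c d. Z a b * Z c d = Z a c * Z b d"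
    and "even (length p + length s)"
  shows "pair_prod Z (p @ a # b # s) = pair_prod Z (p @ b # a # s)"
  using assms(3)
proof (induction p rule: induct_list012)
  case 1
  then show ?case by (simp add: sym [of a b])
next
  case (2 c)
  then obtain d s' where "s = d # s'" by (cases s) auto
  then show ?case using minor [of c a b d] by (simp flip: mult.assoc)
qed simp

lemma pair_prod_move:
  assumes "\<And>a b. Z a b = Z b a" "\<And>a b c d. Z a b * Z c d = Z a c * Z b d"
    and "even (length p + Suc (length s + length t))"
  shows "pair_prod Z (p @ x # s @ t) = pair_prod Z (p @ s @ x # t)"
  using assms(3)
proof (induction s arbitrary: p)
  case (Cons y s)
  have "pair_prod Z (p @ x # y # s @ t) = pair_prod Z (p @ y # x # s @ t)"
    using Cons.prems by (intro pair_prod_swap assms) auto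
  also have "\<dots> = pair_prod Z ((p @ [y]) @ s @ x # t)"
    using Cons.IH [of "p @ [y]"] Cons.prems by simp
  finally show ?case by simp
qed simp

lemma pair_prod_mset:
  assumes Z: "\<And>a b. Z a b = Z b a" "\<And>a b c d. Z a b * Z c d = Z a c * Z b d"
    and "mset xs = mset ys" "even (length xs)"
  shows "pair_prod Z xs = pair_prod Z ys"
proof -
  \<comment> \<open>The prefix \<open>p\<close> is needed because removing a single leading index
    would shift the pairing.\<close>
  have "pair_prod Z (p @ xs) = pair_prod Z (p @ ys)"
    if "mset xs = mset ys" "even (length p + length xs)" for p
    using that
  proof (induction xs arbitrary: p ys)
    case (Cons x xs)
    then have "x \<in> set ys" by (metis list.set_intros(1) mset_eq_setD)
    then obtain s t where ys: "ys = s @ x # t" by (meson split_list)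
    have m: "mset xs = mset (s @ t)" using Cons.prems(1) ys by simp
    then have "length xs = length (s @ t)" by (rule mset_eq_length)
    then have "pair_prod Z (p @ x # s @ t) = pair_prod Z (p @ s @ x # t)"
      using Cons.prems(2) by (intro pair_prod_move Z) simp
    moreover have "pair_prod Z ((p @ [x]) @ xs) = pair_prod Z ((p @ [x]) @ s @ t)"
      using m Cons.prems(2) by (intro Cons.IH) simp_all
    ultimately show ?case by (simp add: ys)
  qed simp
  from this [of "[]"] assms show ?thesis by simp
qed

definition flatten :: "('k \<times> 'k) list \<Rightarrow> 'k list"
  where "flatten v = concat (map (\<lambda>(a, b). [a, b]) v)"

lemma length_flatten: "length (flatten v) = 2 * length v"
  by (induction v) (auto simp: flatten_def)

lemma pair_prod_flatten: "pair_prod Z (flatten v) = prod_list (map (\<lambda>p. Z (fst p) (snd p)) v)"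
  by (induction v) (auto simp: flatten_def)

lemma prod_list_flatten:
  "prod_list (map (\<lambda>p. q (fst p) * q (snd p)) v) = prod_list (map q (flatten v))"
  for q :: "'k \<Rightarrow> 'r::monoid_mult"
  by (induction v) (auto simp: flatten_def mult.assoc)


section \<open>Polynomials vanishing identically\<close>

text \<open>Kronecker's substitution: \<open>q\<^sub>a = t ^ N ^ a\<close> separates the monomials of degree less than \<open>N\<close>.\<close>

definition kronecker :: "nat \<Rightarrow> ('k \<Rightarrow> nat) \<Rightarrow> 'k list \<Rightarrow> nat"
  where "kronecker N e s = sum_list (map (\<lambda>a. N ^ e a) s)"

lemma prod_list_kronecker: "prod_list (map (\<lambda>a. t ^ N ^ e a) s) = (t :: 'a::monoid_mult) ^ kronecker N e s"
  by (induction s) (simp_all add: kronecker_def power_add)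

lemma digits_unique:
  fixes c d :: "nat \<Rightarrow> nat"
  assumes "(\<Sum>i<k. c i * N ^ i) = (\<Sum>i<k. d i * N ^ i)" "\<And>i. i < k \<Longrightarrow> c i < N" "\<And>i. i < k \<Longrightarrow> d i < N"
    and "i < k"
  shows "c i = d i"
  using assms
proof (induction k arbitrary: c d i)
  case (Suc k)
  have split: "(\<Sum>i<Suc k. c i * N ^ i) = c 0 + N * (\<Sum>i<k. c (Suc i) * N ^ i)" for c :: "nat \<Rightarrow> nat"
    by (subst sum.lessThan_Suc_shift) (simp add: sum_distrib_left mult.left_commute mult.commute)
  have lt: "c 0 < N" "d 0 < N" using Suc.prems by auto
  have eq: "c 0 + N * (\<Sum>i<k. c (Suc i) * N ^ i) = d 0 + N * (\<Sum>i<k. d (Suc i) * N ^ i)"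
    using Suc.prems(1) unfolding split .
  have 0: "c 0 = d 0" using arg_cong [OF eq, of "\<lambda>x. x mod N"] lt by simp
  then have "(\<Sum>i<k. c (Suc i) * N ^ i) = (\<Sum>i<k. d (Suc i) * N ^ i)" using eq lt by simp
  then have "c (Suc i) = d (Suc i)" if "i < k" for i
    using that Suc.prems(2,3) Suc.IH [of "\<lambda>i. c (Suc i)" "\<lambda>i. d (Suc i)" i] by simp
  with 0 Suc.prems(4) show ?case by (cases i) auto
qed simp

text \<open>The base \<open>N\<close> digits of the code are the multiplicities of the indices,
  which are less than \<open>N\<close> by the length bounds.\<close>

lemma kronecker_inj:
  fixes s t :: "'k::finite list"
  assumes eq: "kronecker N e s = kronecker N e t" and e: "bij_betw e UNIV {..<k}"
    and "length s < N" "length t < N"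
  shows "mset s = mset t"
proof (rule multiset_eqI)
  fix a :: 'k
  define f where "f = inv_into UNIV e"
  have f: "bij_betw f {..<k} UNIV" unfolding f_def by (rule bij_betw_inv_into [OF e])
  have ef: "e (f i) = i" if "i < k" for i
    using e that unfolding f_def by (intro f_inv_into_f) (auto simp: bij_betw_def)
  have k: "kronecker N e s = (\<Sum>i<k. count (mset s) (f i) * N ^ i)" for s :: "'k list"
  proof -
    have "kronecker N e s = (\<Sum>a\<in>UNIV. count (mset s) a * N ^ e a)"
    proof (induction s)
      case (Cons x s)
      have "(\<Sum>a\<in>UNIV. count (mset (x # s)) a * N ^ e a) =
          (\<Sum>a\<in>UNIV. count (mset s) a * N ^ e a + (if a = x then N ^ e x else 0))"
        by (rule sum.cong) auto
      then show ?case using Cons by (simp add: kronecker_def sum.distrib)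
    qed (simp add: kronecker_def)
    also have "\<dots> = (\<Sum>i<k. count (mset s) (f i) * N ^ i)"
      by (rule sum.reindex_bij_betw [OF f, symmetric, THEN trans]) (simp add: ef)
    finally show ?thesis .
  qed
  have lt: "count (mset s) b < N" if "length s < N" for s b
    using that count_le_length [of s b] by (simp add: count_mset)
  have "count (mset s) (f i) = count (mset t) (f i)" if "i < k" for i
    by (rule digits_unique [where k = k and N = N]) (use eq k assms lt that in auto)
  moreover obtain i where "i < k" "a = f i" using f by (auto simp: bij_betw_def)
  ultimately show "count (mset s) a = count (mset t) a" by simp
qed

text \<open>After the substitution a polynomial in one variable vanishes at all real points, hence
  is zero; each of its coefficients collects the words with one multiset of indices.\<close>

lemma vanishing_coefficients:
  fixes C :: "'v \<Rightarrow> complex" and s :: "'v \<Rightarrow> 'k::finite list"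
  assumes V: "finite V" and len: "\<And>v. v \<in> V \<Longrightarrow> length (s v) = m"
    and van: "\<And>q :: 'k \<Rightarrow> real. (\<Sum>v\<in>V. C v * of_real (prod_list (map q (s v)))) = 0"
  shows "(\<Sum>v | v \<in> V \<and> mset (s v) = M. C v) = 0"
proof (cases "\<exists>v\<in>V. mset (s v) = M")
  case True
  then obtain w where w: "w \<in> V" "mset (s w) = M" by blast
  obtain e :: "'k \<Rightarrow> nat" where e: "bij_betw e UNIV {..<CARD('k)}"
    using ex_bij_betw_finite_nat [of "UNIV :: 'k set"] by (auto simp: atLeast0LessThan)
  \<comment> \<open>The base \<open>Suc m\<close> exceeds the common length \<open>m\<close>, as
    unique digits require.\<close>
  let ?code = "\<lambda>v. kronecker (Suc m) e (s v)"
  define p where "p = (\<Sum>v\<in>V. monom (C v) (?code v))"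
  have "poly p (of_real t) = 0" for t :: real
    using van [of "\<lambda>a. t ^ Suc m ^ e a"]
    by (simp add: p_def poly_sum poly_monom prod_list_kronecker)
  then have "range complex_of_real \<subseteq> {x. poly p x = 0}" by auto
  moreover have "infinite (range complex_of_real)"
    by (simp add: finite_image_iff inj_on_def infinite_UNIV_char_0)
  ultimately have "p = 0" using poly_roots_finite finite_subset by blast
  then have "0 = coeff p (?code w)" by simp
  also have "\<dots> = (\<Sum>v\<in>V. if ?code v = ?code w then C v else 0)"
    by (simp add: p_def coeff_sum coeff_monom if_distrib)
  also have "\<dots> = (\<Sum>v | v \<in> V \<and> mset (s v) = M. C v)"
  proof -
    have "?code v = ?code w \<longleftrightarrow> mset (s v) = M" if "v \<in> V" for v
    proof
      assume "?code v = ?code w"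
      then show "mset (s v) = M" using kronecker_inj [OF _ e] len w that by fastforce
    next
      assume "mset (s v) = M"
      then have "mset (map (\<lambda>a. Suc m ^ e a) (s v)) = mset (map (\<lambda>a. Suc m ^ e a) (s w))"
        using w by simp
      then show "?code v = ?code w" unfolding kronecker_def by (metis sum_mset_sum_list)
    qed
    then show ?thesis
      by (simp add: V sum.If_cases Int_def cong: conj_cong sum.cong)
  qed
  finally show ?thesis by simp
next
  case False
  then have "{v. v \<in> V \<and> mset (s v) = M} = {}" by blast
  then show ?thesis by (simp only: sum.empty)
qed

lemma scaleC_sum_left: "(\<Sum>i\<in>I. f i) *\<^sub>C (x::'a::cstar_algebra) = (\<Sum>i\<in>I. f i *\<^sub>C x)"
  by (induction I rule: infinite_finite_induct) (simp_all add: scaleC_add_left)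

text \<open>Because a product of entries of a symmetric matrix with vanishing \<open>2 \<times> 2\<close> minors only depends on the
  multiset of the indices, a word in linear combinations of these entries is determined by its polynomial.\<close>

lemma rank_one_words_vanish:
  fixes Z :: "'k::finite \<Rightarrow> 'k \<Rightarrow> 'r::{real_algebra, monoid_mult}"
    and \<phi> :: "'r \<Rightarrow> 'a::cstar_algebra" and K :: "'l \<Rightarrow> 'k \<times> 'k \<Rightarrow> real"
  assumes Z: "\<And>a b. Z a b = Z b a" "\<And>a b c d. Z a b * Z c d = Z a c * Z b d"
    and \<phi>: "\<And>x y. \<phi> (x + y) = \<phi> x + \<phi> y" "\<And>r x. \<phi> (r *\<^sub>R x) = r *\<^sub>R \<phi> x"
    and J: "finite J" "\<And>j. j \<in> J \<Longrightarrow> length (w j) = n"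
    and van: "\<And>q :: 'k \<Rightarrow> real. (\<Sum>j\<in>J. c j * of_real (prod_list (map (\<lambda>l. \<Sum>p\<in>UNIV. K l p *\<^sub>R
        (q (fst p) * q (snd p))) (w j)))) = 0"
  shows "(\<Sum>j\<in>J. c j *\<^sub>C \<phi> (prod_list (map (\<lambda>l. \<Sum>p\<in>UNIV. K l p *\<^sub>R Z (fst p) (snd p)) (w j)))) = 0"
proof -
  have \<phi>0: "\<phi> 0 = 0" using \<phi>(1) [of 0 0] by simp
  have \<phi>_sum: "\<phi> (\<Sum>i\<in>I. f i) = (\<Sum>i\<in>I. \<phi> (f i))" for f and I :: "('k \<times> 'k) list set"
    by (induction I rule: infinite_finite_induct) (simp_all add: \<phi> \<phi>0)
  define V where "V = {v :: ('k \<times> 'k) list. length v = n}"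
  have V: "finite V" unfolding V_def by (rule finite_lists_length)
  define \<kappa> where "\<kappa> j v = prod_list (map2 K (w j) v)" for j v
  define C where "C v = (\<Sum>j\<in>J. c j * of_real (\<kappa> j v))" for v
  \<comment> \<open>This is used twice: for real monomials in the hypothesis and for the entries of
    \<open>Z\<close> in the conclusion.\<close>
  have exp: "prod_list (map (\<lambda>l. \<Sum>p\<in>UNIV. K l p *\<^sub>R g p) (w j)) = (\<Sum>v\<in>V. \<kappa> j v *\<^sub>R prod_list (map g v))"
    if "j \<in> J" for j and g :: "'k \<times> 'k \<Rightarrow> 's::{real_algebra, monoid_mult}"
    unfolding prod_list_sum_expand V_def \<kappa>_def J(2) [OF that] ..
  have "(\<Sum>v\<in>V. C v * of_real (prod_list (map q (flatten v)))) = 0" for q :: "'k \<Rightarrow> real"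
  proof -
    have "(\<Sum>v\<in>V. C v * of_real (prod_list (map q (flatten v)))) =
        (\<Sum>j\<in>J. c j * of_real (\<Sum>v\<in>V. \<kappa> j v * prod_list (map q (flatten v))))"
      unfolding C_def of_real_sum sum_distrib_left sum_distrib_right
      by (subst sum.swap) (simp add: mult.assoc)
    also have "\<dots> = 0"
      unfolding van [of q, symmetric]
    proof (rule sum.cong [OF refl])
      fix j assume "j \<in> J"
      from exp [OF this, of "\<lambda>p. q (fst p) * q (snd p)"]
      show "c j * of_real (\<Sum>v\<in>V. \<kappa> j v * prod_list (map q (flatten v))) =
          c j * of_real (prod_list (map (\<lambda>l. \<Sum>p\<in>UNIV. K l p *\<^sub>R (q (fst p) * q (snd p))) (w j)))"
        by (simp add: prod_list_flatten)
    qed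
    finally show ?thesis .
  qed
  from vanishing_coefficients [OF V _ this, of "2 * n"]
  have C0: "(\<Sum>v | v \<in> V \<and> mset (flatten v) = M. C v) = 0" for M
    by (simp add: V_def length_flatten)
  have "(\<Sum>j\<in>J. c j *\<^sub>C \<phi> (prod_list (map (\<lambda>l. \<Sum>p\<in>UNIV. K l p *\<^sub>R Z (fst p) (snd p)) (w j)))) =
      (\<Sum>j\<in>J. \<Sum>v\<in>V. (c j * of_real (\<kappa> j v)) *\<^sub>C \<phi> (pair_prod Z (flatten v)))"
    by (rule sum.cong) (simp_all add: exp pair_prod_flatten \<phi>_sum \<phi> scaleC_sum_right scaleR_scaleC scaleC_scaleC)
  also have "\<dots> = (\<Sum>v\<in>V. C v *\<^sub>C \<phi> (pair_prod Z (flatten v)))"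
    by (subst sum.swap) (simp add: C_def scaleC_sum_left)
  \<comment> \<open>On each class of equal multisets \<open>pair_prod\<close> is constant, and the
    coefficients \<open>C\<close> add up to zero there.\<close>
  also have "\<dots> = (\<Sum>M\<in>(\<lambda>v. mset (flatten v)) ` V. \<Sum>v | v \<in> V \<and> mset (flatten v) = M.
      C v *\<^sub>C \<phi> (pair_prod Z (flatten v)))"
    by (rule sum.image_gen [OF V])
  also have "\<dots> = 0"
  proof (rule sum.neutral, rule ballI)
    fix M assume "M \<in> (\<lambda>v. mset (flatten v)) ` V"
    then obtain u where u: "u \<in> V" "mset (flatten u) = M" by blast
    have "(\<Sum>v | v \<in> V \<and> mset (flatten v) = M. C v *\<^sub>C \<phi> (pair_prod Z (flatten v))) =
        (\<Sum>v | v \<in> V \<and> mset (flatten v) = M. C v *\<^sub>C \<phi> (pair_prod Z (flatten u)))"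
    proof (rule sum.cong [OF refl])
      fix v assume "v \<in> {v. v \<in> V \<and> mset (flatten v) = M}"
      then have "pair_prod Z (flatten v) = pair_prod Z (flatten u)"
        using u by (intro pair_prod_mset Z) (simp_all add: length_flatten)
      then show "C v *\<^sub>C \<phi> (pair_prod Z (flatten v)) = C v *\<^sub>C \<phi> (pair_prod Z (flatten u))" by simp
    qed
    then show "(\<Sum>v | v \<in> V \<and> mset (flatten v) = M. C v *\<^sub>C \<phi> (pair_prod Z (flatten v))) = 0"
      by (simp add: C0 flip: scaleC_sum_left)
  qed
  finally show ?thesis .
qed


lemma klein_add_commute: "a + b = b + (a :: klein)"
  by (cases a; cases b; simp)

section \<open>The Fourier transform of a magic unitary\<close>

text \<open>The characters of the Klein four-group, whose elements \<open>00, 01, 10, 11\<close> are the indices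
  \<open>1, 2, 3, 4\<close>.\<close>

definition klein_char :: "klein \<Rightarrow> 4 \<Rightarrow> real" where
  "klein_char i k = (case i of
     K0 \<Rightarrow> vector [1, 1, 1, 1] | K1 \<Rightarrow> vector [1, 1, -1, -1]
   | K2 \<Rightarrow> vector [1, -1, 1, -1] | K3 \<Rightarrow> vector [1, -1, -1, 1]) $ k"

lemma klein_char_simps [simp]:
  "klein_char K0 k = 1" "klein_char i 1 = 1"
  "klein_char K1 2 = 1" "klein_char K1 3 = -1" "klein_char K1 4 = -1"
  "klein_char K2 2 = -1" "klein_char K2 3 = 1" "klein_char K2 4 = -1"
  "klein_char K3 2 = -1" "klein_char K3 3 = -1" "klein_char K3 4 = 1"
proof -
  have "\<forall>k. klein_char K0 k = 1" unfolding forall_4 by (simp add: klein_char_def vector_4_nth)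
  then show "klein_char K0 k = 1" ..
qed (simp_all add: klein_char_def vector_4_nth split: klein.split)

lemma klein_char_mult: "klein_char i k * klein_char j k = klein_char (i + j) k"
proof -
  have "\<forall>k. klein_char i k * klein_char j k = klein_char (i + j) k"
    unfolding forall_4 by (cases i; cases j; simp)
  then show ?thesis ..
qed

definition ft :: "(4 \<Rightarrow> 'a::real_vector) \<Rightarrow> klein \<Rightarrow> 'a"
  where "ft x i = (\<Sum>k\<in>UNIV. klein_char i k *\<^sub>R x k)"

lemma ft_simps:
  "ft x K0 = x 1 + x 2 + x 3 + x 4" "ft x K1 = x 1 + x 2 - x 3 - x 4"
  "ft x K2 = x 1 - x 2 + x 3 - x 4" "ft x K3 = x 1 - x 2 - x 3 + x 4"
  by (simp_all add: ft_def sum_4)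

lemma ft_inverse: "(\<Sum>i\<in>UNIV. klein_char i k *\<^sub>R ft x i) = 4 *\<^sub>R x k"
proof -
  have "\<forall>k. (\<Sum>i\<in>UNIV. klein_char i k *\<^sub>R ft x i) = 4 *\<^sub>R x k"
    unfolding forall_4 by (simp add: sum_klein ft_simps scaleR_4)
  then show ?thesis ..
qed

lemma ft_swap: "ft (\<lambda>k. ft (\<lambda>l. x k l) j) i = ft (\<lambda>l. ft (\<lambda>k. x k l) i) j"
  unfolding ft_def scaleR_sum_right by (subst sum.swap) (simp add: mult.commute)

lemma ft_convolution:
  fixes x y :: "4 \<Rightarrow> 'a::real_algebra"
  shows "(\<Sum>i\<in>UNIV. ft x i * ft y (i + m)) = 4 *\<^sub>R ft (\<lambda>k. x k * y k) m"
  by (cases m) (simp_all add: sum_klein ft_simps scaleR_4 algebra_simps)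

text \<open>Orthogonal idempotents make the transform multiplicative, because the characters
  are.\<close>

lemma ft_orthogonal:
  fixes x :: "4 \<Rightarrow> 'a::real_algebra"
  assumes "\<And>k l. x k * x l = (if k = l then x k else 0)"
  shows "ft x i * ft x j = ft x (i + j)"
proof -
  have "ft x i * ft x j = (\<Sum>k\<in>UNIV. (klein_char i k * klein_char j k) *\<^sub>R x k)"
    by (simp add: ft_def sum_product assms if_distrib mult.commute cong: if_cong)
  then show ?thesis by (simp add: ft_def klein_char_mult)
qed

lemma sum_pairs: "(\<Sum>p\<in>UNIV. f (fst p) (snd p)) = (\<Sum>i\<in>UNIV. \<Sum>j\<in>UNIV. f i j)"
  by (simp add: sum.cartesian_product split_def)

text \<open>With the factor \<open>1/4\<close> this is conjugation by the orthogonal matrix with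
  entries \<open>klein_char i k / 2\<close>.\<close>

definition fourier :: "'a::real_vector ^ 4 ^ 4 \<Rightarrow> klein \<Rightarrow> klein \<Rightarrow> 'a"
  where "fourier N i j = (1/4) *\<^sub>R ft (\<lambda>k. ft (\<lambda>l. N $ k $ l) j) i"

lemma fourier_inverse:
  "N $ k $ l = (\<Sum>p\<in>UNIV. (klein_char (fst p) k * klein_char (snd p) l / 4) *\<^sub>R fourier N (fst p) (snd p))"
proof -
  have "(\<Sum>p\<in>UNIV. (klein_char (fst p) k * klein_char (snd p) l / 4) *\<^sub>R fourier N (fst p) (snd p)) =
      (1/16) *\<^sub>R (\<Sum>i\<in>UNIV. klein_char i k *\<^sub>R (\<Sum>j\<in>UNIV. klein_char j l *\<^sub>R ft (\<lambda>l. ft (\<lambda>k. N $ k $ l) i) j))"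
    unfolding sum_pairs [of "\<lambda>i j. (klein_char i k * klein_char j l / 4) *\<^sub>R fourier N i j"]
    by (simp add: fourier_def scaleR_sum_right mult.commute mult.left_commute ft_swap [of "\<lambda>k l. N $ k $ l"])
  also have "\<dots> = (1/16) *\<^sub>R (\<Sum>i\<in>UNIV. 4 *\<^sub>R (klein_char i k *\<^sub>R ft (\<lambda>k. N $ k $ l) i))"
    unfolding ft_inverse by (simp add: mult.commute)
  also have "\<dots> = N $ k $ l"
    unfolding scaleR_sum_right [symmetric] ft_inverse by simp
  finally show ?thesis ..
qed

text \<open>The relations between the matrix entries of \<open>SO\<^sub>-\<^sub>1(3)\<close>.\<close>

definition twisted :: "(klein \<Rightarrow> klein \<Rightarrow> 'a::{ring, monoid_mult}) \<Rightarrow> bool" where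
  "twisted a \<longleftrightarrow> a K0 K0 = 1 \<and> (\<forall>i. i \<noteq> K0 \<longrightarrow> a i K0 = 0 \<and> a K0 i = 0) \<and>
    (\<forall>i k m. (\<Sum>j\<in>UNIV. a i j * a k (j + m)) = a (i + k) m) \<and>
    (\<forall>j l m. (\<Sum>i\<in>UNIV. a i j * a (i + m) l) = a m (j + l))"

text \<open>Orthogonality inside columns makes the column transforms multiplicative, and convolution
  over the second index then gives the first family of relations; rows give the other. The entries
  at \<open>K0\<close> come from the row and column sums.\<close>

lemma twisted_fourier:
  fixes N :: "'a::cstar_algebra ^ 4 ^ 4"
  assumes N: "magic_unitary N"
  shows "twisted (fourier N)"
  unfolding twisted_def
proof (intro conjI allI impI)
  have rows: "(\<Sum>l\<in>UNIV. N $ k $ l) = 1" and cols: "(\<Sum>k\<in>UNIV. N $ k $ l) = 1" for k l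
    using N by (simp_all add: magic_unitary_def)
  have row: "N $ k $ l * N $ k $ l' = (if l = l' then N $ k $ l else 0)" for k l l'
    using sum_projections_orthogonal [of "\<lambda>l. N $ k $ l" l l'] N by (simp add: magic_unitary_def)
  have col: "N $ k $ l * N $ k' $ l = (if k = k' then N $ k $ l else 0)" for k k' l
    using sum_projections_orthogonal [of "\<lambda>k. N $ k $ l" k k'] N by (simp add: magic_unitary_def)
  have r1: "ft (\<lambda>l. N $ k $ l) K0 = 1" and c1: "ft (\<lambda>k. N $ k $ l) K0 = 1" for k l
    using rows [of k] cols [of l] by (simp_all add: ft_def)
  have one: "ft (\<lambda>_. 1 :: 'a) i = (if i = K0 then 4 *\<^sub>R 1 else 0)" for i
    by (cases i) (simp_all add: ft_simps scaleR_4)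
  have f': "fourier N i j = (1/4) *\<^sub>R ft (\<lambda>l. ft (\<lambda>k. N $ k $ l) i) j" for i j
    by (simp add: fourier_def ft_swap [of "\<lambda>k l. N $ k $ l"])
  show "fourier N K0 K0 = 1" by (simp add: fourier_def r1 one)
  show "fourier N i K0 = 0" "fourier N K0 i = 0" if "i \<noteq> K0" for i
    using that by (simp add: fourier_def r1 one, simp add: f' c1 one)
  show "(\<Sum>j\<in>UNIV. fourier N i j * fourier N k (j + m)) = fourier N (i + k) m" for i k m
    by (simp add: f' ft_convolution ft_orthogonal col flip: scaleR_sum_right)
  show "(\<Sum>i\<in>UNIV. fourier N i j * fourier N (i + m) l) = fourier N m (j + l)" for j l m
    by (simp add: fourier_def ft_convolution ft_orthogonal row flip: scaleR_sum_right)
qed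

text \<open>Distinct entries in one row or column anticommute, and so do their units, while in
  general position both unit factors change sign. Hence the products with the units commute. The
  same signs turn the sums in \<open>cof\<close> into determinants.\<close>

lemma rotation_twisted:
  fixes a :: "klein \<Rightarrow> klein \<Rightarrow> 'a::{real_algebra, monoid_mult}"
  assumes a: "twisted a"
  shows "rotation (\<lambda>i j. qunit i (qunit j (a i j)))" (is "rotation ?X")
proof -
  have a0: "a K0 K0 = 1" "\<And>i. i \<noteq> K0 \<Longrightarrow> a i K0 = 0" "\<And>i. i \<noteq> K0 \<Longrightarrow> a K0 i = 0"
    and row: "\<And>i k m. (\<Sum>j\<in>UNIV. a i j * a k (j + m)) = a (i + k) m"
    and col: "\<And>j l m. (\<Sum>i\<in>UNIV. a i j * a (i + m) l) = a m (j + l)"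
    using a by (auto simp: twisted_def)
  have X: "?X i j * ?X k l = qunit (i + k) (qunit (j + l) ((qsign i k * qsign j l) *\<^sub>R (a i j * a k l)))" for i j k l
    by (simp add: qunit_mult qunit_linear)
  have anticol: "a p j * a q j = - (a q j * a p j)" if "p \<noteq> K0" "q \<noteq> K0" "p \<noteq> q" for p q j
    using col [of j "p + q" j] that
    by (cases "j = K0"; cases p; cases q; simp add: sum_klein a0 eq_neg_iff_add_eq_0 add.commute)
  have antirow: "a j p * a j q = - (a j q * a j p)" if "p \<noteq> K0" "q \<noteq> K0" "p \<noteq> q" for p q j
    using row [of j j "p + q"] that
    by (cases "j = K0"; cases p; cases q; simp add: sum_klein a0 eq_neg_iff_add_eq_0 add.commute)
  have cof: "a p j * a q l + a q j * a p l = a (p + q) (j + l)"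
    if "p \<noteq> K0" "q \<noteq> K0" "p \<noteq> q" "j \<noteq> K0" "l \<noteq> K0" for p q j l
    using col [of j "p + q" l] that
    by (cases p; cases q; simp add: sum_klein a0 add.commute)
  have cof': "a p j * a q l + a p l * a q j = a (p + q) (j + l)"
    if "p \<noteq> K0" "q \<noteq> K0" "j \<noteq> l" "j \<noteq> K0" "l \<noteq> K0" for p q j l
    using row [of p q "j + l"] that
    by (cases j; cases l; simp add: sum_klein a0 add.commute)
  \<comment> \<open>The expansions \<open>cof\<close> and \<open>cof'\<close> share their first
    summand and their value, so the second summands agree.\<close>
  have comm: "a q j * a p l = a p l * a q j"
    if "p \<noteq> K0" "q \<noteq> K0" "p \<noteq> q" "j \<noteq> K0" "l \<noteq> K0" "j \<noteq> l" for p q j l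
    using cof [of p q j l] cof' [of p q j l] that by (metis add_left_cancel)
  show ?thesis
    unfolding rotation_def
  proof (intro conjI allI impI)
    show "?X i j * ?X k l = ?X k l * ?X i j" for i j k l
    proof (cases "i = K0 \<or> j = K0 \<or> k = K0 \<or> l = K0")
      case True
      then show ?thesis
        unfolding X using a0
        by (cases i; cases j; cases k; cases l; simp)
    next
      case False
      then have "(qsign i k * qsign j l) *\<^sub>R (a i j * a k l) = (qsign k i * qsign l j) *\<^sub>R (a k l * a i j)"
        using comm [of k i j l] anticol [of i k j] antirow [of j l i]
        by (cases i; cases k; simp; cases j; cases l; simp)
      then show ?thesis unfolding X klein_add_commute [of k i] klein_add_commute [of l j] by simp
    qed
    show "?X i K1 * ?X k K1 + ?X i K2 * ?X k K2 + ?X i K3 * ?X k K3 = (if i = k then 1 else 0)"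
      if "i \<noteq> K0" "k \<noteq> K0" for i k
    proof -
      have "?X i K1 * ?X k K1 + ?X i K2 * ?X k K2 + ?X i K3 * ?X k K3 =
          qunit (i + k) (qunit K0 (- qsign i k *\<^sub>R (\<Sum>j\<in>UNIV. a i j * a k (j + K0))))"
        unfolding X using that by (simp add: sum_klein a0 qunit_linear algebra_simps)
      also have "\<dots> = (if i = k then 1 else 0)"
        unfolding row using that by (cases i; cases k; simp add: a0 qunit_linear)
      finally show ?thesis .
    qed
    show "?X K1 i * ?X K1 k + ?X K2 i * ?X K2 k + ?X K3 i * ?X K3 k = (if i = k then 1 else 0)"
      if "i \<noteq> K0" "k \<noteq> K0" for i k
    proof -
      have "?X K1 i * ?X K1 k + ?X K2 i * ?X K2 k + ?X K3 i * ?X K3 k =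
          qunit K0 (qunit (i + k) (- qsign i k *\<^sub>R (\<Sum>j\<in>UNIV. a j i * a (j + K0) k)))"
        unfolding X using that by (simp add: sum_klein a0 qunit_linear algebra_simps)
      also have "\<dots> = (if i = k then 1 else 0)"
        unfolding col using that by (cases i; cases k; simp add: a0 qunit_linear)
      finally show ?thesis .
    qed
    show "?X i j * ?X (kcyc i) (kcyc j) - ?X (kcyc i) j * ?X i (kcyc j) = ?X (kcyc (kcyc i)) (kcyc (kcyc j))"
      if "i \<noteq> K0" "j \<noteq> K0" for i j
      unfolding X using that cof [of i "kcyc i" j "kcyc j"]
      by (cases i; cases j; simp flip: qunit_linear)
  qed
qed

text \<open>This is right multiplication by a quarter turn about the third axis, which undoes the
  exchange of columns in the model and keeps determinant one.\<close>

lemma rotation_permute_columns: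
  assumes "rotation X"
  shows "rotation (\<lambda>i j. case j of K0 \<Rightarrow> X i K0 | K1 \<Rightarrow> X i K2 | K2 \<Rightarrow> - X i K1 | K3 \<Rightarrow> X i K3)"
    (is "rotation ?r")
proof -
  have comm: "X i j * X k l = X k l * X i j" for i j k l
    using assms by (simp add: rotation_def)
  have row: "X i K1 * X k K1 + (X i K2 * X k K2 + X i K3 * X k K3) = (if i = k then 1 else 0)"
    and col: "X K1 i * X K1 k + (X K2 i * X K2 k + X K3 i * X K3 k) = (if i = k then 1 else 0)"
    if "i \<noteq> K0" "k \<noteq> K0" for i k
    using assms that by (simp_all add: rotation_def add.assoc)
  have col': "X K1 i * X K1 k = (if i = k then 1 else 0) - (X K2 i * X K2 k + X K3 i * X K3 k)"
    if "i \<noteq> K0" "k \<noteq> K0" for i k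
    using col [OF that] by (simp add: eq_diff_eq)
  have cof: "X i j * X (kcyc i) (kcyc j) - X (kcyc i) j * X i (kcyc j) = X (kcyc (kcyc i)) (kcyc (kcyc j))"
    if "i \<noteq> K0" "j \<noteq> K0" for i j
    using assms that unfolding rotation_def by blast
  show ?thesis
    unfolding rotation_def
  proof (intro conjI allI impI)
    show "?r i j * ?r k l = ?r k l * ?r i j" for i j k l
      using comm by (simp split: klein.split)
    show "?r i K1 * ?r k K1 + ?r i K2 * ?r k K2 + ?r i K3 * ?r k K3 = (if i = k then 1 else 0)"
      if "i \<noteq> K0" "k \<noteq> K0" for i k
      using row [OF that] by (simp add: add_ac)
    show "?r K1 i * ?r K1 k + ?r K2 i * ?r K2 k + ?r K3 i * ?r K3 k = (if i = k then 1 else 0)"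
      if "i \<noteq> K0" "k \<noteq> K0" for i k
      using that by (cases i; cases k; simp add: col')
    show "?r i j * ?r (kcyc i) (kcyc j) - ?r (kcyc i) j * ?r i (kcyc j) = ?r (kcyc (kcyc i)) (kcyc (kcyc j))"
      if "i \<noteq> K0" "j \<noteq> K0" for i j
      using that cof [of i K1] cof [of i K2] cof [of i K3]
      by (cases j; simp add: comm algebra_simps)
  qed
qed


section \<open>Words in the entries of a twisted rotation matrix\<close>

text \<open>The coefficients of the rotation matrix of a quaternion as a quadratic form, with two columns
  exchanged as in the model.\<close>

definition rot_coeff :: "klein \<Rightarrow> klein \<Rightarrow> klein \<times> klein \<Rightarrow> real" where
  "rot_coeff i j p = (if i = j then (if fst p = snd p then (if fst p \<in> {K0, i} then 1 else -1) else 0)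
    else (if p = (i, j) then 2 else 0) - (if p = (K0, i + j) then 2 * qsign i j else 0))"

text \<open>The letter \<open>(K0, K0)\<close> receives the sum of squares instead of the constant
  \<open>1\<close>, so that every letter is a quadratic form and words of equal length are
  homogeneous of equal degree.\<close>

definition col_coeff :: "klein \<times> klein \<Rightarrow> klein \<times> klein \<Rightarrow> real" where
  "col_coeff l p = (if fst l = K0 then (if snd l = K0 \<and> fst p = snd p then 1 else 0)
    else (case snd l of K0 \<Rightarrow> 0 | K1 \<Rightarrow> - rot_coeff (fst l) K2 p | K2 \<Rightarrow> rot_coeff (fst l) K1 p
      | K3 \<Rightarrow> rot_coeff (fst l) K3 p))"

lemma sum_klein_pairs: "(\<Sum>p\<in>UNIV. f p) = (\<Sum>a\<in>UNIV. \<Sum>b\<in>UNIV. f (a :: klein, b :: klein))"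
  by (simp add: sum.cartesian_product)

text \<open>This inverts the affine formulas of \<open>qsym\<close>. Its trace is \<open>4\<close>,
  so even the constant entry is a linear combination of entries of \<open>qsym\<close>.\<close>

lemma col_coeff_expand:
  fixes X :: "klein \<Rightarrow> klein \<Rightarrow> 'a::{real_algebra, monoid_mult}"
  assumes "X K0 K0 = 1" "\<And>i. i \<noteq> K0 \<Longrightarrow> X i K0 = 0" "\<And>i. i \<noteq> K0 \<Longrightarrow> X K0 i = 0"
  defines "r \<equiv> \<lambda>i j. case j of K0 \<Rightarrow> X i K0 | K1 \<Rightarrow> X i K2 | K2 \<Rightarrow> - X i K1 | K3 \<Rightarrow> X i K3"
  shows "(\<Sum>p\<in>UNIV. col_coeff l p *\<^sub>R ((1/4) *\<^sub>R qsym r (fst p) (snd p))) = X (fst l) (snd l)"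
proof -
  have "(\<Sum>p\<in>UNIV. col_coeff (i, j) p *\<^sub>R qsym r (fst p) (snd p)) = 4 *\<^sub>R X i j" for i j
    unfolding sum_klein_pairs
    by (cases i; cases j; simp add: sum_klein col_coeff_def rot_coeff_def qsym_def r_def assms(1-3)
        scaleR_4 scaleR_2 algebra_simps)
  note eq = this [of "fst l" "snd l"]
  have "(\<Sum>p\<in>UNIV. col_coeff l p *\<^sub>R ((1/4) *\<^sub>R qsym r (fst p) (snd p))) =
      (1/4) *\<^sub>R (\<Sum>p\<in>UNIV. col_coeff l p *\<^sub>R qsym r (fst p) (snd p))"
    by (simp add: scaleR_sum_right)
  then show ?thesis using eq by simp
qed

primrec word_deg :: "klein list \<Rightarrow> klein" where
  "word_deg [] = K0" | "word_deg (i # w) = i + word_deg w"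

text \<open>The product of the units along \<open>w\<close> is this sign times the unit of index
  \<open>word_deg w\<close>.\<close>

primrec word_sign :: "klein list \<Rightarrow> real" where
  "word_sign [] = 1" | "word_sign (i # w) = qsign i (word_deg w) * word_sign w"

lemma word_sign_sq: "word_sign w * word_sign w = 1"
proof (induction w)
  case (Cons i w)
  have "word_sign (i # w) * word_sign (i # w) =
      (qsign i (word_deg w) * qsign i (word_deg w)) * (word_sign w * word_sign w)"
    by (simp add: mult_ac)
  then show ?case by (simp only: Cons qsign_sq mult_1)
qed simp

definition pair_deg :: "(klein \<times> klein) list \<Rightarrow> klein \<times> klein"
  where "pair_deg w = (word_deg (map fst w), word_deg (map snd w))"

definition pair_sign :: "(klein \<times> klein) list \<Rightarrow> real"
  where "pair_sign w = word_sign (map fst w) * word_sign (map snd w)"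

lemma pair_sign_sq: "pair_sign w * pair_sign w = 1"
  using word_sign_sq [of "map fst w"] word_sign_sq [of "map snd w"]
  by (metis (no_types, lifting) mult.assoc mult.left_commute mult_1 pair_sign_def)

lemma prod_list_qunit:
  "prod_list (map (\<lambda>l. qunit (fst l) (qunit (snd l) (a l))) w) =
    qunit (fst (pair_deg w)) (qunit (snd (pair_deg w)) (pair_sign w *\<^sub>R prod_list (map a w)))"
proof (induction w)
  case (Cons l w)
  then show ?case
    by (simp add: pair_deg_def pair_sign_def qunit_mult qunit_linear mult_ac)
qed (simp add: pair_deg_def pair_sign_def qunit_linear)

text \<open>Up to sign, a word in \<open>a\<close> of degree \<open>d\<close> is the coefficient at
  \<open>d\<close> of the same word in the commuting matrix \<open>X\<close>, to which the rank-one
  argument applies.\<close>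

lemma twisted_words_vanish:
  fixes a :: "klein \<Rightarrow> klein \<Rightarrow> 'a::cstar_algebra"
  assumes a: "twisted a" and J: "finite J" "\<And>j. j \<in> J \<Longrightarrow> length (w j) = n"
    and van: "\<And>(q :: klein \<Rightarrow> real) d. (\<Sum>j | j \<in> J \<and> pair_deg (w j) = d. c j * of_real (pair_sign (w j) *
      prod_list (map (\<lambda>l. \<Sum>p\<in>UNIV. col_coeff l p *\<^sub>R (q (fst p) * q (snd p))) (w j)))) = 0"
  shows "(\<Sum>j\<in>J. c j *\<^sub>C prod_list (map (\<lambda>l. a (fst l) (snd l)) (w j))) = 0"
proof -
  define X where "X i j = qunit i (qunit j (a i j))" for i j
  define r where "r i j = (case j of K0 \<Rightarrow> X i K0 | K1 \<Rightarrow> X i K2 | K2 \<Rightarrow> - X i K1 | K3 \<Rightarrow> X i K3)" for i j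
  have r: "rotation r"
    unfolding r_def [abs_def] X_def by (intro rotation_permute_columns rotation_twisted a)
  define Z where "Z b c = (1/4) *\<^sub>R qsym r b c" for b c
  have Z: "Z b c = Z c b" "Z b c * Z d e = Z b d * Z c e" for b c d e
    using qsym_commute [of r b c] qsym_minor [OF r, of b c d e] by (simp_all add: Z_def)
  have X: "(\<Sum>p\<in>UNIV. col_coeff l p *\<^sub>R Z (fst p) (snd p)) = X (fst l) (snd l)" for l
    unfolding Z_def r_def [abs_def]
    by (rule col_coeff_expand) (use a in \<open>simp_all add: X_def twisted_def qunit_linear\<close>)
  have "(\<Sum>j | j \<in> J \<and> pair_deg (w j) = d. c j *\<^sub>C prod_list (map (\<lambda>l. a (fst l) (snd l)) (w j))) = 0" for d
  proof -
    let ?J = "{j. j \<in> J \<and> pair_deg (w j) = d}"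
    \<comment> \<open>The map \<open>\<phi>\<close> extracts the coefficient at \<open>d\<close>:
      complex scalars act on the coefficients, while \<open>quat\<close> carries only real ones. The
      sign put in here cancels the one from \<open>prod_list_qunit\<close>.\<close>
    have sum: "(\<Sum>j\<in>?J. (c j * of_real (pair_sign (w j))) *\<^sub>C qcoeff (qcoeff
        (prod_list (map (\<lambda>l. \<Sum>p\<in>UNIV. col_coeff l p *\<^sub>R Z (fst p) (snd p)) (w j))) (fst d)) (snd d)) = 0"
      by (rule rank_one_words_vanish [where n = n])
        (use Z J van [of _ d] in \<open>simp_all add: qcoeff_simps mult.assoc\<close>)
    have "(c j * of_real (pair_sign (w j))) *\<^sub>C qcoeff (qcoeff
        (prod_list (map (\<lambda>l. \<Sum>p\<in>UNIV. col_coeff l p *\<^sub>R Z (fst p) (snd p)) (w j))) (fst d)) (snd d) =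
        c j *\<^sub>C prod_list (map (\<lambda>l. a (fst l) (snd l)) (w j))" if "j \<in> ?J" for j
    proof -
      have "pair_deg (w j) = d" using that by simp
      then have "qcoeff (qcoeff (prod_list (map (\<lambda>l. X (fst l) (snd l)) (w j))) (fst d)) (snd d) =
          pair_sign (w j) *\<^sub>R prod_list (map (\<lambda>l. a (fst l) (snd l)) (w j))"
        unfolding X_def prod_list_qunit [of "\<lambda>l. a (fst l) (snd l)"] by (simp add: qcoeff_qunit)
      moreover have "complex_of_real (pair_sign (w j)) * complex_of_real (pair_sign (w j)) = 1"
        by (metis of_real_1 of_real_mult pair_sign_sq)
      ultimately show ?thesis
        unfolding X by (simp add: scaleR_scaleC scaleC_scaleC mult.assoc)
    qed
    from trans [OF sum.cong [OF refl this [symmetric]] sum] show ?thesis .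
  qed
  moreover have "(\<Sum>j\<in>J. c j *\<^sub>C prod_list (map (\<lambda>l. a (fst l) (snd l)) (w j))) =
      (\<Sum>d\<in>(\<lambda>j. pair_deg (w j)) ` J. \<Sum>j | j \<in> J \<and> pair_deg (w j) = d.
        c j *\<^sub>C prod_list (map (\<lambda>l. a (fst l) (snd l)) (w j)))"
    by (rule sum.image_gen [OF J(1)])
  ultimately show ?thesis by simp
qed

text \<open>By homogeneity only unit quaternions need to be tested.\<close>

lemma twisted_words_vanish_sphere:
  fixes a :: "klein \<Rightarrow> klein \<Rightarrow> 'a::cstar_algebra"
  assumes a: "twisted a" and J: "finite J" "\<And>j. j \<in> J \<Longrightarrow> length (w j) = n"
    and van: "\<And>(q :: klein \<Rightarrow> real) d. (\<Sum>i\<in>UNIV. (q i)\<^sup>2) = 1 \<Longrightarrow>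
      (\<Sum>j | j \<in> J \<and> pair_deg (w j) = d. c j * of_real (pair_sign (w j) *
      prod_list (map (\<lambda>l. \<Sum>p\<in>UNIV. col_coeff l p *\<^sub>R (q (fst p) * q (snd p))) (w j)))) = 0"
  shows "(\<Sum>j\<in>J. c j *\<^sub>C prod_list (map (\<lambda>l. a (fst l) (snd l)) (w j))) = 0"
  using a J
proof (rule twisted_words_vanish)
  fix q :: "klein \<Rightarrow> real" and d
  let ?x = "\<lambda>q l. \<Sum>p\<in>UNIV. col_coeff l p *\<^sub>R (q (fst p) * q (snd p) :: real)"
  let ?J = "{j. j \<in> J \<and> pair_deg (w j) = d}"
  define R where "R = sqrt (\<Sum>i\<in>UNIV. (q i)\<^sup>2)"
  have R2: "R\<^sup>2 = (\<Sum>i\<in>UNIV. (q i)\<^sup>2)" by (simp add: R_def sum_nonneg)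
  obtain q' where q': "(\<Sum>i\<in>UNIV. (q' i)\<^sup>2) = 1" "\<And>i. q i = R * q' i"
  proof (cases "R = 0")
    case True
    then have "q i = 0" for i using R2 by (simp add: sum_nonneg_eq_0_iff)
    \<comment> \<open>For \<open>q = 0\<close> any unit vector serves.\<close>
    then show thesis using True
      by (intro that [of "\<lambda>i. if i = K0 then 1 else 0"]) (auto simp: sum_klein)
  next
    case False
    then show thesis
      by (intro that [of "\<lambda>i. q i / R"]) (simp_all add: power_divide R2 [symmetric] flip: sum_divide_distrib)
  qed
  \<comment> \<open>All words have length \<open>n\<close>, so this factor leaves the sum as one
    common power.\<close>
  have "?x q l = R\<^sup>2 * ?x q' l" for l
    by (simp add: q'(2) sum_distrib_left power2_eq_square mult_ac)
  then have "prod_list (map (?x q) u) = (R\<^sup>2) ^ length u * prod_list (map (?x q') u)" for u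
    by (induction u) (simp_all add: mult_ac)
  then have "(\<Sum>j\<in>?J. c j * of_real (pair_sign (w j) * prod_list (map (?x q) (w j)))) =
      of_real ((R\<^sup>2) ^ n) * (\<Sum>j\<in>?J. c j * of_real (pair_sign (w j) * prod_list (map (?x q') (w j))))"
    unfolding sum_distrib_left by (intro sum.cong) (simp_all add: J mult_ac)
  then show "(\<Sum>j\<in>?J. c j * of_real (pair_sign (w j) * prod_list (map (?x q) (w j)))) = 0"
    using van [OF q'(1)] by simp
qed


section \<open>Representations of the model\<close>

text \<open>\<open>spin i j t f\<close> is left multiplication by \<open>e\<^sub>i \<otimes> e\<^sub>j\<close> on the tensor square of the quaternions,
  tensored with the \<open>2 \<times> 2\<close> matrix that is the diagonal matrix \<open>(1, \<plusminus>1)\<close> times a power of the flip.\<close>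

definition spin :: "klein \<Rightarrow> klein \<Rightarrow> bool \<Rightarrow> bool \<Rightarrow> (klein \<times> klein \<times> bool) op" where
  "spin i j t f = perm_op (\<lambda>(g, h, b). qsign i (i + g) * qsign j (j + h) * (if t \<and> \<not> b then -1 else 1))
    (\<lambda>(g, h, b). (i + g, j + h, b \<noteq> f))"

text \<open>Associativity of the units with indices \<open>i\<close>, \<open>k\<close> and
  \<open>i + k + g\<close>.\<close>

lemma qsign_cocycle: "qsign i (i + g) * qsign k (k + (i + g)) = qsign i k * qsign (i + k) (i + k + g)"
  by (cases i; cases k; cases g; simp)

lemma klein_add_assoc: "a + b + c = a + (b + c :: klein)"
  by (cases a; cases b; cases c; simp)

lemma klein_add_left_commute: "a + (b + c) = b + (a + c :: klein)"
  by (cases a; cases b; cases c; simp)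

lemma perm_op_scaleR: "r *\<^sub>R perm_op s \<pi> = perm_op (\<lambda>i. r * s i) \<pi>"
  by (rule op_eqI) (simp add: apply_op_simps apply_perm_op vec_eq_iff)

lemma spin_mult:
  "spin i j t f * spin k l t' f' =
    (qsign i k * qsign j l * (if t' \<and> f then -1 else 1)) *\<^sub>R spin (i + k) (j + l) (t \<noteq> t') (f \<noteq> f')"
  unfolding spin_def perm_op_mult perm_op_scaleR
proof (rule arg_cong2 [where f = perm_op]; rule ext)
  fix x :: "klein \<times> klein \<times> bool"
  obtain g h b where x: "x = (g, h, b)" by (cases x)
  have "qsign i (i + g) * qsign j (j + h) * (if t \<and> \<not> b then -1 else 1) *
      (qsign k (k + (i + g)) * qsign l (l + (j + h)) * (if t' \<and> \<not> (b \<noteq> f) then -1 else 1)) =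
      (qsign i (i + g) * qsign k (k + (i + g))) * (qsign j (j + h) * qsign l (l + (j + h))) *
      ((if t' \<and> f then -1 else 1) * (if (t \<noteq> t') \<and> \<not> b then -1 else 1))"
    by auto
  then show "(case x of (g, h, b) \<Rightarrow> qsign i (i + g) * qsign j (j + h) * (if t \<and> \<not> b then -1 else 1)) *
      (case (case x of (g, h, b) \<Rightarrow> (i + g, j + h, b \<noteq> f)) of
        (g, h, b) \<Rightarrow> qsign k (k + g) * qsign l (l + h) * (if t' \<and> \<not> b then -1 else 1)) =
      qsign i k * qsign j l * (if t' \<and> f then -1 else 1) *
      (case x of (g, h, b) \<Rightarrow> qsign (i + k) (i + k + g) * qsign (j + l) (j + l + h) *
        (if (t \<noteq> t') \<and> \<not> b then -1 else 1))"
    unfolding qsign_cocycle by (simp add: x)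
  show "(case (case x of (g, h, b) \<Rightarrow> (i + g, j + h, b \<noteq> f)) of (g, h, b) \<Rightarrow> (k + g, l + h, b \<noteq> f')) =
      (case x of (g, h, b) \<Rightarrow> (i + k + g, j + l + h, b \<noteq> (f \<noteq> f')))"
    by (auto simp: x klein_add_assoc klein_add_left_commute)
qed

lemma spin_one: "spin K0 K0 False False = 1"
  unfolding perm_op_one [symmetric] spin_def by (rule arg_cong2 [where f = perm_op]; rule ext) auto

text \<open>By \<open>spin_mult\<close> the assumption says that the operator squares to
  \<open>1\<close>; an orthogonal matrix with this property is symmetric.\<close>

lemma star_spin:
  assumes "qsign i i * qsign j j * (if t \<and> f then -1 else 1) = 1"
  shows "star (spin i j t f) = spin i j t f"
  unfolding spin_def
proof (rule star_perm_op)
  fix x :: "klein \<times> klein \<times> bool"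
  obtain g h b where x: "x = (g, h, b)" by (cases x)
  have s: "qsign k g = qsign k k * qsign k (k + g)" for k g by (cases k; cases g; simp)
  have "qsign i g * qsign j h * (if t \<and> \<not> (b \<noteq> f) then -1 else 1) =
      (qsign i i * qsign j j * (if t \<and> f then -1 else 1)) *
      (qsign i (i + g) * qsign j (j + h) * (if t \<and> \<not> b then -1 else 1))"
    unfolding s [of i g] s [of j h] by auto
  then show "(case (case x of (g, h, b) \<Rightarrow> (i + g, j + h, b \<noteq> f)) of
        (g, h, b) \<Rightarrow> qsign i (i + g) * qsign j (j + h) * (if t \<and> \<not> b then -1 else 1)) =
      (case x of (g, h, b) \<Rightarrow> qsign i (i + g) * qsign j (j + h) * (if t \<and> \<not> b then -1 else 1))"
    unfolding assms by (simp add: x)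
qed auto

lemma apply_spin_axis:
  "apply_op (spin i j t f) (axis (g, h, b) 1) =
    (qsign i g * qsign j h * (if t \<and> b = f then -1 else 1)) *\<^sub>R axis (i + g, j + h, b \<noteq> f) 1"
  by (auto simp: spin_def apply_perm_op vec_eq_iff axis_def klein_add_eq_iff)

text \<open>The mixed terms cancel, so \<open>c *\<^sub>R x + s *\<^sub>R y\<close> squares to
  \<open>1\<close>.\<close>

lemma anticommuting_projection:
  fixes x y :: "'a::cstar_algebra"
  assumes xy: "x * x = 1" "y * y = 1" "x * y = - (y * x)" "star x = x" "star y = y"
    and cs: "c\<^sup>2 + s\<^sup>2 = 1"
  defines "p \<equiv> (1/2) *\<^sub>R (1 + (c *\<^sub>R x + s *\<^sub>R y))"
  shows "p * p = p" "star p = p"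
proof -
  let ?z = "c *\<^sub>R x + s *\<^sub>R y"
  have "?z * ?z = (c\<^sup>2 + s\<^sup>2) *\<^sub>R 1"
    by (simp add: algebra_simps xy power2_eq_square)
  then have "?z * ?z = 1" by (simp add: cs)
  then have "(1 + ?z) * (1 + ?z) = 2 *\<^sub>R (1 + ?z)"
    by (simp only: distrib_left distrib_right mult_1_left mult_1_right scaleR_2) (simp add: add_ac)
  then show "p * p = p" by (simp add: p_def)
  show "star p = p" by (simp add: p_def star_scaleR star_add xy)
qed

lemma ft_sum: "ft (\<lambda>k. \<Sum>m\<in>I. x k m) i = (\<Sum>m\<in>I. ft (\<lambda>k. x k m) i)"
  unfolding ft_def scaleR_sum_right by (rule sum.swap)

lemma fourier_mult:
  fixes A B :: "'a::real_algebra ^ 4 ^ 4"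
  shows "fourier (\<chi> i j. \<Sum>k\<in>UNIV. A $ i $ k * B $ k $ j) i j = (\<Sum>k\<in>UNIV. fourier A i k * fourier B k j)"
proof -
  have l: "ft (\<lambda>k. c * x k) i = c * ft x i" "ft (\<lambda>k. x k * c) i = ft x i * c" for c i and x :: "4 \<Rightarrow> 'a"
    by (simp_all add: ft_def sum_distrib_left sum_distrib_right)
  \<comment> \<open>The summand \<open>K0\<close> exposes the case \<open>m = K0\<close> of
    \<open>ft_convolution\<close>, which is Parseval's identity.\<close>
  have "(\<Sum>k\<in>UNIV. fourier A i k * fourier B k j) = (1/16) *\<^sub>R
      (\<Sum>k\<in>UNIV. ft (\<lambda>l. ft (\<lambda>k. A $ k $ l) i) k * ft (\<lambda>l. ft (\<lambda>m. B $ l $ m) j) (k + K0))"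
    by (simp add: fourier_def scaleR_sum_right ft_swap [of "\<lambda>k l. A $ k $ l"])
  also have "\<dots> = (1/4) *\<^sub>R (\<Sum>l\<in>UNIV. ft (\<lambda>k. A $ k $ l) i * ft (\<lambda>m. B $ l $ m) j)"
    unfolding ft_convolution by (simp add: ft_def)
  also have "\<dots> = fourier (\<chi> i j. \<Sum>k\<in>UNIV. A $ i $ k * B $ k $ j) i j"
    by (simp add: fourier_def ft_sum l)
  finally show ?thesis ..
qed

text \<open>For projections \<open>p\<close> and \<open>q\<close>, the elements
  \<open>C = p + q - 1\<close> and \<open>S = p - q\<close> anticommute and their squares add up to
  \<open>1\<close>: a twisted cosine and sine.\<close>

definition rmat :: "'a \<Rightarrow> 'a \<Rightarrow> klein \<Rightarrow> klein \<Rightarrow> 'a::cstar_algebra" where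
  "rmat C S i j = (case i of
     K0 \<Rightarrow> (case j of K0 \<Rightarrow> 1 | K1 \<Rightarrow> 0 | K2 \<Rightarrow> 0 | K3 \<Rightarrow> 0)
   | K1 \<Rightarrow> (case j of K0 \<Rightarrow> 0 | K1 \<Rightarrow> 0 | K2 \<Rightarrow> 1 | K3 \<Rightarrow> 0)
   | K2 \<Rightarrow> (case j of K0 \<Rightarrow> 0 | K1 \<Rightarrow> C | K2 \<Rightarrow> 0 | K3 \<Rightarrow> S)
   | K3 \<Rightarrow> (case j of K0 \<Rightarrow> 0 | K1 \<Rightarrow> S | K2 \<Rightarrow> 0 | K3 \<Rightarrow> C))"

lemma fourier_model_R:
  fixes h :: "two_proj \<Rightarrow> 'b::cstar_algebra"
  assumes h: "star_hom h"
  shows "fourier (\<chi> i j. h (model_R $ i $ j)) i j =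
    rmat (h proj_p + h proj_q - 1) (h proj_p - h proj_q) i j"
proof -
  have "ft (\<lambda>k. ft (\<lambda>l. h (model_R $ k $ l)) j) i =
      4 *\<^sub>R rmat (h proj_p + h proj_q - 1) (h proj_p - h proj_q) i j"
    by (cases i; cases j; simp add: rmat_def ft_simps model_R_nth star_homD [OF h] scaleR_4 algebra_simps)
  then show ?thesis by (simp add: fourier_def)
qed

text \<open>The product of the rotations by three angles with the given cosines and sines about the axes \<open>1\<close>,
  \<open>2\<close> and \<open>1\<close>, up to the exchange of the first two columns and a sign.\<close>

definition euler :: "real \<times> real \<Rightarrow> real \<times> real \<Rightarrow> real \<times> real \<Rightarrow> klein \<Rightarrow> klein \<Rightarrow> real" where
  "euler u v w i j = (case u of (c\<^sub>1, s\<^sub>1) \<Rightarrow> case v of (c\<^sub>2, s\<^sub>2) \<Rightarrow> case w of (c\<^sub>3, s\<^sub>3) \<Rightarrow> (case i of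
     K0 \<Rightarrow> (case j of K0 \<Rightarrow> 1 | K1 \<Rightarrow> 0 | K2 \<Rightarrow> 0 | K3 \<Rightarrow> 0)
   | K1 \<Rightarrow> (case j of K0 \<Rightarrow> 0 | K1 \<Rightarrow> - s\<^sub>2 * s\<^sub>3 | K2 \<Rightarrow> c\<^sub>2 | K3 \<Rightarrow> s\<^sub>2 * c\<^sub>3)
   | K2 \<Rightarrow> (case j of K0 \<Rightarrow> 0 | K1 \<Rightarrow> s\<^sub>1 * c\<^sub>2 * s\<^sub>3 - c\<^sub>1 * c\<^sub>3 | K2 \<Rightarrow> s\<^sub>1 * s\<^sub>2 | K3 \<Rightarrow> - c\<^sub>1 * s\<^sub>3 - s\<^sub>1 * c\<^sub>2 * c\<^sub>3)
   | K3 \<Rightarrow> (case j of K0 \<Rightarrow> 0 | K1 \<Rightarrow> - s\<^sub>1 * c\<^sub>3 - c\<^sub>1 * c\<^sub>2 * s\<^sub>3 | K2 \<Rightarrow> - c\<^sub>1 * s\<^sub>2 | K3 \<Rightarrow> c\<^sub>1 * c\<^sub>2 * c\<^sub>3 - s\<^sub>1 * s\<^sub>3)))"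

definition spin_rmat :: "klein \<Rightarrow> klein \<Rightarrow> bool \<Rightarrow> bool \<Rightarrow> klein \<Rightarrow> klein \<Rightarrow> bool \<Rightarrow> bool \<Rightarrow> real \<times> real \<Rightarrow>
    klein \<Rightarrow> klein \<Rightarrow> (klein \<times> klein \<times> bool) op" where
  "spin_rmat i j t f i' j' t' f' u = rmat (fst u *\<^sub>R spin i j t f) (snd u *\<^sub>R spin i' j' t' f')"

lemma apply_op_minus_right: "apply_op f (- v) = - apply_op f v"
  by transfer (rule blinfun.minus_right)

text \<open>The three pairs of anticommuting symmetries commute with each other and generate \<open>M\<^sub>2 \<otimes> M\<^sub>2 \<otimes> M\<^sub>2\<close>.  They
  are chosen such that the entries of the model preserve the subspace with last coordinate
  \<^const>\<open>True\<close> and act there as multiples of \<open>e\<^sub>i \<otimes> e\<^sub>j\<close>.\<close>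

lemma euler_action:
  "apply_op (\<Sum>k\<in>UNIV. spin_rmat K2 K0 True True K3 K0 True True u i k *
      (\<Sum>l\<in>UNIV. spin_rmat K1 K2 True False K1 K2 False True v k l *
        spin_rmat K0 K1 True True K0 K3 True True w l j)) (axis (g, h, True) 1) =
    (euler u v w i j * (qsign i g * qsign j h)) *\<^sub>R axis (i + g, j + h, True) 1"
  unfolding spin_rmat_def
  by (cases u; cases v; cases w; cases i; cases j;
    simp add: euler_def rmat_def sum_klein apply_op_simps apply_op_minus_right apply_spin_axis;
    cases g; cases h; simp add: algebra_simps)

lemma ex_euler:
  fixes q :: "klein \<Rightarrow> real"
  assumes q: "(\<Sum>i\<in>UNIV. (q i)\<^sup>2) = 1"
  obtains u v w where "(fst u)\<^sup>2 + (snd u)\<^sup>2 = 1" "(fst v)\<^sup>2 + (snd v)\<^sup>2 = 1" "(fst w)\<^sup>2 + (snd w)\<^sup>2 = 1"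
    "\<And>l. (\<Sum>p\<in>UNIV. col_coeff l p *\<^sub>R (q (fst p) * q (snd p))) = euler u v w (fst l) (snd l)"
proof -
  have polar: "\<exists>r c s. x = r * c \<and> y = r * s \<and> c\<^sup>2 + s\<^sup>2 = 1" for x y :: real
  proof (cases "x = 0 \<and> y = 0")
    case True
    then have "x = 0 * 1 \<and> y = 0 * 0 \<and> (1 :: real)\<^sup>2 + 0\<^sup>2 = 1" by simp
    then show ?thesis by blast
  next
    case False
    then show ?thesis
      by - (rule exI [of _ "sqrt (x\<^sup>2 + y\<^sup>2)"], rule exI [of _ "x / sqrt (x\<^sup>2 + y\<^sup>2)"],
        rule exI [of _ "y / sqrt (x\<^sup>2 + y\<^sup>2)"],
        simp add: power_divide flip: add_divide_distrib)
  qed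
  obtain r c s where 1: "q K0 = r * c" "q K1 = r * s" "c\<^sup>2 + s\<^sup>2 = 1" using polar by blast
  obtain r' c' s' where 2: "q K2 = r' * c'" "- q K3 = r' * s'" "c'\<^sup>2 + s'\<^sup>2 = 1" using polar by blast
  have q3: "q K3 = - (r' * s')" using 2 by simp
  have "r\<^sup>2 * (c\<^sup>2 + s\<^sup>2) + r'\<^sup>2 * (c'\<^sup>2 + s'\<^sup>2) = 1"
    using q by (simp add: sum_klein 1(1,2) 2(1) q3 power_mult_distrib algebra_simps)
  then have 3: "r\<^sup>2 + r'\<^sup>2 = 1" by (simp add: 1 2)
  have "s * s = 1 - c * c" "s' * s' = 1 - c' * c'" "r' * r' = 1 - r * r"
    using 1(3) 2(3) 3 by (simp_all add: power2_eq_square)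
  then have reduce: "s * s = 1 - c * c" "s * (s * x) = (1 - c * c) * x"
    "s' * s' = 1 - c' * c'" "s' * (s' * x) = (1 - c' * c') * x"
    "r' * r' = 1 - r * r" "r' * (r' * x) = (1 - r * r) * x" for x
    by (simp_all flip: mult.assoc)
  show thesis
  \<comment> \<open>The first angle is the difference of the two polar phases and the third is their
    sum; the second is twice the angle with cosine \<open>r\<close> and sine
    \<open>r'\<close>.\<close>
  proof (rule that [of "(c * c' + s * s', s * c' - c * s')" "(r\<^sup>2 - r'\<^sup>2, 2 * r * r')"
        "(c * c' - s * s', s * c' + c * s')"])
    show "(fst (c * c' + s * s', s * c' - c * s'))\<^sup>2 + (snd (c * c' + s * s', s * c' - c * s'))\<^sup>2 = 1"
      "(fst (c * c' - s * s', s * c' + c * s'))\<^sup>2 + (snd (c * c' - s * s', s * c' + c * s'))\<^sup>2 = 1"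
      "(fst (r\<^sup>2 - r'\<^sup>2, 2 * r * r'))\<^sup>2 + (snd (r\<^sup>2 - r'\<^sup>2, 2 * r * r'))\<^sup>2 = 1"
      using 1(3) 2(3) 3 unfolding fst_conv snd_conv by algebra+
    show "(\<Sum>p\<in>UNIV. col_coeff l p *\<^sub>R (q (fst p) * q (snd p))) =
        euler (c * c' + s * s', s * c' - c * s') (r\<^sup>2 - r'\<^sup>2, 2 * r * r') (c * c' - s * s', s * c' + c * s')
          (fst l) (snd l)" for l
      unfolding sum_klein_pairs
      by (cases l; cases "fst l"; cases "snd l"; simp add: sum_klein euler_def col_coeff_def rot_coeff_def
          1(1,2) 2(1) q3; simp add: algebra_simps power2_eq_square reduce)
  qed
qed

lemma model_representation:
  fixes u v w :: "real \<times> real"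
  assumes "(fst u)\<^sup>2 + (snd u)\<^sup>2 = 1" "(fst v)\<^sup>2 + (snd v)\<^sup>2 = 1" "(fst w)\<^sup>2 + (snd w)\<^sup>2 = 1"
  obtains \<rho> where "star_hom \<rho>" "\<And>i j g h.
    apply_op (fourier (\<chi> i j. \<rho> (model_M $ i $ j)) i j) (axis (g, h, True) 1) =
      (euler u v w i j * (qsign i g * qsign j h)) *\<^sub>R axis (i + g, j + h, True) 1"
proof -
  \<comment> \<open>The images of \<open>proj_p\<close> and \<open>proj_q\<close> differ in the sign
    of \<open>s\<close>, so \<open>rmat\<close> receives the arguments \<open>c *\<^sub>R x\<close>
    and \<open>s *\<^sub>R y\<close>.\<close>
  have ex: "\<exists>h :: two_proj \<Rightarrow> 'a. star_hom h \<and> h proj_p = (1/2) *\<^sub>R (1 + (c *\<^sub>R x + s *\<^sub>R y)) \<and>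
      h proj_q = (1/2) *\<^sub>R (1 + (c *\<^sub>R x + (- s) *\<^sub>R y)) \<and>
      (\<forall>z d. d * x = x * d \<longrightarrow> d * y = y * d \<longrightarrow> d * h z = h z * d)"
    if "x * x = 1" "y * y = 1" "x * y = - (y * x)" "star x = x" "star y = y" "c\<^sup>2 + s\<^sup>2 = 1"
    for x y :: "'a::cstar_algebra" and c s
  proof -
    let ?p = "(1/2) *\<^sub>R (1 + (c *\<^sub>R x + s *\<^sub>R y))" and ?q = "(1/2) *\<^sub>R (1 + (c *\<^sub>R x + (- s) *\<^sub>R y))"
    have "?p * ?p = ?p" "star ?p = ?p" "?q * ?q = ?q" "star ?q = ?q"
      by (rule anticommuting_projection; simp add: that)+
    then obtain h where h: "star_hom h" "h proj_p = ?p" "h proj_q = ?q"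
      and comm: "\<And>z d. d * ?p = ?p * d \<Longrightarrow> d * ?q = ?q * d \<Longrightarrow> d * h z = h z * d"
      using two_proj_extension [of ?p ?q] by blast
    have "d * h z = h z * d" if "d * x = x * d" "d * y = y * d" for z d
      by (rule comm) (simp_all add: that algebra_simps)
    with h show ?thesis by blast
  qed
  obtain h1 :: "two_proj \<Rightarrow> (klein \<times> klein \<times> bool) op" where
    h1: "star_hom h1" "h1 proj_p = (1/2) *\<^sub>R (1 + (fst u *\<^sub>R spin K2 K0 True True + snd u *\<^sub>R spin K3 K0 True True))"
      "h1 proj_q = (1/2) *\<^sub>R (1 + (fst u *\<^sub>R spin K2 K0 True True + (- snd u) *\<^sub>R spin K3 K0 True True))"
    and c1: "\<And>z d. d * spin K2 K0 True True = spin K2 K0 True True * d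
        \<Longrightarrow> d * spin K3 K0 True True = spin K3 K0 True True * d
        \<Longrightarrow> d * h1 z = h1 z * d"
    using ex [of "spin K2 K0 True True" "spin K3 K0 True True" "fst u" "snd u"] assms
    by (simp add: spin_mult star_spin spin_one) blast
  obtain h2 :: "two_proj \<Rightarrow> (klein \<times> klein \<times> bool) op" where
    h2: "star_hom h2" "h2 proj_p = (1/2) *\<^sub>R (1 + (fst v *\<^sub>R spin K1 K2 True False + snd v *\<^sub>R spin K1 K2 False True))"
      "h2 proj_q = (1/2) *\<^sub>R (1 + (fst v *\<^sub>R spin K1 K2 True False + (- snd v) *\<^sub>R spin K1 K2 False True))"
    and c2: "\<And>z d. d * spin K1 K2 True False = spin K1 K2 True False * d
        \<Longrightarrow> d * spin K1 K2 False True = spin K1 K2 False True * d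
        \<Longrightarrow> d * h2 z = h2 z * d"
    using ex [of "spin K1 K2 True False" "spin K1 K2 False True" "fst v" "snd v"] assms
    by (simp add: spin_mult star_spin spin_one) blast
  obtain h3 :: "two_proj \<Rightarrow> (klein \<times> klein \<times> bool) op" where
    h3: "star_hom h3" "h3 proj_p = (1/2) *\<^sub>R (1 + (fst w *\<^sub>R spin K0 K1 True True + snd w *\<^sub>R spin K0 K3 True True))"
      "h3 proj_q = (1/2) *\<^sub>R (1 + (fst w *\<^sub>R spin K0 K1 True True + (- snd w) *\<^sub>R spin K0 K3 True True))"
    and c3: "\<And>z d. d * spin K0 K1 True True = spin K0 K1 True True * d
        \<Longrightarrow> d * spin K0 K3 True True = spin K0 K3 True True * d
        \<Longrightarrow> d * h3 z = h3 z * d"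
    using ex [of "spin K0 K1 True True" "spin K0 K3 True True" "fst w" "snd w"] assms
    by (simp add: spin_mult star_spin spin_one) blast
  have pq: "(1/2) *\<^sub>R (1 + (c *\<^sub>R x + s *\<^sub>R y)) + (1/2) *\<^sub>R (1 + (c *\<^sub>R x + (- s) *\<^sub>R y)) - 1 = c *\<^sub>R x"
    "(1/2) *\<^sub>R (1 + (c *\<^sub>R x + s *\<^sub>R y)) - (1/2) *\<^sub>R (1 + (c *\<^sub>R x + (- s) *\<^sub>R y)) = s *\<^sub>R y"
    for c s and x y :: "(klein \<times> klein \<times> bool) op"
    by (simp_all add: algebra_simps flip: scaleR_left_distrib)
  \<comment> \<open>Both ranges are reduced to their generating symmetries, whose signs in
    \<open>spin_mult\<close> agree in either order.\<close>
  have "h1 x * h2 y = h2 y * h1 x" for x y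
    by (rule c2; rule c1 [symmetric]; simp add: spin_mult)
  moreover have "h1 x * h3 y = h3 y * h1 x" for x y
    by (rule c3; rule c1 [symmetric]; simp add: spin_mult)
  moreover have "h2 x * h3 y = h3 y * h2 x" for x y
    by (rule c3; rule c2 [symmetric]; simp add: spin_mult)
  ultimately have comm: "h1 x * h2 y = h2 y * h1 x" "h1 x * h3 y = h3 y * h1 x" "h2 x * h3 y = h3 y * h2 x" for x y
    by blast+
  obtain h23 where h23: "star_hom h23" "\<And>x y. h23 (x \<otimes> y) = h2 x * h3 y"
    "\<And>z d. (\<And>x. d * h2 x = h2 x * d) \<Longrightarrow> (\<And>y. d * h3 y = h3 y * d) \<Longrightarrow> d * h23 z = h23 z * d"
    using tensor_extension [OF h2(1) h3(1) comm(3)] by blast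
  have "h1 x * h23 y = h23 y * h1 x" for x y by (rule h23(3)) (simp_all add: comm)
  then obtain \<rho> where \<rho>: "star_hom \<rho>" "\<And>x y. \<rho> (x \<otimes> y) = h1 x * h23 y"
    using tensor_extension [OF h1(1) h23(1)] by metis
  let ?R = "\<lambda>h. \<chi> i j. h (model_R $ i $ j)"
  have "(\<chi> i j. \<rho> (model_M $ i $ j)) =
      (\<chi> i j. \<Sum>k\<in>UNIV. ?R h1 $ i $ k * (\<chi> i j. \<Sum>l\<in>UNIV. ?R h2 $ i $ l * ?R h3 $ l $ j) $ k $ j)"
    by (simp add: model_M_def star_hom_sum [OF \<rho>(1)] \<rho>(2) h23(2) sum_distrib_left)
  then have "fourier (\<chi> i j. \<rho> (model_M $ i $ j)) i j =
      (\<Sum>k\<in>UNIV. fourier (?R h1) i k * (\<Sum>l\<in>UNIV. fourier (?R h2) k l * fourier (?R h3) l j))" for i j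
    by (simp only: fourier_mult)
  then have "fourier (\<chi> i j. \<rho> (model_M $ i $ j)) i j =
      (\<Sum>k\<in>UNIV. spin_rmat K2 K0 True True K3 K0 True True u i k *
        (\<Sum>l\<in>UNIV. spin_rmat K1 K2 True False K1 K2 False True v k l *
          spin_rmat K0 K1 True True K0 K3 True True w l j))" for i j
    unfolding fourier_model_R [OF h1(1)] fourier_model_R [OF h2(1)] fourier_model_R [OF h3(1)]
      h1(2,3) h2(2,3) h3(2,3) pq spin_rmat_def .
  then show thesis using that [OF \<rho>(1)] euler_action by simp
qed


section \<open>Fourier expansion of polynomials\<close>

definition expansion_index :: "(4 \<times> 4) free_alg \<Rightarrow> ((4 \<times> 4) word \<times> (klein \<times> klein) list) set"
  where "expansion_index P = (SIGMA w:Poly_Mapping.keys P. {u. length u = length (letters w)})"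

definition expansion_coeff :: "(4 \<times> 4) free_alg \<Rightarrow> (4 \<times> 4) word \<times> (klein \<times> klein) list \<Rightarrow> complex"
  where "expansion_coeff P j = Poly_Mapping.lookup P (fst j) * of_real (prod_list (map2
    (\<lambda>x p. klein_char (fst p) (fst x) * klein_char (snd p) (snd x) / 4) (letters (fst j)) (snd j)))"

text \<open>All words are padded to the same length by the letter \<open>(0, 0)\<close>, whose Fourier coefficient is \<open>1\<close>.\<close>

definition expansion_word :: "nat \<Rightarrow> (4 \<times> 4) word \<times> (klein \<times> klein) list \<Rightarrow> (klein \<times> klein) list"
  where "expansion_word n j = snd j @ replicate (n - length (snd j)) (K0, K0)"

lemma finite_expansion_index: "finite (expansion_index P)"
  unfolding expansion_index_def by (intro finite_SigmaI finite_lists_length) simp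

lemma length_expansion_word:
  assumes "j \<in> expansion_index P" shows "length (expansion_word (free_deg P) j) = free_deg P"
proof -
  have "length (letters w) \<le> free_deg P" if "w \<in> Poly_Mapping.keys P" for w
    unfolding free_deg_def using that by (intro Max_ge) auto
  then show ?thesis using assms by (auto simp: expansion_word_def expansion_index_def)
qed

lemma free_eval_expansion:
  fixes N :: "'a::cstar_algebra ^ 4 ^ 4"
  assumes "fourier N K0 K0 = 1"
  shows "free_eval (\<lambda>(i, j). N $ i $ j) P = (\<Sum>j\<in>expansion_index P.
    expansion_coeff P j *\<^sub>C prod_list (map (\<lambda>l. fourier N (fst l) (snd l)) (expansion_word n j)))"
proof -
  let ?a = "\<lambda>l. fourier N (fst l) (snd l)"
  let ?f = "\<lambda>x p. klein_char (fst p) (fst x) * klein_char (snd p) (snd x) / 4"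
  have pad: "prod_list (map ?a (u @ replicate m (K0, K0))) = prod_list (map ?a u)" for u m
    using assms by (induction m) simp_all
  have N: "(\<lambda>(i, j). N $ i $ j) = (\<lambda>x. \<Sum>p\<in>UNIV. ?f x p *\<^sub>R ?a p)"
    by (rule ext) (auto simp: fourier_inverse [of N])
  have "free_eval (\<lambda>(i, j). N $ i $ j) P = (\<Sum>w\<in>Poly_Mapping.keys P. \<Sum>u | length u = length (letters w).
      expansion_coeff P (w, u) *\<^sub>C prod_list (map ?a (expansion_word n (w, u))))"
    unfolding free_eval_def N prod_list_sum_expand
    by (simp add: expansion_coeff_def expansion_word_def pad scaleC_sum_right scaleR_scaleC scaleC_scaleC
        del: map_append)
  also have "\<dots> = (\<Sum>j\<in>expansion_index P. expansion_coeff P j *\<^sub>C prod_list (map ?a (expansion_word n j)))"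
    unfolding expansion_index_def
    by (subst sum.Sigma) (auto intro: finite_lists_length simp: split_def)
  finally show ?thesis .
qed

lemma apply_op_sum: "apply_op (\<Sum>i\<in>I. f i) v = (\<Sum>i\<in>I. apply_op (f i) v)"
  by (induction I rule: infinite_finite_induct) (simp_all add: apply_op_simps)

lemma word_action:
  fixes A :: "klein \<Rightarrow> klein \<Rightarrow> (klein \<times> klein \<times> bool) op"
  assumes "\<And>i j g h. apply_op (A i j) (axis (g, h, True) 1) =
      (x i j * (qsign i g * qsign j h)) *\<^sub>R axis (i + g, j + h, True) 1"
  shows "apply_op (prod_list (map (\<lambda>l. A (fst l) (snd l)) w)) (axis (K0, K0, True) 1) =
    (pair_sign w * prod_list (map (\<lambda>l. x (fst l) (snd l)) w)) *\<^sub>R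
      axis (fst (pair_deg w), snd (pair_deg w), True) 1"
  by (induction w) (simp_all add: apply_op_simps assms pair_sign_def pair_deg_def mult_ac)

text \<open>A word of degree \<open>d\<close> moves the basis vector at
  \<open>(K0, K0, True)\<close> to a multiple of the one at \<open>d\<close>, so reading one
  component isolates one degree.\<close>

lemma word_action_coefficients:
  fixes A :: "klein \<Rightarrow> klein \<Rightarrow> (klein \<times> klein \<times> bool) op"
  assumes A: "\<And>i j g h. apply_op (A i j) (axis (g, h, True) 1) =
      (x i j * (qsign i g * qsign j h)) *\<^sub>R axis (i + g, j + h, True) 1"
    and J: "finite J" and 0: "(\<Sum>j\<in>J. c j *\<^sub>C prod_list (map (\<lambda>l. A (fst l) (snd l)) (w j))) = 0"
  shows "(\<Sum>j | j \<in> J \<and> pair_deg (w j) = d.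
    c j * of_real (pair_sign (w j) * prod_list (map (\<lambda>l. x (fst l) (snd l)) (w j)))) = 0"
proof -
  let ?s = "\<lambda>j. of_real (pair_sign (w j) * prod_list (map (\<lambda>l. x (fst l) (snd l)) (w j))) :: complex"
  have "0 = apply_op (\<Sum>j\<in>J. c j *\<^sub>C prod_list (map (\<lambda>l. A (fst l) (snd l)) (w j))) (axis (K0, K0, True) 1)
      $ (fst d, snd d, True)"
    by (simp add: 0 apply_op_simps)
  also have "\<dots> = (\<Sum>j\<in>J. if pair_deg (w j) = d then c j * ?s j else 0)"
    unfolding apply_op_sum sum_component
  proof (rule sum.cong [OF refl])
    fix j
    show "apply_op (c j *\<^sub>C prod_list (map (\<lambda>l. A (fst l) (snd l)) (w j))) (axis (K0, K0, True) 1)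
        $ (fst d, snd d, True) = (if pair_deg (w j) = d then c j * ?s j else 0)"
      unfolding apply_op_simps word_action [of A x, OF A]
      by (auto simp: axis_def prod_eq_iff scaleR_conv_of_real [where 'a = complex])
  qed
  also have "\<dots> = (\<Sum>j | j \<in> J \<and> pair_deg (w j) = d. c j * ?s j)"
    using J by (simp add: sum.If_cases Int_def)
  finally show ?thesis by simp
qed


theorem corollary6p1:
  fixes P :: "(4 \<times> 4) free_alg"
  assumes "free_deg P \<le> 50"
  shows "free_eval (\<lambda>(i, j). model_M $ i $ j) P = 0 \<longleftrightarrow>
    free_eval (\<lambda>(i, j). (quantum_perm_u :: 4 quantum_perm ^ 4 ^ 4) $ i $ j) P = 0"
proof
  assume u: "free_eval (\<lambda>(i, j). (quantum_perm_u :: 4 quantum_perm ^ 4 ^ 4) $ i $ j) P = 0"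
  obtain h where h: "star_hom h" "\<And>i j. h ((quantum_perm_u :: 4 quantum_perm ^ 4 ^ 4) $ i $ j) = model_M $ i $ j"
    using magic_unitary_extension [OF magic_unitary_model_M] by blast
  have "h \<circ> (\<lambda>(i, j). quantum_perm_u $ i $ j) = (\<lambda>(i, j). model_M $ i $ j)"
    by (auto simp: h(2))
  then show "free_eval (\<lambda>(i, j). model_M $ i $ j) P = 0"
    using star_hom_free_eval [OF h(1)] u star_homD(6) [OF h(1)] by metis
next
  assume M: "free_eval (\<lambda>(i, j). model_M $ i $ j) P = 0"
  let ?u = "quantum_perm_u :: 4 quantum_perm ^ 4 ^ 4"
  let ?J = "expansion_index P" and ?c = "expansion_coeff P" and ?w = "expansion_word (free_deg P)"
  have u: "twisted (fourier ?u)" by (rule twisted_fourier [OF magic_unitary_quantum_perm_u])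
  have "(\<Sum>j\<in>?J. ?c j *\<^sub>C prod_list (map (\<lambda>l. fourier ?u (fst l) (snd l)) (?w j))) = 0"
  proof (rule twisted_words_vanish_sphere [OF u finite_expansion_index length_expansion_word])
    fix q :: "klein \<Rightarrow> real" and d
    assume unit: "(\<Sum>i\<in>UNIV. (q i)\<^sup>2) = 1"
    obtain x y z where xyz: "(fst x)\<^sup>2 + (snd x)\<^sup>2 = 1" "(fst y)\<^sup>2 + (snd y)\<^sup>2 = 1" "(fst z)\<^sup>2 + (snd z)\<^sup>2 = 1"
      and q: "\<And>l. (\<Sum>p\<in>UNIV. col_coeff l p *\<^sub>R (q (fst p) * q (snd p))) = euler x y z (fst l) (snd l)"
      using ex_euler [OF unit] by blast
    \<comment> \<open>The rotation of \<open>q\<close> is realised by a representation of the model,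
      which carries \<open>P(M) = 0\<close> to a relation evaluated at \<open>q\<close>.\<close>
    obtain \<rho> where \<rho>: "star_hom \<rho>" and act: "\<And>i j g h.
        apply_op (fourier (\<chi> i j. \<rho> (model_M $ i $ j)) i j) (axis (g, h, True) 1) =
          (euler x y z i j * (qsign i g * qsign j h)) *\<^sub>R axis (i + g, j + h, True) 1"
      using model_representation [OF xyz] by blast
    define N where "N = (\<chi> i j. \<rho> (model_M $ i $ j))"
    \<comment> \<open>This yields the value \<open>1\<close> for the padding letter.\<close>
    have "magic_unitary N"
      using magic_unitary_model_M
      by (simp add: N_def magic_unitary_def star_homD(4) [OF \<rho>] flip: star_homD(3,5) [OF \<rho>] star_hom_sum [OF \<rho>])
    then have "fourier N K0 K0 = 1" using twisted_fourier by (auto simp: twisted_def)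
    note expand = free_eval_expansion [OF this, of P "free_deg P"]
    have "\<rho> \<circ> (\<lambda>(i, j). model_M $ i $ j) = (\<lambda>(i, j). N $ i $ j)" by (auto simp: N_def)
    then have "free_eval (\<lambda>(i, j). N $ i $ j) P = 0"
      using star_hom_free_eval [OF \<rho>] M star_homD(6) [OF \<rho>] by metis
    from word_action_coefficients [OF act [folded N_def] finite_expansion_index this [unfolded expand]]
    show "(\<Sum>j | j \<in> ?J \<and> pair_deg (?w j) = d. ?c j * of_real (pair_sign (?w j) *
        prod_list (map (\<lambda>l. \<Sum>p\<in>UNIV. col_coeff l p *\<^sub>R (q (fst p) * q (snd p))) (?w j)))) = 0"
      unfolding q .
  qed
  moreover have "fourier ?u K0 K0 = 1" using u by (simp add: twisted_def)
  ultimately show "free_eval (\<lambda>(i, j). ?u $ i $ j) P = 0"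
    by (simp add: free_eval_expansion [where n = "free_deg P"])
qed

end
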